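(* Assume that $\delta_3>\frac{1}{2\kappa_3}$ and $|\delta_2|<\frac{1}{\kappa_3}\sqrt{2\kappa_3\delta_3-1}$. Then the semigroup $e^{t\mathcal{A}_1}$ is exponentially stable on $\mathcal{H}_1$: there exist constants $M>0$ and $\epsilon>0$ such that $$\|e^{t\mathcal{A}_1}\mathtt{U}_0\|_{\mathcal{H}_1}\le M e^{-\epsilon t}\|\mathtt{U}_0\|_{\mathcal{H}_1},\qquad \forall t>0,\ \forall\,\mathtt{U}_0\in\mathcal{H}_1.$$
   Context: Fix real numbers $0<\beta<L$, $\tau>0$, $\kappa_2,\kappa_3>0$, $\delta_1>0$, $\delta_3>0$ and $\delta_2\in\mathbb{R}\setminus\{0\}$. All functions are complex-valued. Let $\mathbb{X}^m=H^m(0,\beta)\times H^m(\beta,L)$ for $m=1,2$, $\mathbb{X}^0=L^2(0,\beta)\times L^2(\beta,L)$ and $\mathbb{X}^1_L=\{(v,w)\in\mathbb{X}^1: v(0)=0,\ v(\beta)=w(\beta)\}$. The energy space is $\mathcal{H}_1=\mathbb{X}^1_L\times\mathbb{X}^0\times L^2(0,1)$, with elements written $\mathtt{U}=(v,w,z,\phi,\eta(L,\cdot))$ (the last component is a function $\rho\mapsto\eta(L,\rho)$ on $(0,1)$; $L$ is only a label there) and Hilbert norm $$\|\mathtt{U}\|_{\mathcal{H}_1}^2=\kappa_2\int_0^\beta|v_x|^2dx+\kappa_3\int_\beta^L|w_x|^2dx+\int_0^\beta|z|^2dx+\int_\beta^L|\phi|^2dx+\tau\int_0^1|\eta(L,\rho)|^2d\rho.$$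 The operator $\mathcal{A}_1:D(\mathcal{A}_1)\subset\mathcal{H}_1\to\mathcal{H}_1$ has domain $$D(\mathcal{A}_1)=\{(v,w,z,\phi,\eta(L,\cdot))\in\mathbb{X}^1_L\times\mathbb{X}^1_L\times H^1(0,1):\ (\kappa_2v+\delta_1z,w)\in\mathbb{X}^2,\ \kappa_2v_x(\beta)+\delta_1z_x(\beta)=\kappa_3w_x(\beta),$$ $$w_x(L)=-\delta_3\eta(L,0)-\delta_2\eta(L,1),\ \phi(L)=\eta(L,0)\},$$ where $\kappa_2v_x(\beta)+\delta_1z_x(\beta)$ denotes the value at $\beta$ of $(\kappa_2v+\delta_1z)_x$, and $$\mathcal{A}_1\mathtt{U}=\left(z,\phi,(\kappa_2v_x+\delta_1z_x)_x,\kappa_3w_{xx},-\tau^{-1}\eta_\rho(L,\cdot)\right).$$ Under the stated hypotheses $\mathcal{A}_1$ generates a $C_0$-semigroup of contractions $e^{t\mathcal{A}_1}$ on $\mathcal{H}_1$. The Cauchy problem $\mathtt{U}_t=\mathcal{A}_1\mathtt{U}$, $\mathtt{U}(0)=\mathtt{U}_0$, is the first-order form of $v_{tt}-(\kappa_2v_x+\delta_1v_{xt})_x=0$ on $(0,\beta)$, $w_{tt}-\kappa_3w_{xx}=0$ on $(\beta,L)$, $v(0,t)=0$, $v(\beta,t)=w(\beta,t)$, $\kappa_2v_x(\beta,t)+\delta_1v_{xt}(\beta,t)=\kappa_3w_x(\beta,t)$, $w_x(L,t)=-\delta_3w_t(L,t)-\delta_2w_t(L,t-\tau)$, with $(z,\phi)=(v_t,w_t)$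 and $\eta(L,\rho,t)=w_t(L,t-\rho\tau)$. *)

theory Defs
  imports "HOL-Analysis.Analysis"
begin

section \<open>Complex vector spaces\<close>

class complex_vector = real_vector +
  fixes scaleC :: "complex \<Rightarrow> 'a \<Rightarrow> 'a"  (infixr "*\<^sub>C" 75)
  assumes scaleC_add_right: "c *\<^sub>C (x + y) = c *\<^sub>C x + c *\<^sub>C y"
    and scaleC_add_left: "(c + d) *\<^sub>C x = c *\<^sub>C x + d *\<^sub>C x"
    and scaleC_scaleC: "c *\<^sub>C (d *\<^sub>C x) = (c * d) *\<^sub>C x"
    and scaleC_one: "1 *\<^sub>C x = x"
    and scaleR_scaleC: "r *\<^sub>R x = complex_of_real r *\<^sub>C x"

instantiation prod :: (complex_vector, complex_vector) complex_vector
begin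

definition scaleC_prod :: "complex \<Rightarrow> 'a \<times> 'b \<Rightarrow> 'a \<times> 'b" where
  "scaleC_prod c p = (c *\<^sub>C fst p, c *\<^sub>C snd p)"

instance
  by standard
    (simp_all add: scaleC_prod_def prod_eq_iff scaleC_add_right scaleC_add_left
      scaleC_scaleC scaleC_one scaleR_scaleC)

end


section \<open>Measurable functions modulo equality almost everywhere\<close>

definition ae_eq :: "(real \<Rightarrow> complex) \<Rightarrow> (real \<Rightarrow> complex) \<Rightarrow> bool" where
  "ae_eq f g \<longleftrightarrow> f \<in> borel_measurable lborel \<and> g \<in> borel_measurable lborel \<and>
     (AE x in lborel. f x = g x)"

quotient_type mfun = "real \<Rightarrow> complex" / partial: ae_eq
proof (rule part_equivpI)
  show "\<exists>f. ae_eq f f"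
    by (rule exI[of _ "\<lambda>_. 0"]) (simp add: ae_eq_def)
  show "symp ae_eq"
    by (auto simp: symp_def ae_eq_def)
  show "transp ae_eq"
    unfolding transp_def ae_eq_def by (auto elim: AE_mp)
qed

instantiation mfun :: complex_vector
begin

lift_definition zero_mfun :: mfun is "\<lambda>_. 0"
  by (simp add: ae_eq_def)

lift_definition plus_mfun :: "mfun \<Rightarrow> mfun \<Rightarrow> mfun" is "\<lambda>f g x. f x + g x"
  unfolding ae_eq_def by auto

lift_definition uminus_mfun :: "mfun \<Rightarrow> mfun" is "\<lambda>f x. - f x"
  unfolding ae_eq_def by auto

lift_definition minus_mfun :: "mfun \<Rightarrow> mfun \<Rightarrow> mfun" is "\<lambda>f g x. f x - g x"
  unfolding ae_eq_def by auto

lift_definition scaleR_mfun :: "real \<Rightarrow> mfun \<Rightarrow> mfun" is "\<lambda>r f x. r *\<^sub>R f x"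
  unfolding ae_eq_def by auto

lift_definition scaleC_mfun :: "complex \<Rightarrow> mfun \<Rightarrow> mfun" is "\<lambda>c f x. c * f x"
  unfolding ae_eq_def by auto

instance
  by standard
    (transfer; auto simp: ae_eq_def algebra_simps scaleR_conv_of_real)+

end


section \<open>Lebesgue and Sobolev spaces on a bounded interval\<close>

text \<open>
  An element of \<open>L\<^sup>2(a,b)\<close> is represented by its extension by zero to the real line, so that
  the function spaces over all intervals live in one type and equality is equality almost everywhere.
\<close>

lift_definition in_L2 :: "real \<Rightarrow> real \<Rightarrow> mfun \<Rightarrow> bool" is
  "\<lambda>a b f. (AE x in lborel. x \<notin> {a<..<b} \<longrightarrow> f x = 0) \<and>
     set_integrable lborel {a<..<b} (\<lambda>x. (cmod (f x))\<^sup>2)"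
proof -
  have *: "(AE x in lborel. x \<notin> {a<..<b} \<longrightarrow> g x = 0) \<and>
      set_integrable lborel {a<..<b} (\<lambda>x. (cmod (g x))\<^sup>2)"
    if eq: "ae_eq f g"
      and f: "(AE x in lborel. x \<notin> {a<..<b} \<longrightarrow> f x = 0) \<and>
        set_integrable lborel {a<..<b} (\<lambda>x. (cmod (f x))\<^sup>2)"
    for a b :: real and f g :: "real \<Rightarrow> complex"
  proof
    have ae: "AE x in lborel. f x = g x"
      and [measurable]: "f \<in> borel_measurable lborel" "g \<in> borel_measurable lborel"
      using eq by (auto simp: ae_eq_def)
    show "AE x in lborel. x \<notin> {a<..<b} \<longrightarrow> g x = 0"
      using ae conjunct1[OF f] by eventually_elim auto
    show "set_integrable lborel {a<..<b} (\<lambda>x. (cmod (g x))\<^sup>2)"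
      using conjunct2[OF f] unfolding set_integrable_def
      by (rule integrable_cong_AE_imp) (use ae in auto)
  qed
  have sym: "ae_eq g f" if "ae_eq f g" for f g
    using that by (auto simp: ae_eq_def)
  show "((AE x in lborel. x \<notin> {a<..<b} \<longrightarrow> f x = 0) \<and>
      set_integrable lborel {a<..<b} (\<lambda>x. (cmod (f x))\<^sup>2)) =
    ((AE x in lborel. x \<notin> {a<..<b} \<longrightarrow> g x = 0) \<and>
      set_integrable lborel {a<..<b} (\<lambda>x. (cmod (g x))\<^sup>2))"
    if "ae_eq f g" for a b :: real and f g :: "real \<Rightarrow> complex"
    using *[OF that] *[OF sym[OF that]] by blast
qed

definition L2 :: "real \<Rightarrow> real \<Rightarrow> mfun set" where
  "L2 a b = {f. in_L2 a b f}"

lift_definition L2_sqnorm :: "real \<Rightarrow> real \<Rightarrow> mfun \<Rightarrow> real" is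
  "\<lambda>a b f. LINT x:{a<..<b}|lborel. (cmod (f x))\<^sup>2"
  unfolding ae_eq_def set_lebesgue_integral_def by (intro integral_cong_AE) auto

definition C1_test_functions :: "real \<Rightarrow> real \<Rightarrow> (real \<Rightarrow> complex) set" where
  "C1_test_functions a b = {\<psi>. \<psi> C1_differentiable_on UNIV \<and>
     (\<exists>c d. a < c \<and> d < b \<and> (\<forall>x. x \<notin> {c..d} \<longrightarrow> \<psi> x = 0))}"

lemma C1_test_functions_measurable:
  assumes "\<psi> \<in> C1_test_functions a b"
  shows "\<psi> \<in> borel_measurable lborel"
    and "(\<lambda>x. vector_derivative \<psi> (at x)) \<in> borel_measurable lborel"
proof -
  have C1: "\<psi> C1_differentiable_on UNIV"
    using assms by (simp add: C1_test_functions_def)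
  show "\<psi> \<in> borel_measurable lborel"
    using C1_differentiable_imp_continuous_on[OF C1]
    by (simp add: borel_measurable_continuous_onI)
  show "(\<lambda>x. vector_derivative \<psi> (at x)) \<in> borel_measurable lborel"
    using C1 by (simp add: C1_differentiable_on_eq borel_measurable_continuous_onI)
qed

text \<open>In one dimension, test functions of class \<open>C\<^sup>1\<close> and \<open>C\<^sup>\<infinity>\<close> give the same weak derivative.\<close>

lift_definition has_weak_deriv :: "real \<Rightarrow> real \<Rightarrow> mfun \<Rightarrow> mfun \<Rightarrow> bool" is
  "\<lambda>a b f g. \<forall>\<psi>\<in>C1_test_functions a b.
     (LINT x:{a<..<b}|lborel. f x * vector_derivative \<psi> (at x)) =
     - (LINT x:{a<..<b}|lborel. g x * \<psi> x)"
proof -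
  have I: "(LINT x:{a<..<b}|lborel. f x * h x) = (LINT x:{a<..<b}|lborel. f' x * h x)"
    if eq: "ae_eq f f'" and [measurable]: "h \<in> borel_measurable lborel"
    for a b :: real and f f' h
  proof -
    have ae: "AE x in lborel. f x = f' x"
      and [measurable]: "f \<in> borel_measurable lborel" "f' \<in> borel_measurable lborel"
      using eq by (auto simp: ae_eq_def)
    show ?thesis
      unfolding set_lebesgue_integral_def
      by (rule integral_cong_AE) (use ae in auto)
  qed
  show "(\<forall>\<psi>\<in>C1_test_functions a b.
      (LINT x:{a<..<b}|lborel. f x * vector_derivative \<psi> (at x)) =
      - (LINT x:{a<..<b}|lborel. g x * \<psi> x)) =
    (\<forall>\<psi>\<in>C1_test_functions a b.
      (LINT x:{a<..<b}|lborel. f' x * vector_derivative \<psi> (at x)) =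
      - (LINT x:{a<..<b}|lborel. g' x * \<psi> x))"
    if "ae_eq f f'" "ae_eq g g'" for a b :: real and f f' g g'
    by (intro ball_cong refl)
      (simp add: I[OF that(1) C1_test_functions_measurable(2)]
        I[OF that(2) C1_test_functions_measurable(1)])
qed

definition weak_deriv :: "real \<Rightarrow> real \<Rightarrow> mfun \<Rightarrow> mfun" where
  "weak_deriv a b f = (THE g. g \<in> L2 a b \<and> has_weak_deriv a b f g)"

definition H1 :: "real \<Rightarrow> real \<Rightarrow> mfun set" where
  "H1 a b = {f \<in> L2 a b. \<exists>g\<in>L2 a b. has_weak_deriv a b f g}"

definition H2 :: "real \<Rightarrow> real \<Rightarrow> mfun set" where
  "H2 a b = {f \<in> H1 a b. weak_deriv a b f \<in> H1 a b}"

lift_definition has_continuous_rep :: "real \<Rightarrow> real \<Rightarrow> mfun \<Rightarrow> (real \<Rightarrow> complex) \<Rightarrow> bool" is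
  "\<lambda>a b f g. continuous_on {a..b} g \<and> (AE x in lborel. x \<in> {a<..<b} \<longrightarrow> f x = g x)"
proof -
  have *: "AE x in lborel. x \<in> {a<..<b} \<longrightarrow> f' x = g x"
    if "ae_eq f f'" "AE x in lborel. x \<in> {a<..<b} \<longrightarrow> f x = g x"
    for a b :: real and f f' g :: "real \<Rightarrow> complex"
    using conjunct2[OF conjunct2[OF that(1)[unfolded ae_eq_def]]] that(2)
    by eventually_elim auto
  have sym: "ae_eq g f" if "ae_eq f g" for f g
    using that by (auto simp: ae_eq_def)
  show "(\<lambda>g. continuous_on {a..b} g \<and> (AE x in lborel. x \<in> {a<..<b} \<longrightarrow> f x = g x)) =
    (\<lambda>g. continuous_on {a..b} g \<and> (AE x in lborel. x \<in> {a<..<b} \<longrightarrow> f' x = g x))"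
    if "ae_eq f f'" for a b :: real and f f' :: "real \<Rightarrow> complex"
    using *[OF that] *[OF sym[OF that]] by blast
qed

text \<open>Point values, end points included, are those of the representative continuous on \<open>[a,b]\<close>.\<close>

definition point_value :: "real \<Rightarrow> real \<Rightarrow> mfun \<Rightarrow> real \<Rightarrow> complex" where
  "point_value a b f x = (THE y. \<exists>g. has_continuous_rep a b f g \<and> y = g x)"


section \<open>Semigroups of bounded linear operators\<close>

text \<open>
  The Hilbert space is a linear subspace \<open>X\<close> of a complex vector space with norm \<open>N\<close>.
  The values of \<open>S t\<close> for \<open>t < 0\<close> and outside \<open>X\<close> are irrelevant.
\<close>

definition C0_semigroup ::
  "'a::complex_vector set \<Rightarrow> ('a \<Rightarrow> real) \<Rightarrow> (real \<Rightarrow> 'a \<Rightarrow> 'a) \<Rightarrow> bool" where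
  "C0_semigroup X N S \<longleftrightarrow>
     (\<forall>t\<ge>0. (\<forall>u\<in>X. S t u \<in> X) \<and>
        (\<forall>u\<in>X. \<forall>v\<in>X. S t (u + v) = S t u + S t v) \<and>
        (\<forall>c. \<forall>u\<in>X. S t (c *\<^sub>C u) = c *\<^sub>C S t u) \<and>
        (\<exists>C. \<forall>u\<in>X. N (S t u) \<le> C * N u)) \<and>
     (\<forall>u\<in>X. S 0 u = u) \<and>
     (\<forall>s\<ge>0. \<forall>t\<ge>0. \<forall>u\<in>X. S (s + t) u = S s (S t u)) \<and>
     (\<forall>u\<in>X. ((\<lambda>t. N (S t u - u)) \<longlongrightarrow> 0) (at_right 0))"

text \<open>The infinitesimal generator, as the graph of an operator.\<close>

definition generator ::
  "'a::complex_vector set \<Rightarrow> ('a \<Rightarrow> real) \<Rightarrow> (real \<Rightarrow> 'a \<Rightarrow> 'a) \<Rightarrow> ('a \<times> 'a) set" where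
  "generator X N S = {(u, v). u \<in> X \<and> v \<in> X \<and>
     ((\<lambda>t. N ((1 / t) *\<^sub>R (S t u - u) - v)) \<longlongrightarrow> 0) (at_right 0)}"

definition generates_C0_semigroup ::
  "'a::complex_vector set \<Rightarrow> ('a \<Rightarrow> real) \<Rightarrow> 'a set \<Rightarrow> ('a \<Rightarrow> 'a) \<Rightarrow> (real \<Rightarrow> 'a \<Rightarrow> 'a) \<Rightarrow> bool" where
  "generates_C0_semigroup X N D A S \<longleftrightarrow>
     C0_semigroup X N S \<and> generator X N S = {(u, A u) | u. u \<in> D}"


section \<open>The wave equation with Kelvin-Voigt damping and delayed boundary feedback\<close>

type_synonym state = "mfun \<times> mfun \<times> mfun \<times> mfun \<times> mfun"

definition X0 :: "real \<Rightarrow> real \<Rightarrow> (mfun \<times> mfun) set" where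
  "X0 \<beta> L = L2 0 \<beta> \<times> L2 \<beta> L"

definition X1 :: "real \<Rightarrow> real \<Rightarrow> (mfun \<times> mfun) set" where
  "X1 \<beta> L = H1 0 \<beta> \<times> H1 \<beta> L"

definition X2 :: "real \<Rightarrow> real \<Rightarrow> (mfun \<times> mfun) set" where
  "X2 \<beta> L = H2 0 \<beta> \<times> H2 \<beta> L"

definition X1L :: "real \<Rightarrow> real \<Rightarrow> (mfun \<times> mfun) set" where
  "X1L \<beta> L = {(v, w) \<in> X1 \<beta> L.
     point_value 0 \<beta> v 0 = 0 \<and> point_value 0 \<beta> v \<beta> = point_value \<beta> L w \<beta>}"

definition energy_space :: "real \<Rightarrow> real \<Rightarrow> state set" where
  "energy_space \<beta> L = {(v, w, z, \<phi>, \<eta>).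
     (v, w) \<in> X1L \<beta> L \<and> (z, \<phi>) \<in> X0 \<beta> L \<and> \<eta> \<in> L2 0 1}"

definition energy_norm ::
  "real \<Rightarrow> real \<Rightarrow> real \<Rightarrow> real \<Rightarrow> real \<Rightarrow> state \<Rightarrow> real" where
  "energy_norm \<beta> L \<tau> \<kappa>2 \<kappa>3 = (\<lambda>(v, w, z, \<phi>, \<eta>).
     sqrt (\<kappa>2 * L2_sqnorm 0 \<beta> (weak_deriv 0 \<beta> v) + \<kappa>3 * L2_sqnorm \<beta> L (weak_deriv \<beta> L w)
       + L2_sqnorm 0 \<beta> z + L2_sqnorm \<beta> L \<phi> + \<tau> * L2_sqnorm 0 1 \<eta>))"

definition dom_A ::
  "real \<Rightarrow> real \<Rightarrow> real \<Rightarrow> real \<Rightarrow> real \<Rightarrow> real \<Rightarrow> real \<Rightarrow> state set" where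
  "dom_A \<beta> L \<kappa>2 \<kappa>3 \<delta>1 \<delta>2 \<delta>3 = {(v, w, z, \<phi>, \<eta>).
     (v, w) \<in> X1L \<beta> L \<and> (z, \<phi>) \<in> X1L \<beta> L \<and> \<eta> \<in> H1 0 1 \<and>
     (\<kappa>2 *\<^sub>R v + \<delta>1 *\<^sub>R z, w) \<in> X2 \<beta> L \<and>
     point_value 0 \<beta> (weak_deriv 0 \<beta> (\<kappa>2 *\<^sub>R v + \<delta>1 *\<^sub>R z)) \<beta>
       = of_real \<kappa>3 * point_value \<beta> L (weak_deriv \<beta> L w) \<beta> \<and>
     point_value \<beta> L (weak_deriv \<beta> L w) L
       = - of_real \<delta>3 * point_value 0 1 \<eta> 0 - of_real \<delta>2 * point_value 0 1 \<eta> 1 \<and>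
     point_value \<beta> L \<phi> L = point_value 0 1 \<eta> 0}"

definition op_A ::
  "real \<Rightarrow> real \<Rightarrow> real \<Rightarrow> real \<Rightarrow> real \<Rightarrow> real \<Rightarrow> state \<Rightarrow> state" where
  "op_A \<beta> L \<tau> \<kappa>2 \<kappa>3 \<delta>1 = (\<lambda>(v, w, z, \<phi>, \<eta>).
     (z, \<phi>,
      weak_deriv 0 \<beta> (\<kappa>2 *\<^sub>R weak_deriv 0 \<beta> v + \<delta>1 *\<^sub>R weak_deriv 0 \<beta> z),
      \<kappa>3 *\<^sub>R weak_deriv \<beta> L (weak_deriv \<beta> L w),
      - (1 / \<tau>) *\<^sub>R weak_deriv 0 1 \<eta>))"

end

(*
  A Lyapunov argument.  Let E be half the squared energy norm.  On the domain of the generator, integration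
  by parts gives E' = - delta1 |z_x|^2 - q(eta(0), eta(1)), and the conditions on delta2 and delta3 say
  exactly that the quadratic form q is positive definite.  The dissipation thus controls z_x, phi(L) and w_x(L).
  The remaining terms of the energy are recovered from the multipliers (x - beta) w_x on (beta, L), (v, w) on
  the whole string, and the weight (2 - rho) for the delay variable: adding these three bounded quadratic
  forms to a large multiple of the energy yields an equivalent functional V with V' <= - c V.

  A C0-semigroup is only assumed to have bounded operators and to be strongly right continuous at 0.
  Differentiating V along trajectories therefore needs uniform boundedness, hence completeness of the energy
  space.  The decay is extended from the domain to the whole space by density.
*)
theory Submission
  imports Defs
begin

text \<open>\<open>weak_deriv\<close> and \<open>point_value\<close> are definite descriptions over
  equivalence classes, so no boundary term can be computed before uniqueness is known. This explains
  the weight of the analytic half: du Bois-Reymond turns a weak derivative into a genuine primitive,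
  and integration by parts for primitives is Fubini on two triangles, with no differentiation almost
  everywhere. There the kinetic energy is bounded by the dissipation through Poincare for z, and v_x
  is recovered from the multiplier v, paired with the stress only. The multiplier (x - \<beta>) w_x
  vanishes at the interface, so that it leaves boundary terms at L alone, which the dissipation
  controls. The form of (v, w) carries weight 1/2 against weight 2 of the first one: the term
  +|\<phi>|^2 which it creates is then half of what the first one removes. The weight 2 - \<rho> has
  slope -1, which produces the missing norm of the delay variable.\<close>

section \<open>Absolutely continuous functions\<close>

text \<open>Integration by parts in disguise: the triangles s < y and y < s fill the plane up to the
  null diagonal, and Fubini on each of them yields a product of one function with a primitive of the
  other.\<close>

lemma integral_triangles:
  fixes f g :: "real \<Rightarrow> complex"
  assumes f: "integrable lborel f" and g: "integrable lborel g"
  shows "integrable lborel (\<lambda>y. f y * (LINT s:{..<y}|lborel. g s))"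
    and "integrable lborel (\<lambda>s. g s * (LINT y:{..<s}|lborel. f y))"
    and "(LINT y|lborel. f y * (LINT s:{..<y}|lborel. g s)) + (LINT s|lborel. g s * (LINT y:{..<s}|lborel. f y))
     = (LINT y|lborel. f y) * (LINT s|lborel. g s)"
proof -
  have [measurable]: "f \<in> borel_measurable borel" "g \<in> borel_measurable borel" using f g by auto
  have int: "integrable (lborel \<Otimes>\<^sub>M lborel) (\<lambda>(x, y). p x * q y)"
    if [simp]: "integrable lborel p" "integrable lborel q" for p q :: "real \<Rightarrow> complex"
  proof -
    have [measurable]: "p \<in> borel_measurable borel" "q \<in> borel_measurable borel"
      using that[THEN borel_measurable_integrable] by (simp_all only: measurable_lborel2)
    show ?thesis
    proof (rule lborel_pair.Fubini_integrable)
      show "integrable lborel (\<lambda>x. LINT y|lborel. norm ((\<lambda>(x, y). p x * q y) (x, y)))"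
        by (simp add: norm_mult)
    qed (auto)
  qed
  have int': "integrable (lborel \<Otimes>\<^sub>M lborel) (\<lambda>(x, y). indicator {..<x} y *\<^sub>R (p x * q y))"
    if [simp]: "integrable lborel p" "integrable lborel q" for p q :: "real \<Rightarrow> complex"
  proof -
    have [measurable]: "p \<in> borel_measurable borel" "q \<in> borel_measurable borel"
      using that[THEN borel_measurable_integrable] by (simp_all only: measurable_lborel2)
    have "integrable (lborel \<Otimes>\<^sub>M lborel)
        (\<lambda>z. indicator {z. snd z < fst z} z *\<^sub>R (\<lambda>(x, y). p x * q y) z)"
    proof (intro integrable_mult_indicator int that)
      have "Measurable.pred (borel \<Otimes>\<^sub>M borel) (\<lambda>z :: real \<times> real. snd z < fst z)" by measurable
      thus "{z :: real \<times> real. snd z < fst z} \<in> sets (lborel \<Otimes>\<^sub>M lborel)"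
        by (simp add: pred_def space_pair_measure)
    qed
    moreover have "(\<lambda>z. indicator {z. snd z < fst z} z *\<^sub>R (\<lambda>(x, y). p x * q y) z)
       = (\<lambda>(x, y). indicator {..<x} y *\<^sub>R (p x * q y))"
      by (auto simp: fun_eq_iff split: split_indicator)
    ultimately show ?thesis by simp
  qed
  have inner: "(LINT y|lborel. indicator {..<x} y *\<^sub>R (p x * q y)) = p x * (LINT y:{..<x}|lborel. q y)"
    if "integrable lborel q" for p q :: "real \<Rightarrow> complex" and x
  proof -
    have "(\<lambda>y. indicator {..<x} y *\<^sub>R (p x * q y)) = (\<lambda>y. p x * (indicator {..<x} y *\<^sub>R q y))" by auto
    thus ?thesis by (simp only: set_lebesgue_integral_def integral_mult_right_zero)
  qed
  show 1: "integrable lborel (\<lambda>y. f y * (LINT s:{..<y}|lborel. g s))"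
    using lborel_pair.integrable_fst'[OF int'[OF f g]] by (simp add: inner g)
  show 2: "integrable lborel (\<lambda>s. g s * (LINT y:{..<s}|lborel. f y))"
    using lborel_pair.integrable_fst'[OF int'[OF g f]] by (simp add: inner f)
  have inner': "(LINT x|lborel. indicator {..<x} y *\<^sub>R (f x * g y)) = g y * (LINT x:{y<..}|lborel. f x)" for y
  proof -
    have "(\<lambda>x. indicator {..<x} y *\<^sub>R (f x * g y)) = (\<lambda>x. g y * (indicator {y<..} x *\<^sub>R f x))"
      by (auto split: split_indicator)
    thus ?thesis by (simp only: set_lebesgue_integral_def integral_mult_right_zero)
  qed
  have "(LINT y|lborel. f y * (LINT s:{..<y}|lborel. g s))
      = (LINT x|lborel. LINT y|lborel. indicator {..<x} y *\<^sub>R (f x * g y))"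
    by (simp add: inner g)
  also have "\<dots> = (LINT y|lborel. LINT x|lborel. indicator {..<x} y *\<^sub>R (f x * g y))"
    using lborel_pair.Fubini_integral[OF int'[OF f g]] by simp
  also have "\<dots> = (LINT y|lborel. g y * (LINT x:{y<..}|lborel. f x))" by (simp add: inner')
  finally have 3: "(LINT y|lborel. f y * (LINT s:{..<y}|lborel. g s)) = \<dots>" .
  have 4: "integrable lborel (\<lambda>y. g y * (LINT x:{y<..}|lborel. f x))"
    using lborel_pair.integrable_snd[OF int'[OF f g]] by (simp add: inner')
  \<comment> \<open>The two open rays miss only the point \<open>s\<close>. This joins the first
    triangle, integrated in the swapped order, to the second one.\<close>
  have split: "(LINT y:{s<..}|lborel. f y) + (LINT y:{..<s}|lborel. f y) = (LINT y|lborel. f y)" for s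
  proof -
    have "(LINT y:{s<..}|lborel. f y) + (LINT y:{..<s}|lborel. f y)
       = (LINT y|lborel. indicator {s<..} y *\<^sub>R f y + indicator {..<s} y *\<^sub>R f y)"
      unfolding set_lebesgue_integral_def
      by (intro Bochner_Integration.integral_add[symmetric] integrable_mult_indicator f) auto
    also have "\<dots> = (LINT y|lborel. f y)"
    proof (rule integral_cong_AE)
      show "AE y in lborel. indicator {s<..} y *\<^sub>R f y + indicator {..<s} y *\<^sub>R f y = f y"
        using AE_lborel_singleton[of s] by eventually_elim (auto split: split_indicator)
    qed auto
    finally show ?thesis .
  qed
  have "(LINT y|lborel. g y * (LINT x:{y<..}|lborel. f x)) + (LINT s|lborel. g s * (LINT y:{..<s}|lborel. f y))
      = (LINT s|lborel. g s * (LINT x:{s<..}|lborel. f x) + g s * (LINT y:{..<s}|lborel. f y))"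
    by (rule Bochner_Integration.integral_add[symmetric, OF 4 2])
  also have "\<dots> = (LINT s|lborel. g s * (LINT y|lborel. f y))"
    by (simp only: distrib_left[symmetric] split)
  also have "\<dots> = (LINT s|lborel. g s) * (LINT y|lborel. f y)" by simp
  finally show "(LINT y|lborel. f y * (LINT s:{..<y}|lborel. g s)) + (LINT s|lborel. g s * (LINT y:{..<s}|lborel. f y))
     = (LINT y|lborel. f y) * (LINT s|lborel. g s)"
    using 3 by (simp only: mult.commute)
qed

text \<open>Absolute continuity on [a, b] with derivative \<open>f\<close>, encoded by the integral
  identity. \<open>F\<close> is constrained only on the closed interval and \<open>f\<close> only on
  the open one.\<close>

definition primitive_on :: "real \<Rightarrow> real \<Rightarrow> (real \<Rightarrow> complex) \<Rightarrow> (real \<Rightarrow> complex) \<Rightarrow> bool" where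
  "primitive_on a b F f \<longleftrightarrow> set_integrable lborel {a<..<b} f \<and>
     (\<forall>x\<in>{a..b}. F x = F a + (LINT y:{a<..<x}|lborel. f y))"

lemma primitive_on_subinterval:
  assumes "primitive_on a b F f" "c \<le> b"
  shows "primitive_on a c F f"
  unfolding primitive_on_def
proof (intro conjI ballI)
  have "set_integrable lborel {a<..<b} f" using assms(1) by (simp add: primitive_on_def)
  thus "set_integrable lborel {a<..<c} f" by (rule set_integrable_subset) (use assms(2) in auto)
  fix x assume "x \<in> {a..c}"
  hence "x \<in> {a..b}" using assms(2) by auto
  thus "F x = F a + (LINT y:{a<..<x}|lborel. f y)" using assms(1) by (simp only: primitive_on_def)
qed

lemma primitive_on_integral:
  "primitive_on a b F f \<Longrightarrow> x \<in> {a..b} \<Longrightarrow> (LINT y:{a<..<x}|lborel. f y) = F x - F a"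
  unfolding primitive_on_def by (metis add_diff_cancel_left')

text \<open>The product rule tested at the right end point only; applying it to all subintervals
  [a, c] gives the rule for \<open>primitive_on\<close>.\<close>

lemma primitive_on_mult_aux:
  assumes F: "primitive_on a b F f" and G: "primitive_on a b G g" and "a \<le> b"
  shows "set_integrable lborel {a<..<b} (\<lambda>x. f x * G x + F x * g x)"
    and "(LINT x:{a<..<b}|lborel. f x * G x + F x * g x) = F b * G b - F a * G a"
proof -
  \<comment> \<open>Extension by zero turns the half-line integrals of
    \<open>integral_triangles\<close> into the increments F y - F a and G y - G a.\<close>
  define f0 g0 where "f0 = (\<lambda>x. indicator {a<..<b} x *\<^sub>R f x)" and "g0 = (\<lambda>x. indicator {a<..<b} x *\<^sub>R g x)"
  have int: "integrable lborel f0" "integrable lborel g0"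
    using F G by (auto simp: primitive_on_def set_integrable_def f0_def g0_def)
  have *: "indicator {a<..<b} y *\<^sub>R (p y * (LINT s:{..<y}|lborel. indicator {a<..<b} s *\<^sub>R q s))
      = indicator {a<..<b} y *\<^sub>R (p y * (H y - H a))" if "primitive_on a b H q" for y p q H
  proof (cases "y \<in> {a<..<b}")
    case True
    have "(LINT s:{..<y}|lborel. indicator {a<..<b} s *\<^sub>R q s) = (LINT s:{a<..<y}|lborel. q s)"
      unfolding set_lebesgue_integral_def using True
      by (intro Bochner_Integration.integral_cong) (auto split: split_indicator)
    thus ?thesis using that True primitive_on_integral[OF that, of y] by simp
  qed simp
  have f0G: "f0 y * (LINT s:{..<y}|lborel. g0 s) = indicator {a<..<b} y *\<^sub>R (f y * (G y - G a))" for y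
    using *[OF G, of y f] by (simp add: f0_def g0_def)
  have g0F: "g0 y * (LINT s:{..<y}|lborel. f0 s) = indicator {a<..<b} y *\<^sub>R (g y * (F y - F a))" for y
    using *[OF F, of y g] by (simp add: f0_def g0_def)
  have I: "(LINT x|lborel. f0 x) = F b - F a" "(LINT x|lborel. g0 x) = G b - G a"
    using primitive_on_integral[OF F, of b] primitive_on_integral[OF G, of b] \<open>a \<le> b\<close>
    by (simp_all add: f0_def g0_def set_lebesgue_integral_def)
  note T = integral_triangles[OF int, unfolded f0G g0F I]
  \<comment> \<open>The triangles only see increments from \<open>a\<close>; the constants
    \<open>F a\<close> and \<open>G a\<close> are split off and contribute the linear
    remainder.\<close>
  have eq: "(\<lambda>x. indicator {a<..<b} x *\<^sub>R (f x * G x + F x * g x))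
     = (\<lambda>x. indicator {a<..<b} x *\<^sub>R (f x * (G x - G a)) + indicator {a<..<b} x *\<^sub>R (g x * (F x - F a))
         + (f0 x * G a + g0 x * F a))"
    by (auto simp: fun_eq_iff f0_def g0_def algebra_simps split: split_indicator)
  show "set_integrable lborel {a<..<b} (\<lambda>x. f x * G x + F x * g x)"
    unfolding set_integrable_def eq using T(1,2) int by auto
  have "(LINT x:{a<..<b}|lborel. f x * G x + F x * g x) = (F b - F a) * (G b - G a) + ((F b - F a) * G a + (G b - G a) * F a)"
    unfolding set_lebesgue_integral_def eq using T int I
    by (simp add: Bochner_Integration.integral_add)
  thus "(LINT x:{a<..<b}|lborel. f x * G x + F x * g x) = F b * G b - F a * G a"
    by (simp add: algebra_simps)
qed

lemma primitive_on_mult: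
  assumes F: "primitive_on a b F f" and G: "primitive_on a b G g"
  shows "primitive_on a b (\<lambda>x. F x * G x) (\<lambda>x. f x * G x + F x * g x)"
proof (cases "a \<le> b")
  case True
  have "(LINT x:{a<..<c}|lborel. f x * G x + F x * g x) = F c * G c - F a * G a" if "c \<in> {a..b}" for c
    using that F G by (intro primitive_on_mult_aux(2)) (auto intro: primitive_on_subinterval)
  thus ?thesis using primitive_on_mult_aux(1)[OF F G True] by (auto simp: primitive_on_def)
next
  case False
  thus ?thesis by (auto simp: primitive_on_def set_integrable_def)
qed

text \<open>The Lebesgue integral is read as a gauge integral, whose indefinite integral is
  continuous.\<close>

lemma primitive_on_continuous:
  assumes "primitive_on a b F f"
  shows "continuous_on {a..b} F"
proof -
  have f: "set_integrable lborel {a<..<b} f" using assms by (simp add: primitive_on_def)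
  hence int: "f integrable_on {a<..<b}" by (rule set_borel_integral_eq_integral(1))
  hence "f integrable_on {a..b}"
    by (simp add: integrable_on_Icc_iff_Ioo)
  hence "continuous_on {a..b} (\<lambda>x. F a + integral {a..x} f)"
    by (intro continuous_intros indefinite_integral_continuous_1)
  moreover have "F x = F a + integral {a..x} f" if "x \<in> {a..b}" for x
  proof -
    have "set_integrable lborel {a<..<x} f" using that by (intro set_integrable_subset[OF f]) auto
    hence "(LINT y:{a<..<x}|lborel. f y) = integral {a<..<x} f" by (rule set_borel_integral_eq_integral(2))
    thus ?thesis using primitive_on_integral[OF assms that] integral_open_interval_real[of a x f]
      by (simp add: algebra_simps)
  qed
  ultimately show ?thesis by (rule continuous_on_eq[OF _ sym])
qed

lemma primitive_on_C1:
  assumes "\<psi> C1_differentiable_on UNIV"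
  shows "primitive_on a b \<psi> (\<lambda>x. vector_derivative \<psi> (at x))"
proof -
  have c: "continuous_on S (\<lambda>x. vector_derivative \<psi> (at x))" for S
    using assms by (auto simp: C1_differentiable_on_eq intro: continuous_on_subset)
  have d: "(\<psi> has_vector_derivative vector_derivative \<psi> (at x)) (at x within S)" for x S
    using assms by (auto simp: C1_differentiable_on_eq vector_derivative_works[symmetric] intro: has_vector_derivative_at_within)
  have i: "set_integrable lborel {a..b} (\<lambda>x. vector_derivative \<psi> (at x))" for a b
    by (intro borel_integrable_atLeastAtMost' c)
  have i': "set_integrable lborel {a<..<b} (\<lambda>x. vector_derivative \<psi> (at x))" for a b
    by (rule set_integrable_subset[OF i[of a b]]) auto
  show ?thesis unfolding primitive_on_def
  proof (intro conjI ballI)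
    fix x assume "x \<in> {a..b}"
    hence "((\<lambda>x. vector_derivative \<psi> (at x)) has_integral (\<psi> x - \<psi> a)) {a..x}"
      by (intro fundamental_theorem_of_calculus d) auto
    hence "((\<lambda>x. vector_derivative \<psi> (at x)) has_integral (\<psi> x - \<psi> a)) {a<..<x}"
      by (simp add: has_integral_Icc_iff_Ioo)
    hence "(LINT y:{a<..<x}|lborel. vector_derivative \<psi> (at y)) = \<psi> x - \<psi> a"
      using set_borel_integral_eq_integral(2)[OF i'] by (metis integral_unique)
    thus "\<psi> x = \<psi> a + (LINT y:{a<..<x}|lborel. vector_derivative \<psi> (at y))" by simp
  qed (rule i')
qed

lemma primitive_on_cnj:
  assumes "primitive_on a b F f"
  shows "primitive_on a b (\<lambda>x. cnj (F x)) (\<lambda>x. cnj (f x))"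
  unfolding primitive_on_def
proof (intro conjI ballI)
  show "set_integrable lborel {a<..<b} (\<lambda>x. cnj (f x))"
    using assms by (simp add: primitive_on_def set_integrable_def flip: complex_cnj_scaleR)
  fix x assume x: "x \<in> {a..b}"
  have "(LINT y:{a<..<x}|lborel. cnj (f y)) = cnj (LINT y:{a<..<x}|lborel. f y)"
    by (simp add: set_lebesgue_integral_def flip: complex_cnj_scaleR)
  thus "cnj (F x) = cnj (F a) + (LINT y:{a<..<x}|lborel. cnj (f y))"
    using primitive_on_integral[OF assms x] by simp
qed

section \<open>Square integrable functions and test functions\<close>

text \<open>Measurability is global while integrability concerns (a, b) only: representatives stay
  functions on the whole line with arbitrary values outside.\<close>

definition sq_integrable :: "real \<Rightarrow> real \<Rightarrow> (real \<Rightarrow> complex) \<Rightarrow> bool" where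
  "sq_integrable a b f \<longleftrightarrow> f \<in> borel_measurable borel \<and>
     set_integrable lborel {a<..<b} (\<lambda>x. (cmod (f x))\<^sup>2)"

lemma set_integrable_bounded:
  assumes [measurable]: "f \<in> borel_measurable borel" and "\<And>x. x \<in> {a<..<b} \<Longrightarrow> norm (f x) \<le> K"
  shows "set_integrable lborel {a<..<b::real} (f :: real \<Rightarrow> 'a::{banach, second_countable_topology})"
proof -
  have "set_integrable lborel {a..b} (\<lambda>_. K)" by (intro borel_integrable_atLeastAtMost') auto
  hence "set_integrable lborel {a<..<b} (\<lambda>_. K)" by (rule set_integrable_subset) auto
  thus ?thesis unfolding set_integrable_def
    by (rule Bochner_Integration.integrable_bound)
      (use assms(2) in \<open>force split: split_indicator intro!: AE_I2\<close>)+
qed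

lemma set_integrable_dominated:
  assumes "set_integrable lborel {a<..<b} w" and [measurable]: "f \<in> borel_measurable borel"
    and "\<And>x. x \<in> {a<..<b} \<Longrightarrow> norm (f x) \<le> w x"
  shows "set_integrable lborel {a<..<b::real} (f :: real \<Rightarrow> 'a::{banach, second_countable_topology})"
  using assms(1) unfolding set_integrable_def
  by (rule Bochner_Integration.integrable_bound)
    (use assms(3) in \<open>force split: split_indicator intro!: AE_I2\<close>)+

lemma sq_integrable_bounded:
  assumes "f \<in> borel_measurable borel" "\<And>x. x \<in> {a<..<b} \<Longrightarrow> cmod (f x) \<le> K"
  shows "sq_integrable a b f"
  unfolding sq_integrable_def
  using assms by (auto intro!: set_integrable_bounded[where K = "K\<^sup>2"] power_mono)

lemma sum_sq_le: "(cmod (x + y))\<^sup>2 \<le> 2 * (cmod x)\<^sup>2 + 2 * (cmod y)\<^sup>2"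
proof -
  have "(cmod (x + y))\<^sup>2 \<le> (cmod x + cmod y)\<^sup>2" by (intro power_mono norm_triangle_ineq) auto
  also have "\<dots> \<le> 2 * (cmod x)\<^sup>2 + 2 * (cmod y)\<^sup>2"
    using sum_squares_bound[of "cmod x" "cmod y"] by (simp add: power2_sum)
  finally show ?thesis .
qed

lemma sq_integrable_add:
  assumes "sq_integrable a b f" "sq_integrable a b g"
  shows "sq_integrable a b (\<lambda>x. f x + g x)"
proof -
  have [measurable]: "f \<in> borel_measurable borel" "g \<in> borel_measurable borel"
    using assms by (auto simp: sq_integrable_def)
  have "set_integrable lborel {a<..<b} (\<lambda>x. 2 * (cmod (f x))\<^sup>2 + 2 * (cmod (g x))\<^sup>2)"
    using assms by (intro set_integral_add set_integrable_mult_right) (auto simp: sq_integrable_def)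
  hence "set_integrable lborel {a<..<b} (\<lambda>x. (cmod (f x + g x))\<^sup>2)"
    by (rule set_integrable_dominated) (auto simp: sum_sq_le)
  thus ?thesis by (simp add: sq_integrable_def)
qed

lemma sq_integrable_mult_const: "sq_integrable a b f \<Longrightarrow> sq_integrable a b (\<lambda>x. c * f x)"
  by (auto simp: sq_integrable_def norm_mult power_mult_distrib intro!: set_integrable_mult_right)

lemma sq_integrable_uminus: "sq_integrable a b f \<Longrightarrow> sq_integrable a b (\<lambda>x. - f x)"
  using sq_integrable_mult_const[of a b f "-1"] by simp

lemma sq_integrable_diff:
  "sq_integrable a b f \<Longrightarrow> sq_integrable a b g \<Longrightarrow> sq_integrable a b (\<lambda>x. f x - g x)"
  using sq_integrable_add[OF _ sq_integrable_uminus] by fastforce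

lemma sq_integrable_cnj: "sq_integrable a b f \<Longrightarrow> sq_integrable a b (\<lambda>x. cnj (f x))"
  by (auto simp: sq_integrable_def intro!: borel_measurable_continuous_on[where f = cnj] continuous_intros)

lemma sq_integrable_imp_integrable:
  assumes "sq_integrable a b f"
  shows "set_integrable lborel {a<..<b} f"
proof -
  have [measurable]: "f \<in> borel_measurable borel" using assms by (auto simp: sq_integrable_def)
  have "set_integrable lborel {a<..<b} (\<lambda>x. 1 + (cmod (f x))\<^sup>2)"
    using assms by (intro set_integral_add(1)) (auto simp: sq_integrable_def intro: set_integrable_bounded[where K = 1])
  moreover have *: "r \<le> 1 + r\<^sup>2" for r :: real
    using sum_squares_bound[of r 1] by (cases "r \<ge> 0") (auto simp: power2_eq_square intro: order_trans[of _ 0])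
  ultimately show ?thesis by (auto intro: set_integrable_dominated *)
qed

lemma prod_le_half_sq: "cmod (x * y) \<le> ((cmod x)\<^sup>2 + (cmod y)\<^sup>2) / 2"
  using sum_squares_bound[of "cmod x" "cmod y"] by (simp add: norm_mult)

lemma sq_integrable_mult:
  assumes "sq_integrable a b f" "sq_integrable a b g"
  shows "set_integrable lborel {a<..<b} (\<lambda>x. f x * g x)"
proof -
  have [measurable]: "f \<in> borel_measurable borel" "g \<in> borel_measurable borel"
    using assms by (auto simp: sq_integrable_def)
  have "set_integrable lborel {a<..<b} (\<lambda>x. ((cmod (f x))\<^sup>2 + (cmod (g x))\<^sup>2) / 2)"
    using assms by (intro set_integral_add set_integrable_divide) (auto simp: sq_integrable_def)
  thus ?thesis by (rule set_integrable_dominated) (use prod_le_half_sq in \<open>auto simp: field_simps\<close>)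
qed

definition sq_dist :: "real \<Rightarrow> real \<Rightarrow> (real \<Rightarrow> complex) \<Rightarrow> (real \<Rightarrow> complex) \<Rightarrow> real" where
  "sq_dist a b f g = (LINT x:{a<..<b}|lborel. (cmod (f x - g x))\<^sup>2)"

text \<open>Distances are kept squared to avoid roots. The price is the factor 2, which the error
  budgets and the geometric ratios below have to absorb.\<close>

lemma sq_dist_triangle:
  assumes "sq_integrable a b f" "sq_integrable a b g" "sq_integrable a b h"
  shows "sq_dist a b f h \<le> 2 * sq_dist a b f g + 2 * sq_dist a b g h"
proof -
  have i: "set_integrable lborel {a<..<b} (\<lambda>x. (cmod (p x - q x))\<^sup>2)"
    if "sq_integrable a b p" "sq_integrable a b q" for p q
    using sq_integrable_diff[OF that] by (simp add: sq_integrable_def)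
  have "sq_dist a b f h \<le> (LINT x:{a<..<b}|lborel. 2 * (cmod (f x - g x))\<^sup>2 + 2 * (cmod (g x - h x))\<^sup>2)"
    unfolding sq_dist_def
    using sum_sq_le[of "f x - g x" "g x - h x" for x] assms
    by (intro set_integral_mono i set_integral_add set_integrable_mult_right) (auto simp: algebra_simps)
  also have "\<dots> = 2 * sq_dist a b f g + 2 * sq_dist a b g h"
    unfolding sq_dist_def using assms by (simp add: set_integral_add set_integrable_mult_right i)
  finally show ?thesis .
qed

lemma sq_dist_tendsto_0:
  fixes w :: "real \<Rightarrow> real"
  assumes [measurable]: "f \<in> borel_measurable borel" "\<And>n. g n \<in> borel_measurable borel"
    and lim: "AE x in lborel. x \<in> {a<..<b} \<longrightarrow> (\<lambda>n. g n x) \<longlonglongrightarrow> f x"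
    and w: "set_integrable lborel {a<..<b} (\<lambda>x. (w x)\<^sup>2)"
    and bd: "\<And>n x. x \<in> {a<..<b} \<Longrightarrow> cmod (g n x) \<le> w x" "\<And>x. x \<in> {a<..<b} \<Longrightarrow> cmod (f x) \<le> w x"
  shows "(\<lambda>n. sq_dist a b f (g n)) \<longlonglongrightarrow> 0"
proof -
  have "(\<lambda>n. LINT x|lborel. indicator {a<..<b} x *\<^sub>R (cmod (f x - g n x))\<^sup>2)
      \<longlonglongrightarrow> (LINT x|(lborel :: real measure). (0::real))"
  proof (rule integral_dominated_convergence)
    show "integrable lborel (\<lambda>x. indicator {a<..<b} x *\<^sub>R (4 * (w x)\<^sup>2))"
      using w set_integrable_mult_right[of 4 lborel "{a<..<b}" "\<lambda>x. (w x)\<^sup>2"] by (simp add: set_integrable_def)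
    show "AE x in lborel. (\<lambda>n. indicator {a<..<b} x *\<^sub>R (cmod (f x - g n x))\<^sup>2) \<longlonglongrightarrow> 0"
      using lim
    proof eventually_elim
      case (elim x)
      show ?case
      proof (cases "x \<in> {a<..<b}")
        case True
        hence "(\<lambda>n. (cmod (f x - g n x))\<^sup>2) \<longlonglongrightarrow> (cmod (f x - f x))\<^sup>2"
          using elim by (intro tendsto_intros) auto
        thus ?thesis using True by simp
      qed simp
    qed
    show "AE x in lborel. norm (indicator {a<..<b} x *\<^sub>R (cmod (f x - g n x))\<^sup>2)
        \<le> indicator {a<..<b} x *\<^sub>R (4 * (w x)\<^sup>2)" for n
    proof (intro AE_I2)
      fix x
      show "norm (indicator {a<..<b} x *\<^sub>R (cmod (f x - g n x))\<^sup>2) \<le> indicator {a<..<b} x *\<^sub>R (4 * (w x)\<^sup>2)"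
      proof (cases "x \<in> {a<..<b}")
        case True
        have "cmod (f x - g n x) \<le> 2 * w x"
          using norm_triangle_ineq4[of "f x" "g n x"] bd(1)[OF True, of n] bd(2)[OF True] by linarith
        hence "(cmod (f x - g n x))\<^sup>2 \<le> (2 * w x)\<^sup>2" by (intro power_mono) auto
        thus ?thesis using True by (simp add: power_mult_distrib)
      qed simp
    qed
  qed measurable
  thus ?thesis by (simp add: sq_dist_def set_lebesgue_integral_def)
qed

section \<open>Cutoffs and density of C1 test functions in L2\<close>

lemma has_real_derivative_pos_part_sq:
  "((\<lambda>t::real. (max 0 t)\<^sup>2) has_real_derivative 2 * max 0 t) (at t)"
proof -
  consider "t > 0" | "t < 0" | "t = 0" by linarith
  thus ?thesis
  proof cases
    case 1
    have "((\<lambda>t. t\<^sup>2) has_real_derivative 2 * t) (at t)" by (auto intro!: derivative_eq_intros)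
    moreover have "\<forall>\<^sub>F s in nhds t. (max 0 s)\<^sup>2 = s\<^sup>2"
      using 1 by (intro eventually_mono[OF eventually_nhds_in_open[of "{0<..}" t]]) auto
    ultimately show ?thesis using 1 by (subst DERIV_cong_ev[OF refl _ refl]) auto
  next
    case 2
    have "((\<lambda>t. 0) has_real_derivative 0) (at t)" by auto
    moreover have ev: "\<forall>\<^sub>F s in nhds t. (max 0 s)\<^sup>2 = 0"
      using 2 by (intro eventually_mono[OF eventually_nhds_in_open[of "{..<0}" t]]) auto
    ultimately show ?thesis using 2 DERIV_cong_ev[OF refl ev, of 0 0] by simp
  next
    case 3
    \<comment> \<open>At the kink the difference quotient is at most |h|: squaring is what makes the
      positive part C1.\<close>
    have "((\<lambda>h::real. (max 0 h)\<^sup>2 / h) \<longlongrightarrow> 0) (at 0)"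
    proof (rule Lim_null_comparison)
      show "\<forall>\<^sub>F h in at (0::real). norm ((max 0 h)\<^sup>2 / h) \<le> \<bar>h\<bar>"
        by (intro always_eventually) (auto simp: max_def power2_eq_square)
      show "((\<lambda>h::real. \<bar>h\<bar>) \<longlongrightarrow> 0) (at 0)" by (auto intro!: tendsto_eq_intros)
    qed
    thus ?thesis using 3 by (simp add: has_field_derivative_iff)
  qed
qed

text \<open>\<open>h\<close> is positive exactly on (a + d, b - d), so h / (h + e) is a C1 cutoff
  with values in [0, 1) that tends to 1 there as e tends to 0.\<close>

lemma cutoff_mult_test_function:
  fixes P :: "real \<Rightarrow> complex"
  assumes P: "\<And>x. (P has_vector_derivative P' x) (at x)" and P': "continuous_on UNIV P'"
    and d: "0 < d" "a + d < b - d" and e: "0 < e"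
  defines "h \<equiv> \<lambda>x. (max 0 ((x - a - d) * (b - d - x)))\<^sup>2"
  shows "(\<lambda>x. of_real (h x / (h x + e)) * P x) \<in> C1_test_functions a b"
proof -
  define q where "q x = (x - a - d) * (b - d - x)" for x
  define h' where "h' x = 2 * max 0 (q x) * (a + b - 2 * x)" for x
  have h: "(h has_real_derivative h' x) (at x)" for x
  proof -
    have "(q has_real_derivative (a + b - 2 * x)) (at x)"
      unfolding q_def by (auto intro!: derivative_eq_intros)
    from DERIV_chain2[OF has_real_derivative_pos_part_sq this] show ?thesis
      by (simp add: h_def h'_def q_def)
  qed
  have pos: "h x + e > 0" for x using e by (simp add: h_def add_nonneg_pos)
  define k where "k x = h x / (h x + e)" for x
  define k' where "k' x = h' x * e / (h x + e)\<^sup>2" for x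
  have k: "(k has_real_derivative k' x) (at x)" for x
    unfolding k_def k'_def using pos[of x]
    by (auto intro!: derivative_eq_intros h simp: power2_eq_square field_simps)
  have ch: "continuous_on UNIV h" using h by (intro DERIV_continuous_on) auto
  have ch': "continuous_on UNIV h'" unfolding h'_def q_def by (intro continuous_intros)
  have ck: "continuous_on UNIV k" using k by (intro DERIV_continuous_on) auto
  have ck': "continuous_on UNIV k'" unfolding k'_def using pos
    by (intro continuous_intros ch ch') (auto simp: less_imp_neq[symmetric] intro: less_imp_neq[OF pos, symmetric])
  have cP: "continuous_on UNIV P"
    using P by (meson continuous_at_imp_continuous_on has_vector_derivative_continuous)
  have "((\<lambda>x. of_real (k x) * P x) has_vector_derivative of_real (k x) * P' x + of_real (k' x) * P x) (at x)" for x
    using has_vector_derivative_mult[OF has_vector_derivative_of_real[OF k] P]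
    by simp
  hence "(\<lambda>x. of_real (k x) * P x) C1_differentiable_on UNIV"
    unfolding C1_differentiable_on_def
    by (intro exI[of _ "\<lambda>x. of_real (k x) * P' x + of_real (k' x) * P x"] conjI continuous_intros)
      (auto intro: ck ck' cP P')
  moreover have "k x = 0" if "x \<notin> {a + d..b - d}" for x
  proof -
    have "q x \<le> 0" unfolding q_def using that d by (auto intro: mult_nonpos_nonneg mult_nonneg_nonpos)
    thus ?thesis by (simp add: k_def h_def q_def)
  qed
  ultimately show ?thesis using d unfolding C1_test_functions_def k_def[symmetric]
    by (intro CollectI conjI exI[of _ "a + d"] exI[of _ "b - d"]) auto
qed

lemma test_function_sq_integrable:
  assumes "\<psi> \<in> C1_test_functions a b"
  shows "sq_integrable a b \<psi>" "sq_integrable a b (\<lambda>x. vector_derivative \<psi> (at x))"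
    "\<exists>K. \<forall>x. cmod (\<psi> x) \<le> K"
proof -
  have C1: "\<psi> C1_differentiable_on UNIV" using assms by (simp add: C1_test_functions_def)
  obtain c d where cd: "a < c" "d < b" "\<And>x. x \<notin> {c..d} \<Longrightarrow> \<psi> x = 0"
    using assms by (auto simp: C1_test_functions_def)
  have bd: "\<exists>K. \<forall>x\<in>{a..b}. cmod (h x) \<le> K" if "continuous_on UNIV h" for h :: "real \<Rightarrow> complex"
  proof -
    have "bounded (h ` {a..b})"
      by (intro compact_imp_bounded compact_continuous_image continuous_on_subset[OF that]) auto
    thus ?thesis by (auto simp: bounded_iff)
  qed
  have c: "continuous_on UNIV \<psi>" "continuous_on UNIV (\<lambda>x. vector_derivative \<psi> (at x))"
    using C1 C1_differentiable_imp_continuous_on by (auto simp: C1_differentiable_on_eq)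
  obtain K K' where K: "\<And>x. x \<in> {a..b} \<Longrightarrow> cmod (\<psi> x) \<le> K"
      "\<And>x. x \<in> {a..b} \<Longrightarrow> cmod (vector_derivative \<psi> (at x)) \<le> K'"
    using bd[OF c(1)] bd[OF c(2)] by blast
  show "sq_integrable a b \<psi>"
    using K(1) C1_test_functions_measurable(1)[OF assms]
    by (auto intro!: sq_integrable_bounded[where K = K])
  show "sq_integrable a b (\<lambda>x. vector_derivative \<psi> (at x))"
    using K(2) C1_test_functions_measurable(2)[OF assms]
    by (auto intro!: sq_integrable_bounded[where K = K'])
  have "cmod (\<psi> x) \<le> max 0 K" for x
    using K(1)[of x] cd by (cases "x \<in> {c..d}") auto
  thus "\<exists>K. \<forall>x. cmod (\<psi> x) \<le> K" by blast
qed

lemma sq_dist_bounded_approx: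
  assumes "sq_integrable a b f" "e > 0"
  obtains g M where "g \<in> borel_measurable borel" "0 < M" "\<And>x. cmod (g x) \<le> M" "sq_dist a b f g < e"
proof -
  have [measurable]: "f \<in> borel_measurable borel" using assms by (simp add: sq_integrable_def)
  define g where "g n x = (if cmod (f x) \<le> real n then f x else 0)" for n x
  have [measurable]: "g n \<in> borel_measurable borel" for n unfolding g_def by measurable
  have "(\<lambda>n. sq_dist a b f (g n)) \<longlonglongrightarrow> 0"
  proof (rule sq_dist_tendsto_0[where w = "\<lambda>x. cmod (f x)"])
    have "(\<lambda>n. g n x) \<longlonglongrightarrow> f x" for x
    proof (rule tendsto_eventually)
      show "\<forall>\<^sub>F n in sequentially. g n x = f x"
        using eventually_ge_at_top[of "nat \<lceil>cmod (f x)\<rceil>"]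
        by eventually_elim (simp add: g_def nat_le_iff ceiling_le_iff)
    qed
    thus "AE x in lborel. x \<in> {a<..<b} \<longrightarrow> (\<lambda>n. g n x) \<longlonglongrightarrow> f x" by auto
  qed (use assms in \<open>auto simp: g_def sq_integrable_def\<close>)
  hence "\<forall>\<^sub>F n in sequentially. sq_dist a b f (g n) < e" using assms(2) by (rule order_tendstoD)
  then obtain n where "sq_dist a b f (g n) < e" by (auto simp: eventually_sequentially)
  thus ?thesis using that[of "g n" "real n + 1"] by (auto simp: g_def)
qed

text \<open>A measurable function is an almost everywhere limit of continuous ones; clipping them to
  the disc of radius \<open>M\<close> supplies the dominating function.\<close>

lemma sq_dist_continuous_approx:
  assumes [measurable]: "f \<in> borel_measurable borel" and M: "0 < M" "\<And>x. cmod (f x) \<le> M" and e: "e > 0"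
  obtains g where "continuous_on UNIV g" "\<And>x. cmod (g x) \<le> M" "sq_dist a b f g < e"
proof -
  have "f measurable_on UNIV"
    by (rule lebesgue_measurable_imp_measurable_on) (auto simp: measurable_completion)
  then obtain Z h where Z: "negligible Z" and h: "\<And>n :: nat. continuous_on UNIV (h n)"
      and lim: "\<And>x. x \<notin> Z \<Longrightarrow> (\<lambda>n. h n x) \<longlonglongrightarrow> f x"
    unfolding measurable_on_def by auto
  \<comment> \<open>The radial retraction onto the disc of radius \<open>M\<close>: continuous, and
    the identity on the values of \<open>f\<close>.\<close>
  define cl where "cl z = z / of_real (max 1 (cmod z / M))" for z
  have cl: "continuous_on UNIV cl" unfolding cl_def by (intro continuous_intros) (use M in auto)
  have cl_bd: "cmod (cl z) \<le> M" for z
    using M by (auto simp: cl_def norm_divide max_def field_simps)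
  have cl_id: "cl z = z" if "cmod z \<le> M" for z using that M by (auto simp: cl_def max_def field_simps)
  define g where "g n x = cl (h n x)" for n x
  have cg: "continuous_on UNIV (g n)" for n
    unfolding g_def using continuous_on_compose2[OF cl h] by auto
  have AE_Z: "AE x in lborel. x \<notin> Z"
  proof -
    have "AE x in lebesgue. x \<notin> Z" using Z by (simp add: negligible_iff_null_sets AE_not_in)
    thus ?thesis by (simp add: AE_completion_iff)
  qed
  have "(\<lambda>n. sq_dist a b f (g n)) \<longlonglongrightarrow> 0"
  proof (rule sq_dist_tendsto_0[where w = "\<lambda>_. M"])
    have "(\<lambda>n. g n x) \<longlonglongrightarrow> cl (f x)" if "x \<notin> Z" for x
      unfolding g_def using cl lim[OF that]
      by (intro isCont_tendsto_compose[of _ cl]) (auto simp: continuous_on_eq_continuous_at)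
    hence *: "(\<lambda>n. g n x) \<longlonglongrightarrow> f x" if "x \<notin> Z" for x using cl_id[OF M(2)] that by metis
    show "AE x in lborel. x \<in> {a<..<b} \<longrightarrow> (\<lambda>n. g n x) \<longlonglongrightarrow> f x"
      using AE_Z by eventually_elim (auto intro: *)
    show "set_integrable lborel {a<..<b} (\<lambda>x. M\<^sup>2)" by (rule set_integrable_bounded) auto
    show "g n \<in> borel_measurable borel" for n using cg by (rule borel_measurable_continuous_onI)
  qed (auto simp: g_def cl_bd M)
  hence "\<forall>\<^sub>F n in sequentially. sq_dist a b f (g n) < e" using e by (rule order_tendstoD)
  then obtain n where "sq_dist a b f (g n) < e" by (auto simp: eventually_sequentially)
  thus ?thesis using that[of "g n"] cg by (auto simp: g_def cl_bd)
qed

text \<open>Polynomials from Stone-Weierstrass are smooth but do not vanish near the end points; a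
  cutoff repairs this, and dominated convergence removes it again in the limit.\<close>

lemma sq_dist_test_approx_continuous:
  assumes "a < b" and f: "continuous_on UNIV f" and e: "e > 0"
  obtains \<psi> where "\<psi> \<in> C1_test_functions a b" "sq_dist a b f \<psi> < e"
proof -
  have "continuous_on {a..b} f" using f by (rule continuous_on_subset) auto
  \<comment> \<open>Uniform error \<open>r\<close> costs r^2 (b - a) in squared distance; the added
    1 makes this strictly less than e / 4.\<close>
  define r where "r = sqrt (e / (4 * (b - a) + 1))"
  have r: "r > 0" using assms by (auto simp: r_def intro!: divide_pos_pos add_nonneg_pos)
  have r2: "r\<^sup>2 * (b - a) < e / 4"
  proof -
    have "r\<^sup>2 = e / (4 * (b - a) + 1)" using assms by (auto simp: r_def)
    hence "r\<^sup>2 * (4 * (b - a) + 1) = e" using assms by simp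
    hence "4 * (r\<^sup>2 * (b - a)) + r\<^sup>2 = e" by (simp add: algebra_simps)
    moreover have "r\<^sup>2 > 0" using r by simp
    ultimately show ?thesis by linarith
  qed
  obtain P where P: "polynomial_function P" "\<And>x. x \<in> {a..b} \<Longrightarrow> cmod (f x - P x) < r"
    using Stone_Weierstrass_polynomial_function[OF _ \<open>continuous_on {a..b} f\<close> r] by auto
  obtain P' where P': "polynomial_function P'" "\<And>x. (P has_vector_derivative P' x) (at x)"
    using has_vector_derivative_polynomial_function[OF P(1)] by blast
  have cP: "continuous_on UNIV P" "continuous_on UNIV P'"
    using P P' by (auto intro: continuous_on_polymonial_function)
  have "bounded (P ` {a..b})"
    by (intro compact_imp_bounded compact_continuous_image continuous_on_subset[OF cP(1)]) auto
  then obtain K where "\<forall>y\<in>P ` {a..b}. norm y \<le> K" unfolding bounded_iff by blast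
  hence K: "cmod (P x) \<le> K" if "x \<in> {a..b}" for x using that by blast
  have [measurable]: "f \<in> borel_measurable borel" "P \<in> borel_measurable borel"
    using f cP by (auto intro: borel_measurable_continuous_onI)
  \<comment> \<open>The offset 3 keeps 2 d n below b - a already for n = 0.\<close>
  define d where "d n = (b - a) / real (n + 3)" for n
  define h where "h n x = (max 0 ((x - a - d n) * (b - d n - x)))\<^sup>2" for n x
  define \<epsilon> where "\<epsilon> n = 1 / real (Suc n)" for n
  define \<psi> where "\<psi> n x = of_real (h n x / (h n x + \<epsilon> n)) * P x" for n x
  have \<psi>: "\<psi> n \<in> C1_test_functions a b" for n
  proof -
    have "d n > 0" using assms by (simp add: d_def)
    moreover have "(b - a) * (2 / real (n + 3)) < (b - a) * 1"
      using assms by (intro mult_strict_left_mono) auto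
    hence "2 * d n < b - a" by (simp add: d_def field_simps)
    ultimately show ?thesis unfolding \<psi>_def h_def
      by (intro cutoff_mult_test_function[OF P'(2) cP(2)]) (auto simp: \<epsilon>_def)
  qed
  have [measurable]: "\<psi> n \<in> borel_measurable borel" for n
    using C1_test_functions_measurable(1)[OF \<psi>] by simp
  have bd: "cmod (\<psi> n x) \<le> cmod (P x)" for n x
  proof -
    have "h n x \<ge> 0" "\<epsilon> n > 0" by (simp_all add: h_def \<epsilon>_def)
    hence "\<bar>h n x / (h n x + \<epsilon> n)\<bar> \<le> 1" by simp
    hence "\<bar>h n x / (h n x + \<epsilon> n)\<bar> * cmod (P x) \<le> 1 * cmod (P x)" by (intro mult_right_mono) auto
    thus ?thesis by (simp only: \<psi>_def norm_mult norm_of_real mult_1)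
  qed
  have "(\<lambda>n. sq_dist a b P (\<psi> n)) \<longlonglongrightarrow> 0"
  proof (rule sq_dist_tendsto_0[where w = "\<lambda>_. K"])
    have d0: "d \<longlonglongrightarrow> 0"
      unfolding d_def using LIMSEQ_ignore_initial_segment[OF lim_const_over_n, of "b - a" 3] by simp
    have e0: "\<epsilon> \<longlonglongrightarrow> 0" unfolding \<epsilon>_def using LIMSEQ_inverse_real_of_nat by (simp add: inverse_eq_divide)
    have "(\<lambda>n. \<psi> n x) \<longlonglongrightarrow> P x" if x: "x \<in> {a<..<b}" for x
    proof -
      define h0 where "h0 = (max 0 ((x - a - 0) * (b - 0 - x)))\<^sup>2"
      have "h0 > 0" using x by (simp add: h0_def)
      have "(\<lambda>n. h n x) \<longlonglongrightarrow> h0" unfolding h_def h0_def by (intro tendsto_intros d0)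
      hence "(\<lambda>n. \<psi> n x) \<longlonglongrightarrow> of_real (h0 / (h0 + 0)) * P x"
        unfolding \<psi>_def using \<open>h0 > 0\<close> by (intro tendsto_intros e0) auto
      thus ?thesis using \<open>h0 > 0\<close> by simp
    qed
    thus "AE x in lborel. x \<in> {a<..<b} \<longrightarrow> (\<lambda>n. \<psi> n x) \<longlonglongrightarrow> P x" by auto
    show "set_integrable lborel {a<..<b} (\<lambda>x. K\<^sup>2)" by (rule set_integrable_bounded) auto
  qed (use K order_trans[OF bd K] in auto)
  hence "\<forall>\<^sub>F n in sequentially. sq_dist a b P (\<psi> n) < e / 4"
    by (rule order_tendstoD) (use e in simp)
  then obtain n where n: "sq_dist a b P (\<psi> n) < e / 4" by (auto simp: eventually_sequentially)
  have sqi: "sq_integrable a b g" if "continuous_on UNIV g" for g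
  proof -
    have "bounded (g ` {a..b})"
      by (intro compact_imp_bounded compact_continuous_image continuous_on_subset[OF that]) auto
    then obtain K where "\<forall>y\<in>g ` {a..b}. norm y \<le> K" unfolding bounded_iff by blast
    thus ?thesis using that
      by (intro sq_integrable_bounded[where K = K] borel_measurable_continuous_onI) auto
  qed
  have "sq_dist a b f P \<le> (LINT x:{a<..<b}|lborel. r\<^sup>2)"
    unfolding sq_dist_def using sq_integrable_diff[OF sqi[OF f] sqi[OF cP(1)]] P(2)
    by (intro set_integral_mono power_mono) (auto simp: sq_integrable_def less_imp_le intro: set_integrable_bounded)
  also have "\<dots> = r\<^sup>2 * (b - a)" using assms by (simp add: set_lebesgue_integral_def)
  finally have "sq_dist a b f P < e / 4" using r2 by simp
  hence "sq_dist a b f (\<psi> n) < e"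
    using n sq_dist_triangle[OF sqi[OF f] sqi[OF cP(1)] test_function_sq_integrable(1)[OF \<psi>], of n] by simp
  with \<psi> show ?thesis by (rule that)
qed

theorem test_functions_dense:
  assumes "a < b" "sq_integrable a b f" "e > 0"
  obtains \<psi> where "\<psi> \<in> C1_test_functions a b" "sq_dist a b f \<psi> < e"
proof -
  \<comment> \<open>Budget with the doubling triangle inequality: e/16 and e/16 combine to e/4, and
    then e/8 and e/4 combine to 3e/4.\<close>
  obtain g M where g: "g \<in> borel_measurable borel" "0 < M" "\<And>x. cmod (g x) \<le> M" "sq_dist a b f g < e / 8"
    using sq_dist_bounded_approx[OF assms(2), of "e / 8"] assms(3) by auto
  obtain h where h: "continuous_on UNIV h" "\<And>x. cmod (h x) \<le> M" "sq_dist a b g h < e / 16"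
    using sq_dist_continuous_approx[OF g(1-3), of "e / 16"] assms(3) by auto
  obtain \<psi> where \<psi>: "\<psi> \<in> C1_test_functions a b" "sq_dist a b h \<psi> < e / 16"
    using sq_dist_test_approx_continuous[OF assms(1) h(1), of "e / 16"] assms(3) by auto
  have sg: "sq_integrable a b g" and sh: "sq_integrable a b h"
    using g h by (auto intro!: sq_integrable_bounded borel_measurable_continuous_onI)
  have "sq_dist a b g \<psi> < e / 4"
    using sq_dist_triangle[OF sg sh test_function_sq_integrable(1)[OF \<psi>(1)]] h \<psi> by simp
  hence "sq_dist a b f \<psi> < e"
    using sq_dist_triangle[OF assms(2) sg test_function_sq_integrable(1)[OF \<psi>(1)]] g assms(3) by simp
  with \<psi>(1) show ?thesis by (rule that)
qed

section \<open>The fundamental lemma and weak derivatives as primitives\<close>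

lemma sq_norm_zero_imp_AE:
  assumes "sq_integrable a b f" "(LINT x:{a<..<b}|lborel. (cmod (f x))\<^sup>2) = 0"
  shows "AE x in lborel. x \<in> {a<..<b} \<longrightarrow> f x = 0"
proof -
  have "AE x in lborel. indicator {a<..<b} x *\<^sub>R (cmod (f x))\<^sup>2 = 0"
    using assms integral_nonneg_eq_0_iff_AE[of lborel "\<lambda>x. indicator {a<..<b} x *\<^sub>R (cmod (f x))\<^sup>2"]
    by (simp add: sq_integrable_def set_integrable_def set_lebesgue_integral_def)
  thus ?thesis by eventually_elim auto
qed

text \<open>With \<open>\<psi>\<close> close to the conjugate of \<open>g\<close>, orthogonality
  gives I = \<integral> g r for the remainder \<open>r\<close>. Young's inequality bounds this by
  half of \<open>I\<close> plus half of the squared distance, so \<open>I\<close> is at most that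
  distance.\<close>

lemma orthogonal_test_functions_imp_zero:
  assumes ab: "a < b" and g: "sq_integrable a b g"
    and orth: "\<And>\<psi>. \<psi> \<in> C1_test_functions a b \<Longrightarrow> (LINT x:{a<..<b}|lborel. g x * \<psi> x) = 0"
  shows "AE x in lborel. x \<in> {a<..<b} \<longrightarrow> g x = 0"
proof -
  define I where "I = (LINT x:{a<..<b}|lborel. (cmod (g x))\<^sup>2)"
  have Ii: "set_integrable lborel {a<..<b} (\<lambda>x. (cmod (g x))\<^sup>2)" using g by (simp add: sq_integrable_def)
  have "I \<le> e" if e: "e > 0" for e
  proof -
    obtain \<psi> where \<psi>: "\<psi> \<in> C1_test_functions a b" "sq_dist a b (\<lambda>x. cnj (g x)) \<psi> < e"
      using test_functions_dense[OF ab sq_integrable_cnj[OF g] e] by blast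
    define r where "r x = cnj (g x) - \<psi> x" for x
    have r: "sq_integrable a b r" unfolding r_def
      by (intro sq_integrable_diff sq_integrable_cnj g test_function_sq_integrable(1)[OF \<psi>(1)])
    have "complex_of_real I = (LINT x:{a<..<b}|lborel. g x * cnj (g x))"
      unfolding I_def set_lebesgue_integral_def
      by (subst integral_complex_of_real[symmetric])
        (simp add: scaleR_conv_of_real flip: complex_norm_square)
    also have "\<dots> = (LINT x:{a<..<b}|lborel. g x * r x + g x * \<psi> x)"
      by (simp add: r_def algebra_simps)
    also have "\<dots> = (LINT x:{a<..<b}|lborel. g x * r x)"
      using orth[OF \<psi>(1)] sq_integrable_mult[OF g r]
        sq_integrable_mult[OF g test_function_sq_integrable(1)[OF \<psi>(1)]]
      by (subst set_integral_add) auto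
    finally have "\<bar>I\<bar> = cmod (LINT x:{a<..<b}|lborel. g x * r x)" by (metis norm_of_real)
    also have "\<dots> \<le> (LINT x:{a<..<b}|lborel. cmod (g x * r x))"
      by (intro set_integral_norm_bound sq_integrable_mult g r)
    also have "\<dots> \<le> (LINT x:{a<..<b}|lborel. ((cmod (g x))\<^sup>2 + (cmod (r x))\<^sup>2) / 2)"
      using g r sq_integrable_mult[OF g r]
      by (intro set_integral_mono set_integrable_norm set_integrable_divide set_integral_add prod_le_half_sq)
        (auto simp: sq_integrable_def)
    also have "\<dots> = (I + sq_dist a b (\<lambda>x. cnj (g x)) \<psi>) / 2"
      using g r by (simp add: I_def sq_dist_def r_def sq_integrable_def set_integral_add)
    finally have "I \<le> (I + sq_dist a b (\<lambda>x. cnj (g x)) \<psi>) / 2" by linarith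
    hence "2 * I \<le> I + sq_dist a b (\<lambda>x. cnj (g x)) \<psi>" by simp
    thus ?thesis using \<psi>(2) by simp
  qed
  hence "I \<le> 0" by (rule field_le_epsilon[of _ 0, simplified])
  moreover have "I \<ge> 0" unfolding I_def set_lebesgue_integral_def by (intro integral_nonneg_AE) auto
  ultimately show ?thesis using g by (intro sq_norm_zero_imp_AE) (auto simp: I_def)
qed

text \<open>The vanishing mean is what makes the antiderivative vanish again to the right of the
  support.\<close>

lemma test_function_integral_zero_imp_antiderivative:
  assumes ab: "a < b" and \<theta>: "\<theta> \<in> C1_test_functions a b" and int0: "(LINT x:{a<..<b}|lborel. \<theta> x) = 0"
  obtains \<psi> where "\<psi> \<in> C1_test_functions a b" "\<And>x. vector_derivative \<psi> (at x) = \<theta> x"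
proof -
  have C1: "\<theta> C1_differentiable_on UNIV" using \<theta> by (simp add: C1_test_functions_def)
  obtain c d where cd: "a < c" "d < b" "\<And>x. x \<notin> {c..d} \<Longrightarrow> \<theta> x = 0"
    using \<theta> by (auto simp: C1_test_functions_def)
  have cont: "continuous_on S \<theta>" for S
    using C1_differentiable_imp_continuous_on[OF C1] by (rule continuous_on_subset) auto
  define \<psi> where "\<psi> x = integral {a..x} \<theta>" for x
  have deriv: "(\<psi> has_vector_derivative \<theta> x) (at x)" for x
  proof (cases "x < c")
    case True
    have "\<psi> y = 0" if "y < c" for y
      unfolding \<psi>_def using that by (intro integral_unique has_integral_is_0) (auto simp: cd(3))
    moreover have "((\<lambda>_. 0) has_vector_derivative \<theta> x) (at x)" using True cd(3)[of x] by auto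
    ultimately show ?thesis using True
      by (elim has_vector_derivative_transform_within_open[of _ _ _ "{..<c}"]) auto
  next
    case False
    \<comment> \<open>The interval is prolonged to x + 1 only to make \<open>x\<close> interior; the
      points left of \<open>c\<close>, including those left of \<open>a\<close>, were settled
      above.\<close>
    hence x: "x \<in> {a<..<x + 1}" using cd by auto
    have "((\<lambda>u. integral {a..u} \<theta>) has_vector_derivative \<theta> x) (at x within {a..x + 1})"
      using x by (intro integral_has_vector_derivative cont) auto
    hence "((\<lambda>u. integral {a..u} \<theta>) has_vector_derivative \<theta> x) (at x within {a<..<x + 1})"
      by (rule has_vector_derivative_within_subset) auto
    thus ?thesis using x at_within_open[of x "{a<..<x + 1}"] by (simp add: \<psi>_def[abs_def])
  qed
  have i: "\<theta> integrable_on {a..y}" for y by (intro integrable_continuous_real cont)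
  have "(LINT x:{a<..<b}|lborel. \<theta> x) = integral {a<..<b} \<theta>"
    using test_function_sq_integrable(1)[OF \<theta>]
    by (intro set_borel_integral_eq_integral sq_integrable_imp_integrable)
  hence b0: "\<psi> b = 0" using int0 integral_open_interval_real[of a b \<theta>] by (simp add: \<psi>_def)
  have "\<psi> x = 0" if "x \<notin> {c..d}" for x
  proof (cases "x < c")
    case True
    thus ?thesis unfolding \<psi>_def by (intro integral_unique has_integral_is_0) (auto simp: cd(3))
  next
    case False
    hence xd: "x > d" "x \<ge> a" using that cd by auto
    show ?thesis
    proof (cases "x \<le> b")
      case True
      have "integral {a..x} \<theta> + integral {x..b} \<theta> = \<psi> b"
        unfolding \<psi>_def using xd True i by (intro Henstock_Kurzweil_Integration.integral_combine) auto
      moreover have "integral {x..b} \<theta> = 0"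
        using xd by (intro integral_unique has_integral_is_0) (auto simp: cd(3))
      ultimately show ?thesis using b0 by (simp add: \<psi>_def)
    next
      case False
      have "integral {a..b} \<theta> + integral {b..x} \<theta> = \<psi> x"
        unfolding \<psi>_def using xd False ab i by (intro Henstock_Kurzweil_Integration.integral_combine) auto
      moreover have "integral {b..x} \<theta> = 0"
        using cd by (intro integral_unique has_integral_is_0) (auto simp: cd(3))
      ultimately show ?thesis using b0 by (simp add: \<psi>_def)
    qed
  qed
  moreover have "\<psi> C1_differentiable_on UNIV"
    unfolding C1_differentiable_on_def using deriv cont by blast
  ultimately have "\<psi> \<in> C1_test_functions a b" using cd by (auto simp: C1_test_functions_def)
  thus ?thesis using deriv by (intro that) (auto intro: vector_derivative_at)
qed

text \<open>With a fixed \<open>\<theta>0\<close> of nonzero mean, every test function minus a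
  multiple of \<open>\<theta>0\<close> has mean zero, hence is the derivative of a test function. So
  \<open>f\<close> minus the constant \<open>C\<close> is orthogonal to all test functions.\<close>

lemma du_Bois_Reymond:
  assumes ab: "a < b" and f: "sq_integrable a b f"
    and orth: "\<And>\<psi>. \<psi> \<in> C1_test_functions a b \<Longrightarrow> (LINT x:{a<..<b}|lborel. f x * vector_derivative \<psi> (at x)) = 0"
  obtains c where "AE x in lborel. x \<in> {a<..<b} \<longrightarrow> f x = c"
proof -
  have const: "sq_integrable a b (\<lambda>_. c)" for c by (rule sq_integrable_bounded) auto
  \<comment> \<open>Otherwise the constant 1 would be orthogonal to all test functions and therefore
    zero.\<close>
  have "\<exists>\<theta>0\<in>C1_test_functions a b. (LINT x:{a<..<b}|lborel. \<theta>0 x) \<noteq> 0"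
  proof (rule ccontr)
    assume "\<not> ?thesis"
    hence "AE x in lborel. x \<in> {a<..<b} \<longrightarrow> (1::complex) = 0"
      by (intro orthogonal_test_functions_imp_zero ab const) auto
    hence "AE x in lborel. x \<notin> {a<..<b}" by auto
    hence "emeasure lborel {a<..<b} = 0" using AE_iff_measurable[of "{a<..<b}" lborel "\<lambda>x. x \<notin> {a<..<b}"]
      by (simp add: greaterThanLessThan_def greaterThan_def lessThan_def Int_def)
    thus False using ab by simp
  qed
  then obtain \<theta>0 where \<theta>0: "\<theta>0 \<in> C1_test_functions a b" "(LINT x:{a<..<b}|lborel. \<theta>0 x) \<noteq> 0" by blast
  define J where "J = (LINT x:{a<..<b}|lborel. \<theta>0 x)"
  define C where "C = (LINT x:{a<..<b}|lborel. f x * \<theta>0 x) / J"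
  have "(LINT x:{a<..<b}|lborel. (f x - C) * \<theta> x) = 0" if \<theta>: "\<theta> \<in> C1_test_functions a b" for \<theta>
  proof -
    note int = sq_integrable_imp_integrable[OF test_function_sq_integrable(1)]
    note fint = sq_integrable_mult[OF f test_function_sq_integrable(1)]
    define k where "k = (LINT x:{a<..<b}|lborel. \<theta> x) / J"
    define \<zeta> where "\<zeta> x = \<theta> x - k * \<theta>0 x" for x
    have \<zeta>: "\<zeta> \<in> C1_test_functions a b"
    proof -
      obtain c d c' d' where cd: "a < c" "d < b" "\<And>x. x \<notin> {c..d} \<Longrightarrow> \<theta> x = 0"
          "a < c'" "d' < b" "\<And>x. x \<notin> {c'..d'} \<Longrightarrow> \<theta>0 x = 0"
        using \<theta> \<theta>0 by (auto simp: C1_test_functions_def)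
      have "\<zeta> x = 0" if "x \<notin> {min c c'..max d d'}" for x
      proof -
        have "x \<notin> {c..d}" "x \<notin> {c'..d'}" using that by auto
        thus ?thesis by (simp add: \<zeta>_def cd)
      qed
      moreover have "a < min c c'" "max d d' < b" using cd by auto
      moreover have "\<zeta> C1_differentiable_on UNIV"
        using \<theta> \<theta>0 unfolding \<zeta>_def C1_test_functions_def
        by (intro C1_differentiable_on_diff C1_differentiable_on_mult) auto
      ultimately show ?thesis unfolding C1_test_functions_def by blast
    qed
    have "(LINT x:{a<..<b}|lborel. \<zeta> x) = 0"
      using \<theta>0(2) int[OF \<theta>] int[OF \<theta>0(1)]
      by (simp add: \<zeta>_def set_integral_diff set_integrable_mult_right k_def J_def)
    then obtain \<psi> where \<psi>: "\<psi> \<in> C1_test_functions a b" "\<And>x. vector_derivative \<psi> (at x) = \<zeta> x"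
      using test_function_integral_zero_imp_antiderivative[OF ab \<zeta>] by blast
    have "0 = (LINT x:{a<..<b}|lborel. f x * \<zeta> x)" using orth[OF \<psi>(1)] \<psi>(2) by simp
    also have "\<dots> = (LINT x:{a<..<b}|lborel. f x * \<theta> x - k * (f x * \<theta>0 x))"
      by (simp add: \<zeta>_def algebra_simps)
    also have "\<dots> = (LINT x:{a<..<b}|lborel. f x * \<theta> x) - k * (LINT x:{a<..<b}|lborel. f x * \<theta>0 x)"
      using fint[OF \<theta>] fint[OF \<theta>0(1)] by (simp add: set_integral_diff set_integrable_mult_right)
    also have "\<dots> = (LINT x:{a<..<b}|lborel. f x * \<theta> x) - C * (LINT x:{a<..<b}|lborel. \<theta> x)"
      by (simp add: k_def C_def)
    also have "\<dots> = (LINT x:{a<..<b}|lborel. f x * \<theta> x - C * \<theta> x)"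
      using fint[OF \<theta>] int[OF \<theta>] by (simp add: set_integral_diff set_integrable_mult_right)
    finally show ?thesis by (simp add: algebra_simps)
  qed
  hence "AE x in lborel. x \<in> {a<..<b} \<longrightarrow> f x - C = 0"
    by (intro orthogonal_test_functions_imp_zero ab sq_integrable_diff f const)
  thus ?thesis by (intro that[of C]) auto
qed

lemma primitive_on_test_function:
  assumes ab: "a < b" and F: "primitive_on a b F f" and "sq_integrable a b F" "sq_integrable a b f"
    and \<psi>: "\<psi> \<in> C1_test_functions a b"
  shows "(LINT x:{a<..<b}|lborel. F x * vector_derivative \<psi> (at x)) = - (LINT x:{a<..<b}|lborel. f x * \<psi> x)"
proof -
  have C1: "\<psi> C1_differentiable_on UNIV" and "\<psi> a = 0" "\<psi> b = 0"
    using \<psi> by (auto simp: C1_test_functions_def)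
  hence "(LINT x:{a<..<b}|lborel. f x * \<psi> x + F x * vector_derivative \<psi> (at x)) = 0"
    using primitive_on_mult_aux(2)[OF F primitive_on_C1[OF C1]] ab by simp
  thus ?thesis
    using sq_integrable_mult[OF assms(4) test_function_sq_integrable(1)[OF \<psi>]]
      sq_integrable_mult[OF assms(3) test_function_sq_integrable(2)[OF \<psi>]]
    by (simp add: set_integral_add add_eq_0_iff)
qed

text \<open>A primitive is unconstrained outside [a, b]; the indicator provides the global
  measurability.\<close>

lemma primitive_on_sq_integrable:
  assumes "primitive_on a b F f"
  shows "sq_integrable a b (\<lambda>x. indicator {a<..<b} x * F x)"
proof -
  have c: "continuous_on {a..b} F" by (rule primitive_on_continuous[OF assms])
  have "bounded (F ` {a..b})" by (intro compact_imp_bounded compact_continuous_image c) auto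
  then obtain K where "\<forall>y\<in>F ` {a..b}. norm y \<le> K" unfolding bounded_iff by blast
  moreover have "(\<lambda>x. indicator {a<..<b} x *\<^sub>R F x) \<in> borel_measurable borel"
    by (intro borel_measurable_continuous_on_indicator continuous_on_subset[OF c]) auto
  hence "(\<lambda>x. indicator {a<..<b} x * F x) \<in> borel_measurable borel"
    by (simp add: scaleR_conv_of_real of_real_indicator)
  ultimately show ?thesis by (intro sq_integrable_bounded[where K = K]) auto
qed

lemma primitive_onI:
  assumes "set_integrable lborel {a<..<b} f"
  shows "primitive_on a b (\<lambda>x. c + (LINT y:{a<..<x}|lborel. f y)) f"
  using assms by (simp add: primitive_on_def set_lebesgue_integral_def)

text \<open>Subtracting the explicit primitive of \<open>g\<close> leaves a function with weak
  derivative zero, which is constant by du Bois-Reymond.\<close>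

theorem weak_derivative_imp_primitive:
  assumes ab: "a < b" and f: "sq_integrable a b f" and g: "sq_integrable a b g"
    and weak: "\<And>\<psi>. \<psi> \<in> C1_test_functions a b \<Longrightarrow>
      (LINT x:{a<..<b}|lborel. f x * vector_derivative \<psi> (at x)) = - (LINT x:{a<..<b}|lborel. g x * \<psi> x)"
  obtains F where "primitive_on a b F g" "AE x in lborel. x \<in> {a<..<b} \<longrightarrow> f x = F x"
proof -
  define G0 where "G0 x = (LINT y:{a<..<x}|lborel. g y)" for x
  have G0: "primitive_on a b G0 g"
    using primitive_onI[OF sq_integrable_imp_integrable[OF g], of 0] by (simp add: G0_def[abs_def])
  define G where "G x = indicator {a<..<b} x * G0 x" for x
  have G: "sq_integrable a b G" unfolding G_def by (rule primitive_on_sq_integrable[OF G0])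
  have "(LINT x:{a<..<b}|lborel. (f x - G x) * vector_derivative \<psi> (at x)) = 0"
    if \<psi>: "\<psi> \<in> C1_test_functions a b" for \<psi>
  proof -
    have C1: "\<psi> C1_differentiable_on UNIV" and "\<psi> a = 0" "\<psi> b = 0"
      using \<psi> by (auto simp: C1_test_functions_def)
    hence "(LINT x:{a<..<b}|lborel. g x * \<psi> x + G0 x * vector_derivative \<psi> (at x)) = 0"
      using primitive_on_mult_aux(2)[OF G0 primitive_on_C1[OF C1]] ab by simp
    hence "(LINT x:{a<..<b}|lborel. g x * \<psi> x + G x * vector_derivative \<psi> (at x)) = 0"
      unfolding set_lebesgue_integral_def G_def
      by (subst (asm) Bochner_Integration.integral_cong[OF refl]) (auto split: split_indicator)
    thus ?thesis
      using weak[OF \<psi>] sq_integrable_mult[OF g test_function_sq_integrable(1)[OF \<psi>]]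
        sq_integrable_mult[OF f test_function_sq_integrable(2)[OF \<psi>]]
        sq_integrable_mult[OF G test_function_sq_integrable(2)[OF \<psi>]]
      by (simp add: set_integral_add set_integral_diff left_diff_distrib add_eq_0_iff)
  qed
  then obtain c where "AE x in lborel. x \<in> {a<..<b} \<longrightarrow> f x - G x = c"
    using du_Bois_Reymond[OF ab sq_integrable_diff[OF f G]] by blast
  hence "AE x in lborel. x \<in> {a<..<b} \<longrightarrow> f x = c + G0 x"
    by eventually_elim (auto simp: G_def algebra_simps)
  moreover have "primitive_on a b (\<lambda>x. c + G0 x) g"
    unfolding G0_def by (intro primitive_onI sq_integrable_imp_integrable g)
  ultimately show ?thesis by (intro that[of "\<lambda>x. c + G0 x"])
qed

section \<open>Completeness of L2\<close>

lemma sq_dist_nonneg: "0 \<le> sq_dist a b f g"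
  unfolding sq_dist_def set_lebesgue_integral_def by (intro integral_nonneg_AE) auto

text \<open>Young's inequality with a free parameter: \<open>r\<close> is a power of 1/3 in the
  completeness proof, while the optimal \<open>r\<close> gives Cauchy-Schwarz in the estimate of
  point values.\<close>

lemma sq_integrable_cmod_bound:
  assumes ab: "a \<le> b" and f: "sq_integrable a b f" and r: "r > 0"
  shows "(LINT x:{a<..<b}|lborel. cmod (f x)) \<le> (r * (b - a) + (LINT x:{a<..<b}|lborel. (cmod (f x))\<^sup>2) / r) / 2"
proof -
  have c: "set_integrable lborel {a<..<b} (\<lambda>_. r)" by (rule set_integrable_bounded) auto
  have s: "set_integrable lborel {a<..<b} (\<lambda>x. (cmod (f x))\<^sup>2 / r)"
    using f by (intro set_integrable_divide) (auto simp: sq_integrable_def)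
  have le: "cmod (f x) \<le> (r + (cmod (f x))\<^sup>2 / r) / 2" for x
    using sum_squares_bound[of r "cmod (f x)"] r by (simp add: field_simps power2_eq_square)
  have "(LINT x:{a<..<b}|lborel. cmod (f x)) \<le> (LINT x:{a<..<b}|lborel. (r + (cmod (f x))\<^sup>2 / r) / 2)"
    by (intro set_integral_mono set_integrable_norm sq_integrable_imp_integrable f
        set_integrable_divide set_integral_add(1) c s le)
  also have "\<dots> = (r * (b - a) + (LINT x:{a<..<b}|lborel. (cmod (f x))\<^sup>2) / r) / 2"
    using c s ab by (simp add: set_integral_add(2)) (simp add: set_lebesgue_integral_def)
  finally show ?thesis .
qed

text \<open>Fatou's lemma passes a bound on the distance to a fixed \<open>h\<close> to the
  pointwise limit, and so gives its square integrability as well.\<close>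

lemma sq_integrable_Fatou:
  assumes f: "\<And>m. sq_integrable a b (f m)" and [measurable]: "g \<in> borel_measurable borel"
    and lim: "AE x in lborel. x \<in> {a<..<b} \<longrightarrow> (\<lambda>m. f m x) \<longlonglongrightarrow> g x"
    and h: "sq_integrable a b h" and bd: "\<And>m. m \<ge> n \<Longrightarrow> sq_dist a b (f m) h \<le> B"
  shows "sq_integrable a b g" "sq_dist a b g h \<le> B"
proof -
  have [measurable]: "f m \<in> borel_measurable borel" "h \<in> borel_measurable borel" for m
    using f h by (auto simp: sq_integrable_def)
  have B0: "B \<ge> 0" using bd[of n] sq_dist_nonneg[of a b "f n" h] by simp
  define u where "u m x = ennreal (indicator {a<..<b} x * (cmod (f m x - h x))\<^sup>2)" for m x
  define v where "v x = indicator {a<..<b} x * (cmod (g x - h x))\<^sup>2" for x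
  have [measurable]: "v \<in> borel_measurable borel" "u m \<in> borel_measurable borel" for m
    unfolding u_def v_def by measurable
  have um: "(\<integral>\<^sup>+x. u m x \<partial>lborel) = ennreal (sq_dist a b (f m) h)" for m
    using sq_integrable_diff[OF f[of m] h] unfolding u_def sq_dist_def set_lebesgue_integral_def
    by (subst nn_integral_eq_integral) (auto simp: sq_integrable_def set_integrable_def)
  have "AE x in lborel. ennreal (v x) = liminf (\<lambda>m. u m x)"
    using lim
  proof eventually_elim
    case (elim x)
    have "(\<lambda>m. u m x) \<longlonglongrightarrow> ennreal (v x)"
    proof (cases "x \<in> {a<..<b}")
      case True
      thus ?thesis using elim unfolding u_def v_def by (intro tendsto_ennrealI tendsto_intros) auto
    qed (simp add: u_def v_def)
    thus ?case by (simp add: lim_imp_Liminf)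
  qed
  hence "(\<integral>\<^sup>+x. ennreal (v x) \<partial>lborel) = (\<integral>\<^sup>+x. liminf (\<lambda>m. u m x) \<partial>lborel)"
    by (intro nn_integral_cong_AE) auto
  also have "\<dots> \<le> liminf (\<lambda>m. \<integral>\<^sup>+x. u m x \<partial>lborel)" by (intro nn_integral_liminf) auto
  also have "\<dots> \<le> limsup (\<lambda>m. \<integral>\<^sup>+x. u m x \<partial>lborel)" by (intro Liminf_le_Limsup) auto
  also have "\<dots> \<le> ennreal B"
    by (intro Limsup_bounded) (use bd in \<open>auto simp: um eventually_sequentially intro!: exI[of _ n] ennreal_leI\<close>)
  finally have le: "(\<integral>\<^sup>+x. ennreal (v x) \<partial>lborel) \<le> ennreal B" .
  have v0: "v x \<ge> 0" for x by (simp add: v_def)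
  have iv: "integrable lborel v"
    using le v0 by (intro integrableI_bounded) (auto simp: le_less_trans)
  have gh: "sq_integrable a b (\<lambda>x. g x - h x)"
    using iv by (simp add: sq_integrable_def set_integrable_def v_def[abs_def])
  from sq_integrable_add[OF gh h] show "sq_integrable a b g" by simp
  have "ennreal (sq_dist a b g h) = (\<integral>\<^sup>+x. ennreal (v x) \<partial>lborel)"
    using iv v0 by (subst nn_integral_eq_integral) (auto simp: sq_dist_def set_lebesgue_integral_def v_def[abs_def])
  thus "sq_dist a b g h \<le> B" using le B0 by (metis ennreal_le_iff)
qed

text \<open>The first increment is peeled off, not the last, so that the doubling hits the smaller
  tail: 2 * 3/9 + 2 = 8/3, which is at most 3.\<close>

lemma sq_dist_rapidly_Cauchy:
  assumes f: "\<And>n. sq_integrable a b (f n)" and d: "\<And>n. sq_dist a b (f (Suc n)) (f n) \<le> C * (1/9) ^ n"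
  shows "sq_dist a b (f (n + k)) (f n) \<le> 3 * C * (1/9) ^ n"
proof (induction k arbitrary: n)
  have C: "0 \<le> C" using order_trans[OF sq_dist_nonneg d[of 0]] by simp
  {
    case 0
    show ?case using C by (simp add: sq_dist_def set_lebesgue_integral_def)
  next
    case (Suc k)
    have "sq_dist a b (f (n + Suc k)) (f n)
        \<le> 2 * sq_dist a b (f (Suc n + k)) (f (Suc n)) + 2 * sq_dist a b (f (Suc n)) (f n)"
      using sq_dist_triangle[OF f f f] by simp
    also have "\<dots> \<le> 2 * (3 * C * (1/9) ^ Suc n) + 2 * (C * (1/9) ^ n)"
      using Suc[of "Suc n"] d[of n] by (intro add_mono mult_left_mono) auto
    also have "\<dots> \<le> 3 * C * (1/9) ^ n" using C by (simp add: field_simps)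
    finally show ?case .
  }
qed

theorem Riesz_Fischer:
  assumes ab: "a \<le> b" and f: "\<And>n. sq_integrable a b (f n)"
    and d: "\<And>n. sq_dist a b (f (Suc n)) (f n) \<le> C * (1/9) ^ n"
  obtains g where "sq_integrable a b g" "\<And>n. sq_dist a b g (f n) \<le> 3 * C * (1/9) ^ n"
proof -
  have C: "0 \<le> C" using order_trans[OF sq_dist_nonneg d[of 0]] by simp
  have [measurable]: "f m \<in> borel_measurable borel" for m
    using f by (auto simp: sq_integrable_def)
  define u where "u n x = indicator {a<..<b} x * cmod (f (Suc n) x - f n x)" for n x
  have [measurable]: "u n \<in> borel_measurable borel" for n unfolding u_def by measurable
  have iu: "integrable lborel (u n)" for n
    using set_integrable_norm[OF sq_integrable_imp_integrable[OF sq_integrable_diff[OF f[of "Suc n"] f[of n]]]]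
    by (simp add: u_def[abs_def] set_integrable_def)
  have ub: "(LINT x|lborel. u n x) \<le> ((b - a) + C) / 2 * (1/3) ^ n" for n
  proof -
    \<comment> \<open>The parameter (1/3)^n balances both terms, since (1/9)^n / (1/3)^n =
      (1/3)^n.\<close>
    have "(LINT x|lborel. u n x) \<le> ((1/3)^n * (b - a) + sq_dist a b (f (Suc n)) (f n) / (1/3)^n) / 2"
      using sq_integrable_cmod_bound[OF ab sq_integrable_diff[OF f[of "Suc n"] f[of n]], of "(1/3)^n"]
      by (simp add: u_def[abs_def] set_lebesgue_integral_def sq_dist_def)
    also have "\<dots> \<le> ((1/3)^n * (b - a) + (C * (1/9) ^ n) / (1/3)^n) / 2"
      using d[of n] by (intro divide_right_mono add_left_mono) auto
    also have "(C * (1/9) ^ n) / (1/3)^n = C * (1/3)^n"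
    proof -
      have "(9::real)^n = 3^n * 3^n" by (simp flip: power_mult_distrib)
      thus ?thesis by (simp add: power_divide)
    qed
    finally show ?thesis by (simp add: algebra_simps)
  qed
  have u0: "u n x \<ge> 0" for n x by (simp add: u_def)
  have "summable (\<lambda>n. LINT x|lborel. u n x)"
  proof (rule summable_comparison_test')
    show "summable (\<lambda>n. ((b - a) + C) / 2 * (1/3::real) ^ n)" by (intro summable_mult summable_geometric) simp
    show "norm (LINT x|lborel. u n x) \<le> ((b - a) + C) / 2 * (1/3) ^ n" if "n \<ge> 0" for n
      using ub[of n] u0 by (simp only: real_norm_def abs_of_nonneg integral_nonneg_AE AE_I2)
  qed
  \<comment> \<open>Finiteness of the sum of the integrals is moved inside by monotone convergence,
    so the pointwise sum is finite almost everywhere.\<close>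
  hence "(\<Sum>n. ennreal (LINT x|lborel. u n x)) \<noteq> \<infinity>"
    using ennreal_suminf_neq_top u0 by (auto intro: integral_nonneg_AE)
  hence "(\<Sum>n. \<integral>\<^sup>+x. ennreal (u n x) \<partial>lborel) \<noteq> \<infinity>"
    using u0 by (simp add: nn_integral_eq_integral[OF iu])
  hence "(\<integral>\<^sup>+x. (\<Sum>n. ennreal (u n x)) \<partial>lborel) \<noteq> \<infinity>" by (subst nn_integral_suminf) auto
  hence "AE x in lborel. (\<Sum>n. ennreal (u n x)) \<noteq> \<infinity>" by (intro nn_integral_noteq_infinite) auto
  hence AE: "AE x in lborel. x \<in> {a<..<b} \<longrightarrow> convergent (\<lambda>n. f n x)"
  proof eventually_elim
    case (elim x)
    show ?case
    proof
      assume x: "x \<in> {a<..<b}"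
      have "summable (\<lambda>n. u n x)" using elim u0 by (auto intro: summable_suminf_not_top)
      hence "summable (\<lambda>n. f (Suc n) x - f n x)" using x
        by (simp add: u_def) (rule summable_norm_cancel)
      hence "convergent (\<lambda>n. \<Sum>k<n. f (Suc k) x - f k x)" by (simp add: summable_iff_convergent)
      hence "convergent (\<lambda>n. f n x - f 0 x)" by (simp add: sum_lessThan_telescope[of "\<lambda>n. f n x"])
      hence "convergent (\<lambda>n. (f n x - f 0 x) + f 0 x)" by (intro convergent_add convergent_const)
      thus "convergent (\<lambda>n. f n x)" by simp
    qed
  qed
  define g where "g x = lim (\<lambda>n. f n x)" for x
  have [measurable]: "g \<in> borel_measurable borel" unfolding g_def[abs_def] by measurable
  have lim: "AE x in lborel. x \<in> {a<..<b} \<longrightarrow> (\<lambda>n. f n x) \<longlonglongrightarrow> g x"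
    using AE by eventually_elim (auto simp: g_def convergent_LIMSEQ_iff)
  have bd: "sq_dist a b (f m) (f n) \<le> 3 * C * (1/9) ^ n" if "m \<ge> n" for m n
    using sq_dist_rapidly_Cauchy[where f = f, OF f d, of n "m - n"] that by simp
  show ?thesis
    using sq_integrable_Fatou[OF f _ lim f bd] by (intro that[of g]) auto
qed

section \<open>Sobolev functions on an interval\<close>

lemma ae_eq_refl_iff [simp]: "ae_eq F F \<longleftrightarrow> F \<in> borel_measurable borel"
  by (simp add: ae_eq_def)

lemma abs_mfun_eq_iff:
  "F \<in> borel_measurable borel \<Longrightarrow> G \<in> borel_measurable borel \<Longrightarrow>
    abs_mfun F = abs_mfun G \<longleftrightarrow> (AE x in lborel. F x = G x)"
  using Quotient3_rel[OF Quotient3_mfun, of F G] by (simp add: ae_eq_def)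

lemma mfun_cases: obtains F where "F \<in> borel_measurable borel" "f = abs_mfun F"
proof
  have "ae_eq (rep_mfun f) (rep_mfun f)" by (rule Quotient3_rep_reflp[OF Quotient3_mfun])
  thus "rep_mfun f \<in> borel_measurable borel" by simp
  show "f = abs_mfun (rep_mfun f)" by (simp add: Quotient3_abs_rep[OF Quotient3_mfun])
qed

text \<open>The class of a function cut off to (a, b), in the extension-by-zero convention of
  \<open>L2\<close>; every element of \<open>L2 a b\<close> arises from a square integrable function
  in this way.\<close>

definition restr :: "real \<Rightarrow> real \<Rightarrow> (real \<Rightarrow> complex) \<Rightarrow> mfun" where
  "restr a b F = abs_mfun (\<lambda>x. indicator {a<..<b} x * F x)"

lemma sq_integrable_restrict:
  "sq_integrable a b F \<Longrightarrow> sq_integrable a b (\<lambda>x. indicator {a<..<b} x * F x)"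
proof -
  assume F: "sq_integrable a b F"
  have "set_integrable lborel {a<..<b} (\<lambda>x. (cmod (indicator {a<..<b} x * F x))\<^sup>2)
      \<longleftrightarrow> set_integrable lborel {a<..<b} (\<lambda>x. (cmod (F x))\<^sup>2)"
    by (intro set_integrable_cong) auto
  thus ?thesis using F by (auto simp: sq_integrable_def)
qed

lemma restr_cong: "(\<And>x. x \<in> {a<..<b} \<Longrightarrow> F x = G x) \<Longrightarrow> restr a b F = restr a b G"
  unfolding restr_def by (intro arg_cong[where f = abs_mfun] ext) (auto simp: indicator_def)

lemma restr_L2 [simp, intro]: "sq_integrable a b F \<Longrightarrow> restr a b F \<in> L2 a b"
  using sq_integrable_restrict[of a b F]
  by (simp add: restr_def L2_def in_L2.abs_eq sq_integrable_def)

lemma L2_cases: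
  assumes "f \<in> L2 a b"
  obtains F where "sq_integrable a b F" "f = restr a b F"
proof -
  obtain F where F: "F \<in> borel_measurable borel" "f = abs_mfun F" by (rule mfun_cases)
  hence L2: "AE x in lborel. x \<notin> {a<..<b} \<longrightarrow> F x = 0" "sq_integrable a b F"
    using assms by (simp_all add: L2_def in_L2.abs_eq sq_integrable_def)
  have "AE x in lborel. F x = indicator {a<..<b} x * F x"
    using L2(1) by eventually_elim (auto simp: indicator_def)
  hence "f = restr a b F" using F sq_integrable_restrict[OF L2(2)]
    by (simp add: restr_def abs_mfun_eq_iff sq_integrable_def)
  with L2(2) show ?thesis by (rule that)
qed

lemma restr_eq_iff:
  assumes "sq_integrable a b F" "sq_integrable a b G"
  shows "restr a b F = restr a b G \<longleftrightarrow> (AE x in lborel. x \<in> {a<..<b} \<longrightarrow> F x = G x)"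
proof -
  have "restr a b F = restr a b G \<longleftrightarrow> (AE x in lborel. indicator {a<..<b} x * F x = indicator {a<..<b} x * G x)"
    unfolding restr_def using assms[THEN sq_integrable_restrict]
    by (intro abs_mfun_eq_iff) (auto simp: sq_integrable_def)
  also have "\<dots> \<longleftrightarrow> (AE x in lborel. x \<in> {a<..<b} \<longrightarrow> F x = G x)"
    by (intro AE_cong) (auto simp: indicator_def)
  finally show ?thesis .
qed

lemma restr_add:
  assumes "sq_integrable a b F" "sq_integrable a b G"
  shows "restr a b F + restr a b G = restr a b (\<lambda>x. F x + G x)"
  using assms[THEN sq_integrable_restrict]
  by (simp add: restr_def plus_mfun.abs_eq sq_integrable_def distrib_left)

lemma restr_diff:
  assumes "sq_integrable a b F" "sq_integrable a b G"
  shows "restr a b F - restr a b G = restr a b (\<lambda>x. F x - G x)"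
  using assms[THEN sq_integrable_restrict]
  by (simp add: restr_def minus_mfun.abs_eq sq_integrable_def right_diff_distrib)

lemma restr_scaleR:
  assumes "sq_integrable a b F"
  shows "r *\<^sub>R restr a b F = restr a b (\<lambda>x. of_real r * F x)"
  using assms[THEN sq_integrable_restrict]
  by (simp add: restr_def scaleR_mfun.abs_eq sq_integrable_def scaleR_conv_of_real mult.left_commute)

lemma restr_0: "restr a b (\<lambda>_. 0) = 0"
  by (simp add: restr_def zero_mfun_def)

lemma L2_subspace: "subspace (L2 a b)"
proof (rule subspaceI)
  have "sq_integrable a b (\<lambda>_. 0)" by (rule sq_integrable_bounded) auto
  thus "0 \<in> L2 a b" using restr_0 restr_L2 by metis
  show "f + g \<in> L2 a b" if "f \<in> L2 a b" "g \<in> L2 a b" for f g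
    using that by (elim L2_cases) (auto simp: restr_add intro: sq_integrable_add)
  show "r *\<^sub>R f \<in> L2 a b" if "f \<in> L2 a b" for f r
    using that by (elim L2_cases) (auto simp: restr_scaleR intro: sq_integrable_mult_const)
qed

section \<open>Weighted real inner products\<close>

lemma borel_measurable_cnj_compose [measurable]:
  "f \<in> borel_measurable M \<Longrightarrow> (\<lambda>x. cnj (f x)) \<in> borel_measurable M"
  by (rule borel_measurable_continuous_on) (intro continuous_intros)

text \<open>The affine weight p + q x covers all the multipliers: 1, x - \<beta> and 2 - \<rho>. The
  real part makes it a real symmetric bilinear form, which is all that energy estimates use.\<close>

lift_definition wip :: "real \<Rightarrow> real \<Rightarrow> real \<Rightarrow> real \<Rightarrow> mfun \<Rightarrow> mfun \<Rightarrow> real" is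
  "\<lambda>p q a b f g. LINT x:{a<..<b}|lborel. (p + q * x) * Re (f x * cnj (g x))"
  unfolding ae_eq_def set_lebesgue_integral_def
proof (intro integral_cong_AE, goal_cases)
  case (3 p q a b f f' g g')
  then have "AE x in lborel. f x = f' x" "AE x in lborel. g x = g' x" by auto
  thus ?case by eventually_elim simp
qed auto

lemma sq_integrable_weighted:
  assumes "sq_integrable a b F" "sq_integrable a b G"
  shows "set_integrable lborel {a<..<b} (\<lambda>x. (p + q * x) * Re (F x * cnj (G x)))"
proof -
  have i: "set_integrable lborel {a<..<b} (\<lambda>x. F x * cnj (G x))"
    by (intro sq_integrable_mult sq_integrable_cnj assms)
  define K where "K = \<bar>p\<bar> + \<bar>q\<bar> * max \<bar>a\<bar> \<bar>b\<bar>"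
  have [measurable]: "F \<in> borel_measurable borel" "G \<in> borel_measurable borel"
    using assms by (auto simp: sq_integrable_def)
  have K: "\<bar>p + q * x\<bar> \<le> K" if "x \<in> {a<..<b}" for x
  proof -
    have "\<bar>q * x\<bar> \<le> \<bar>q\<bar> * max \<bar>a\<bar> \<bar>b\<bar>" using that by (auto simp: abs_mult intro!: mult_left_mono)
    thus ?thesis unfolding K_def by linarith
  qed
  have "set_integrable lborel {a<..<b} (\<lambda>x. K * cmod (F x * cnj (G x)))"
    by (intro set_integrable_mult_right set_integrable_norm i)
  thus ?thesis
  proof (rule set_integrable_dominated)
    fix x assume x: "x \<in> {a<..<b}"
    show "norm ((p + q * x) * Re (F x * cnj (G x))) \<le> K * cmod (F x * cnj (G x))"
      unfolding real_norm_def abs_mult using K[OF x] by (intro mult_mono abs_Re_le_cmod) auto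
  qed auto
qed

lemma Re_mult_cnj_self: "Re (z * cnj z) = (cmod z)\<^sup>2"
  by (simp add: cmod_power2 flip: power2_eq_square)

lemma wip_restr:
  assumes "sq_integrable a b F" "sq_integrable a b G"
  shows "wip p q a b (restr a b F) (restr a b G) = (LINT x:{a<..<b}|lborel. (p + q * x) * Re (F x * cnj (G x)))"
proof -
  have "wip p q a b (restr a b F) (restr a b G) = (LINT x:{a<..<b}|lborel. (p + q * x)
      * Re (indicator {a<..<b} x * F x * cnj (indicator {a<..<b} x * G x)))"
    unfolding restr_def using assms[THEN sq_integrable_restrict]
    by (intro wip.abs_eq) (auto simp: sq_integrable_def)
  also have "\<dots> = (LINT x:{a<..<b}|lborel. (p + q * x) * Re (F x * cnj (G x)))"
    unfolding set_lebesgue_integral_def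
    by (intro Bochner_Integration.integral_cong) (auto simp: indicator_def)
  finally show ?thesis .
qed

lemma wip_sym: "wip p q a b f g = wip p q a b g f"
proof -
  obtain F G where FG: "F \<in> borel_measurable borel" "f = abs_mfun F" "G \<in> borel_measurable borel" "g = abs_mfun G"
    by (metis mfun_cases)
  have "Re (F x * cnj (G x)) = Re (G x * cnj (F x))" for x by simp
  thus ?thesis using FG by (simp only: wip.abs_eq ae_eq_refl_iff)
qed

lemma L2_sqnorm_eq_wip: "L2_sqnorm a b f = wip 1 0 a b f f"
proof -
  obtain F where F: "F \<in> borel_measurable borel" "f = abs_mfun F" by (rule mfun_cases)
  have "(cmod (F x))\<^sup>2 = (1 + 0 * x) * Re (F x * cnj (F x))" for x
    by (simp only: Re_mult_cnj_self) simp
  thus ?thesis using F by (simp only: wip.abs_eq L2_sqnorm.abs_eq ae_eq_refl_iff)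
qed

lemma L2_sqnorm_nonneg: "0 \<le> L2_sqnorm a b f"
proof -
  obtain F where F: "F \<in> borel_measurable borel" "f = abs_mfun F" by (rule mfun_cases)
  thus ?thesis by (auto simp: L2_sqnorm.abs_eq set_lebesgue_integral_def intro: integral_nonneg_AE)
qed

lemma L2_sqnorm_restr:
  assumes "sq_integrable a b F"
  shows "L2_sqnorm a b (restr a b F) = (LINT x:{a<..<b}|lborel. (cmod (F x))\<^sup>2)"
  unfolding L2_sqnorm_eq_wip wip_restr[OF assms assms]
  by (simp only: Re_mult_cnj_self) simp

lemma wip_add_left:
  assumes "f \<in> L2 a b" "g \<in> L2 a b" "h \<in> L2 a b"
  shows "wip p q a b (f + g) h = wip p q a b f h + wip p q a b g h"
  using assms
proof (elim L2_cases)
  fix F G H assume i: "sq_integrable a b F" "sq_integrable a b G" "sq_integrable a b H"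
    and [simp]: "f = restr a b F" "g = restr a b G" "h = restr a b H"
  have "(p + q * x) * Re ((F x + G x) * cnj (H x))
     = (p + q * x) * Re (F x * cnj (H x)) + (p + q * x) * Re (G x * cnj (H x))" for x
    by (simp only: distrib_left distrib_right plus_complex.simps)
  thus ?thesis using i sq_integrable_add[OF i(1,2)]
    by (simp only: \<open>f = _\<close> \<open>g = _\<close> \<open>h = _\<close> restr_add wip_restr set_integral_add(2) sq_integrable_weighted)
qed

lemma wip_scaleR_left:
  assumes "f \<in> L2 a b" "h \<in> L2 a b"
  shows "wip p q a b (r *\<^sub>R f) h = r * wip p q a b f h"
  using assms
proof (elim L2_cases)
  fix F H assume i: "sq_integrable a b F" "sq_integrable a b H"
    and [simp]: "f = restr a b F" "h = restr a b H"
  have "(p + q * x) * Re (of_real r * F x * cnj (H x)) = r * ((p + q * x) * Re (F x * cnj (H x)))" for x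
    by (simp add: algebra_simps)
  thus ?thesis using i sq_integrable_mult_const[OF i(1), of "of_real r"]
    by (simp only: \<open>f = _\<close> \<open>h = _\<close> restr_scaleR wip_restr set_integral_mult_right)
qed

lemma wip_add_right:
  "f \<in> L2 a b \<Longrightarrow> g \<in> L2 a b \<Longrightarrow> h \<in> L2 a b \<Longrightarrow> wip p q a b h (f + g) = wip p q a b h f + wip p q a b h g"
  using wip_add_left wip_sym by metis

lemma wip_scaleR_right:
  "f \<in> L2 a b \<Longrightarrow> h \<in> L2 a b \<Longrightarrow> wip p q a b h (r *\<^sub>R f) = r * wip p q a b h f"
  using wip_scaleR_left wip_sym by metis

text \<open>Linearity in the weight; it evaluates the zero weight and the weight -1 that integration
  by parts produces.\<close>

lemma wip_combine:
  assumes f: "f \<in> L2 a b" and g: "g \<in> L2 a b"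
  shows "wip p q a b f g = p * wip 1 0 a b f g + q * wip 0 1 a b f g"
  using assms
proof (elim L2_cases)
  fix F G assume i: "sq_integrable a b F" "sq_integrable a b G"
    and [simp]: "f = restr a b F" "g = restr a b G"
  have "(p + q * x) * Re (F x * cnj (G x)) = p * ((1 + 0 * x) * Re (F x * cnj (G x)))
      + q * ((0 + 1 * x) * Re (F x * cnj (G x)))" for x
    by (simp add: algebra_simps)
  thus ?thesis using i
    by (simp only: \<open>f = _\<close> \<open>g = _\<close> wip_restr set_integral_mult_right set_integral_add(2)
        set_integrable_mult_right sq_integrable_weighted)
qed

lemma wip_bound:
  assumes f: "f \<in> L2 a b" and g: "g \<in> L2 a b" and K: "\<And>x. x \<in> {a<..<b} \<Longrightarrow> \<bar>p + q * x\<bar> \<le> K"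
  shows "\<bar>wip p q a b f g\<bar> \<le> K / 2 * (L2_sqnorm a b f + L2_sqnorm a b g)"
  using f g
proof (elim L2_cases)
  fix F G assume i: "sq_integrable a b F" "sq_integrable a b G"
    and [simp]: "f = restr a b F" "g = restr a b G"
  have s: "set_integrable lborel {a<..<b} (\<lambda>x. (cmod (F x))\<^sup>2)" "set_integrable lborel {a<..<b} (\<lambda>x. (cmod (G x))\<^sup>2)"
    using i by (auto simp: sq_integrable_def)
  have "\<bar>wip p q a b f g\<bar> \<le> (LINT x:{a<..<b}|lborel. norm ((p + q * x) * Re (F x * cnj (G x))))"
    using set_integral_norm_bound[OF sq_integrable_weighted[OF i, of p q]] i by (simp add: wip_restr)
  also have "\<dots> \<le> (LINT x:{a<..<b}|lborel. K / 2 * ((cmod (F x))\<^sup>2 + (cmod (G x))\<^sup>2))"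
  proof (intro set_integral_mono set_integrable_norm sq_integrable_weighted i set_integrable_mult_right set_integral_add(1) s)
    fix x assume x: "x \<in> {a<..<b}"
    have "\<bar>p + q * x\<bar> * \<bar>Re (F x * cnj (G x))\<bar> \<le> K * (((cmod (F x))\<^sup>2 + (cmod (G x))\<^sup>2) / 2)"
      using K[OF x] prod_le_half_sq[of "F x" "cnj (G x)"] abs_Re_le_cmod[of "F x * cnj (G x)"]
      by (intro mult_mono) (auto simp del: times_complex.simps)
    thus "norm ((p + q * x) * Re (F x * cnj (G x))) \<le> K / 2 * ((cmod (F x))\<^sup>2 + (cmod (G x))\<^sup>2)"
      by (simp add: abs_mult)
  qed
  also have "\<dots> = K / 2 * (L2_sqnorm a b f + L2_sqnorm a b g)"
    using s i by (simp add: L2_sqnorm_restr set_integral_add(2))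
  finally show ?thesis .
qed

lemma L2_rapidly_Cauchy:
  assumes ab: "a \<le> b" and f: "\<And>n. f n \<in> L2 a b"
    and d: "\<And>n. L2_sqnorm a b (f (Suc n) - f n) \<le> C * (1/9) ^ n"
  obtains g where "g \<in> L2 a b" "(\<lambda>n. L2_sqnorm a b (f n - g)) \<longlonglongrightarrow> 0"
proof -
  have "\<exists>F. sq_integrable a b F \<and> f n = restr a b F" for n using L2_cases[OF f] by metis
  then obtain F where F: "\<And>n. sq_integrable a b (F n)" "\<And>n. f n = restr a b (F n)" by metis
  have sd: "L2_sqnorm a b (restr a b P - restr a b Q) = sq_dist a b P Q"
    if "sq_integrable a b P" "sq_integrable a b Q" for P Q
    using that by (simp add: restr_diff L2_sqnorm_restr sq_integrable_diff sq_dist_def)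
  have "sq_dist a b (F (Suc n)) (F n) \<le> C * (1/9) ^ n" for n
    using d[of n] F by (simp add: sd)
  then obtain G where G: "sq_integrable a b G" "\<And>n. sq_dist a b G (F n) \<le> 3 * C * (1/9) ^ n"
    using Riesz_Fischer[where f = F, OF ab F(1)] by blast
  have sc: "sq_dist a b P Q = sq_dist a b Q P" for P Q by (simp add: sq_dist_def norm_minus_commute)
  have "(\<lambda>n. sq_dist a b (F n) G) \<longlonglongrightarrow> 0"
  proof (rule tendsto_sandwich[OF _ _ tendsto_const])
    have "(\<lambda>n. 3 * C * (1/9) ^ n) \<longlonglongrightarrow> 3 * C * 0" by (intro tendsto_intros LIMSEQ_realpow_zero) auto
    thus "(\<lambda>n. 3 * C * (1/9::real) ^ n) \<longlonglongrightarrow> 0" by simp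
  qed (use G sc[of "F _" G] in \<open>auto simp: sq_dist_nonneg\<close>)
  thus ?thesis using G F by (intro that[of "restr a b G"]) (auto simp: sd)
qed

section \<open>Uniqueness of weak derivatives and of point values\<close>

lemma has_weak_deriv_restr:
  assumes "sq_integrable a b F" "sq_integrable a b G"
  shows "has_weak_deriv a b (restr a b F) (restr a b G) \<longleftrightarrow>
    (\<forall>\<psi>\<in>C1_test_functions a b. (LINT x:{a<..<b}|lborel. F x * vector_derivative \<psi> (at x))
      = - (LINT x:{a<..<b}|lborel. G x * \<psi> x))"
proof -
  have "(LINT x:{a<..<b}|lborel. indicator {a<..<b} x * P x * h x) = (LINT x:{a<..<b}|lborel. P x * h x)"
    for P h :: "real \<Rightarrow> complex"
    unfolding set_lebesgue_integral_def
    by (intro Bochner_Integration.integral_cong) (auto simp: indicator_def)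
  thus ?thesis
    unfolding restr_def using assms[THEN sq_integrable_restrict]
    by (subst has_weak_deriv.abs_eq) (auto simp: sq_integrable_def)
qed

text \<open>Two candidates differ by a function orthogonal to all test functions, so the definite
  description is determined.\<close>

lemma weak_deriv_eqI:
  assumes ab: "a < b" and f: "f \<in> L2 a b" and g: "g \<in> L2 a b" and d: "has_weak_deriv a b f g"
  shows "weak_deriv a b f = g"
  unfolding weak_deriv_def
proof (rule the_equality)
  fix g' assume "g' \<in> L2 a b \<and> has_weak_deriv a b f g'"
  hence g': "g' \<in> L2 a b" and d': "has_weak_deriv a b f g'" by auto
  obtain F where F: "sq_integrable a b F" "f = restr a b F" using f by (rule L2_cases)
  obtain G where G: "sq_integrable a b G" "g = restr a b G" using g by (rule L2_cases)
  obtain G' where G': "sq_integrable a b G'" "g' = restr a b G'" using g' by (rule L2_cases)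
  have "AE x in lborel. x \<in> {a<..<b} \<longrightarrow> G' x - G x = 0"
  proof (intro orthogonal_test_functions_imp_zero ab sq_integrable_diff G G')
    fix \<psi> assume \<psi>: "\<psi> \<in> C1_test_functions a b"
    have "(LINT x:{a<..<b}|lborel. G' x * \<psi> x) = (LINT x:{a<..<b}|lborel. G x * \<psi> x)"
      using d d' F G G' \<psi> by (simp add: has_weak_deriv_restr)
    thus "(LINT x:{a<..<b}|lborel. (G' x - G x) * \<psi> x) = 0"
      using sq_integrable_mult[OF _ test_function_sq_integrable(1)[OF \<psi>]] G G'
      by (simp add: left_diff_distrib set_integral_diff)
  qed
  thus "g' = g" using G G' by (simp add: restr_eq_iff)
qed (use g d in auto)

text \<open>In the open interval the set of disagreement is open and null, hence empty; the end
  points follow by closure. This makes \<open>point_value\<close> well defined.\<close>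

lemma continuous_AE_eq_imp_eq:
  fixes f g :: "real \<Rightarrow> complex"
  assumes ab: "a < b" and f: "continuous_on {a..b} f" and g: "continuous_on {a..b} g"
    and AE: "AE x in lborel. x \<in> {a<..<b} \<longrightarrow> f x = g x" and x: "x \<in> {a..b}"
  shows "f x = g x"
proof -
  define U where "U = {a<..<b} \<inter> (\<lambda>x. f x - g x) -` (- {0})"
  have "continuous_on {a<..<b} (\<lambda>x. f x - g x)"
    by (intro continuous_intros continuous_on_subset[OF f] continuous_on_subset[OF g]) auto
  hence "open U" unfolding U_def by (intro continuous_open_preimage) auto
  have "AE x in lborel. x \<notin> U" using AE by eventually_elim (auto simp: U_def)
  hence "U \<in> null_sets lborel"
    using AE_iff_null_sets[of U lborel] \<open>open U\<close> by (auto simp: borel_open)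
  hence "negligible U" by (simp add: null_sets_completionI negligible_iff_null_sets)
  hence "U = {}" using open_not_negligible \<open>open U\<close> by blast
  hence z: "f y - g y = 0" if "y \<in> {a<..<b}" for y using that by (auto simp: U_def)
  have "f x - g x = 0"
  proof (rule continuous_constant_on_closure[of "{a<..<b}" "\<lambda>x. f x - g x"])
    show "continuous_on (closure {a<..<b}) (\<lambda>x. f x - g x)"
      using ab by (auto intro!: continuous_intros f g)
    show "x \<in> closure {a<..<b}" using ab x by simp
  qed (rule z)
  thus ?thesis by simp
qed

lemma point_value_restr:
  assumes ab: "a < b" and F: "sq_integrable a b F" "continuous_on {a..b} F" and x: "x \<in> {a..b}"
  shows "point_value a b (restr a b F) x = F x"
proof -
  have rep: "has_continuous_rep a b (restr a b F) G \<longleftrightarrow>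
      continuous_on {a..b} G \<and> (AE x in lborel. x \<in> {a<..<b} \<longrightarrow> F x = G x)" for G
  proof -
    have "has_continuous_rep a b (restr a b F) G \<longleftrightarrow>
        continuous_on {a..b} G \<and> (AE x in lborel. x \<in> {a<..<b} \<longrightarrow> indicator {a<..<b} x * F x = G x)"
      unfolding restr_def using F(1)[THEN sq_integrable_restrict]
      by (subst has_continuous_rep.abs_eq) (auto simp: sq_integrable_def)
    also have "(AE x in lborel. x \<in> {a<..<b} \<longrightarrow> indicator {a<..<b} x * F x = G x)
       \<longleftrightarrow> (AE x in lborel. x \<in> {a<..<b} \<longrightarrow> F x = G x)" by (intro AE_cong) auto
    finally show ?thesis .
  qed
  show ?thesis unfolding point_value_def
  proof (rule the_equality)
    show "\<exists>g. has_continuous_rep a b (restr a b F) g \<and> F x = g x"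
      using F by (intro exI[of _ F]) (simp add: rep)
    fix y assume "\<exists>g. has_continuous_rep a b (restr a b F) g \<and> y = g x"
    then obtain G where "continuous_on {a..b} G" "AE x in lborel. x \<in> {a<..<b} \<longrightarrow> F x = G x" "y = G x"
      by (auto simp: rep)
    thus "y = F x" using continuous_AE_eq_imp_eq[OF ab F(2) _ _ x] by auto
  qed
qed

text \<open>Continuing \<open>F\<close> by its boundary values makes it continuous on the line, so
  the same function serves as a primitive and as a measurable representative.\<close>

lemma primitive_on_extend:
  assumes "a \<le> b" and F: "primitive_on a b F f"
  obtains G where "primitive_on a b G f" "sq_integrable a b G" "\<And>x. x \<in> {a..b} \<Longrightarrow> G x = F x"
proof -
  define G where "G x = F (max a (min b x))" for x
  have GF: "G x = F x" if "x \<in> {a..b}" for x using that by (simp add: G_def)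
  have "continuous_on UNIV G" unfolding G_def
    by (intro continuous_on_compose2[OF primitive_on_continuous[OF F]] continuous_intros)
      (use assms in auto)
  moreover have "bounded (F ` {a..b})"
    by (intro compact_imp_bounded compact_continuous_image primitive_on_continuous[OF F]) auto
  then obtain K where "\<forall>y\<in>F ` {a..b}. norm y \<le> K" unfolding bounded_iff by blast
  ultimately have "sq_integrable a b G"
    by (intro sq_integrable_bounded[where K = K] borel_measurable_continuous_onI) (auto simp: GF)
  moreover have "primitive_on a b G f"
    unfolding primitive_on_def
  proof (intro conjI ballI)
    show "set_integrable lborel {a<..<b} f" using F by (simp add: primitive_on_def)
    fix x assume x: "x \<in> {a..b}"
    thus "G x = G a + (LINT y:{a<..<x}|lborel. f y)"
      using primitive_on_integral[OF F x] GF[of x] GF[of a] assms(1) by simp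
  qed
  ultimately show ?thesis using GF by (intro that)
qed

text \<open>The evaluation rules for \<open>weak_deriv\<close> and \<open>point_value\<close>.
  Together with \<open>H1_cases\<close>, which is the converse, they reduce statements about H1 to
  statements about primitives.\<close>

lemma restr_H1:
  assumes ab: "a < b" and F: "primitive_on a b F f" "sq_integrable a b F" "sq_integrable a b f"
  shows "restr a b F \<in> H1 a b" "weak_deriv a b (restr a b F) = restr a b f"
    "x \<in> {a..b} \<Longrightarrow> point_value a b (restr a b F) x = F x"
proof -
  have d: "has_weak_deriv a b (restr a b F) (restr a b f)"
    using primitive_on_test_function[OF ab F] F by (simp add: has_weak_deriv_restr)
  show "restr a b F \<in> H1 a b" using d F by (auto simp: H1_def)
  show "weak_deriv a b (restr a b F) = restr a b f" using d F ab by (intro weak_deriv_eqI) auto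
  show "x \<in> {a..b} \<Longrightarrow> point_value a b (restr a b F) x = F x"
    by (intro point_value_restr ab F primitive_on_continuous[OF F(1)])
qed

lemma H1_cases:
  assumes ab: "a < b" and u: "u \<in> H1 a b"
  obtains F f where "primitive_on a b F f" "sq_integrable a b F" "sq_integrable a b f" "u = restr a b F"
proof -
  obtain g where g: "u \<in> L2 a b" "g \<in> L2 a b" "has_weak_deriv a b u g" using u by (auto simp: H1_def)
  obtain U where U: "sq_integrable a b U" "u = restr a b U" using g(1) by (rule L2_cases)
  obtain f where f: "sq_integrable a b f" "g = restr a b f" using g(2) by (rule L2_cases)
  obtain F0 where F0: "primitive_on a b F0 f" "AE x in lborel. x \<in> {a<..<b} \<longrightarrow> U x = F0 x"
    using weak_derivative_imp_primitive[OF ab U(1) f(1)] g(3) U(2) f(2) has_weak_deriv_restr[OF U(1) f(1)]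
    by blast
  obtain F where F: "primitive_on a b F f" "sq_integrable a b F" "\<And>x. x \<in> {a..b} \<Longrightarrow> F x = F0 x"
    using primitive_on_extend[OF less_imp_le[OF ab] F0(1)] by blast
  have "AE x in lborel. x \<in> {a<..<b} \<longrightarrow> U x = F x" using F0(2) by eventually_elim (simp add: F(3))
  hence "u = restr a b F" using U F by (simp add: restr_eq_iff)
  with F f show ?thesis by (intro that)
qed

section \<open>Linear structure, approximation and integration by parts in H1\<close>

lemma H1_L2 [intro]: "u \<in> H1 a b \<Longrightarrow> u \<in> L2 a b"
  by (simp add: H1_def)

lemma weak_deriv_L2 [intro]:
  assumes ab: "a < b" and "u \<in> H1 a b"
  shows "weak_deriv a b u \<in> L2 a b"
proof -
  obtain F f where F: "primitive_on a b F f" "sq_integrable a b F" "sq_integrable a b f" "u = restr a b F"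
    using ab assms(2) by (rule H1_cases)
  thus ?thesis by (simp only: restr_H1(2)[OF ab F(1-3)] restr_L2)
qed

lemma primitive_on_add:
  assumes "primitive_on a b F f" "primitive_on a b G g"
  shows "primitive_on a b (\<lambda>x. F x + G x) (\<lambda>x. f x + g x)"
  unfolding primitive_on_def
proof (intro conjI ballI)
  have i: "set_integrable lborel {a<..<b} f" "set_integrable lborel {a<..<b} g"
    using assms by (auto simp: primitive_on_def)
  thus "set_integrable lborel {a<..<b} (\<lambda>x. f x + g x)" by (rule set_integral_add(1))
  fix x assume x: "x \<in> {a..b}"
  have "set_integrable lborel {a<..<x} f" "set_integrable lborel {a<..<x} g"
    using i x by (auto intro!: set_integrable_subset[of lborel "{a<..<b}"])
  thus "F x + G x = F a + G a + (LINT y:{a<..<x}|lborel. f y + g y)"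
    using primitive_on_integral[OF assms(1) x] primitive_on_integral[OF assms(2) x]
    by (simp add: set_integral_add(2))
qed

lemma primitive_on_cmult:
  assumes "primitive_on a b F f"
  shows "primitive_on a b (\<lambda>x. c * F x) (\<lambda>x. c * f x)"
  unfolding primitive_on_def
proof (intro conjI ballI)
  show "set_integrable lborel {a<..<b} (\<lambda>x. c * f x)"
    using assms by (auto simp: primitive_on_def)
  fix x assume x: "x \<in> {a..b}"
  have "c * (LINT y:{a<..<x}|lborel. f y) = c * (F x - F a)"
    by (simp only: primitive_on_integral[OF assms x])
  thus "c * F x = c * F a + (LINT y:{a<..<x}|lborel. c * f y)"
    by (simp add: right_diff_distrib)
qed

lemma H1_add:
  assumes ab: "a < b" and "u \<in> H1 a b" "v \<in> H1 a b"
  shows "u + v \<in> H1 a b" "weak_deriv a b (u + v) = weak_deriv a b u + weak_deriv a b v"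
    "x \<in> {a..b} \<Longrightarrow> point_value a b (u + v) x = point_value a b u x + point_value a b v x"
proof -
  obtain F f where F: "primitive_on a b F f" "sq_integrable a b F" "sq_integrable a b f" "u = restr a b F"
    using ab assms(2) by (rule H1_cases)
  obtain G g where G: "primitive_on a b G g" "sq_integrable a b G" "sq_integrable a b g" "v = restr a b G"
    using ab assms(3) by (rule H1_cases)
  note * = restr_H1[OF ab primitive_on_add[OF F(1) G(1)] sq_integrable_add[OF F(2) G(2)] sq_integrable_add[OF F(3) G(3)]]
  show "u + v \<in> H1 a b" "weak_deriv a b (u + v) = weak_deriv a b u + weak_deriv a b v"
    "x \<in> {a..b} \<Longrightarrow> point_value a b (u + v) x = point_value a b u x + point_value a b v x"
    using * F G ab by (simp_all add: restr_add restr_H1[where F = F] restr_H1[where F = G])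
qed

lemma H1_scaleR:
  assumes ab: "a < b" and "u \<in> H1 a b"
  shows "r *\<^sub>R u \<in> H1 a b" "weak_deriv a b (r *\<^sub>R u) = r *\<^sub>R weak_deriv a b u"
    "x \<in> {a..b} \<Longrightarrow> point_value a b (r *\<^sub>R u) x = of_real r * point_value a b u x"
proof -
  obtain F f where F: "primitive_on a b F f" "sq_integrable a b F" "sq_integrable a b f" "u = restr a b F"
    using ab assms(2) by (rule H1_cases)
  note * = restr_H1[OF ab primitive_on_cmult[OF F(1)] sq_integrable_mult_const[OF F(2)] sq_integrable_mult_const[OF F(3)]]
  show "r *\<^sub>R u \<in> H1 a b" "weak_deriv a b (r *\<^sub>R u) = r *\<^sub>R weak_deriv a b u"
    "x \<in> {a..b} \<Longrightarrow> point_value a b (r *\<^sub>R u) x = of_real r * point_value a b u x"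
    using * F ab by (simp_all add: restr_scaleR restr_H1[where F = F])
qed

text \<open>The free initial value \<open>c\<close> serves to satisfy the condition v(0) = 0 and the
  matching of v and w at the interface.\<close>

lemma H1_primitive:
  assumes ab: "a < b" and f: "f \<in> L2 a b"
  obtains u where "u \<in> H1 a b" "weak_deriv a b u = f" "point_value a b u a = c"
proof -
  obtain g where g: "sq_integrable a b g" "f = restr a b g" using f by (rule L2_cases)
  obtain F where F: "primitive_on a b F g" "sq_integrable a b F"
      "\<And>x. x \<in> {a..b} \<Longrightarrow> F x = c + (LINT y:{a<..<x}|lborel. g y)"
    using primitive_on_extend[OF less_imp_le[OF ab] primitive_onI[OF sq_integrable_imp_integrable[OF g(1)], of c]]
    by blast
  have "F a = c" using F(3)[of a] ab by (simp add: set_lebesgue_integral_def)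
  thus ?thesis using restr_H1[OF ab F(1,2) g(1)] g(2) ab by (intro that[of "restr a b F"]) auto
qed

text \<open>Approximants with zero boundary values satisfy linear boundary conditions trivially,
  which is what density of the domain calls for.\<close>

lemma H1_0_dense:
  assumes ab: "a < b" and f: "f \<in> L2 a b" and e: "e > 0"
  obtains u where "u \<in> H1 a b" "point_value a b u a = 0" "point_value a b u b = 0" "L2_sqnorm a b (f - u) < e"
proof -
  obtain g where g: "sq_integrable a b g" "f = restr a b g" using f by (rule L2_cases)
  obtain \<psi> where \<psi>: "\<psi> \<in> C1_test_functions a b" "sq_dist a b g \<psi> < e"
    using test_functions_dense[OF ab g(1) e] by blast
  have z: "\<psi> C1_differentiable_on UNIV" "\<psi> a = 0" "\<psi> b = 0" using \<psi>(1) by (auto simp: C1_test_functions_def)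
  note s = test_function_sq_integrable[OF \<psi>(1)]
  have "L2_sqnorm a b (f - restr a b \<psi>) = sq_dist a b g \<psi>"
    using g s by (simp add: restr_diff L2_sqnorm_restr sq_integrable_diff sq_dist_def)
  thus ?thesis using restr_H1[OF ab primitive_on_C1[OF z(1)] s(1,2)] z \<psi> ab
    by (intro that[of "restr a b \<psi>"]) auto
qed

lemma primitive_on_affine: "primitive_on a b (\<lambda>x. of_real (p + q * x)) (\<lambda>_. of_real q)"
proof -
  have d: "((\<lambda>x. complex_of_real (p + q * x)) has_vector_derivative of_real q) (at x)" for x
    by (intro has_vector_derivative_of_real) (auto intro!: derivative_eq_intros)
  hence "(\<lambda>x. complex_of_real (p + q * x)) C1_differentiable_on UNIV"
    unfolding C1_differentiable_on_def by (intro exI[of _ "\<lambda>_. of_real q"]) auto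
  from primitive_on_C1[OF this, of a b] show ?thesis by (simp only: vector_derivative_at[OF d])
qed

text \<open>The product rule applied to weight times \<open>F\<close> times conjugate
  \<open>G\<close>; the slope of the weight yields the third term. All boundary terms of the energy
  and multiplier identities come from here.\<close>

theorem wip_by_parts:
  assumes ab: "a < b" and "u \<in> H1 a b" "v \<in> H1 a b"
  shows "wip p q a b (weak_deriv a b u) v + wip p q a b u (weak_deriv a b v) + wip q 0 a b u v
    = (p + q * b) * Re (point_value a b u b * cnj (point_value a b v b))
      - (p + q * a) * Re (point_value a b u a * cnj (point_value a b v a))"
proof -
  obtain F f where F: "primitive_on a b F f" "sq_integrable a b F" "sq_integrable a b f" "u = restr a b F"
    using ab assms(2) by (rule H1_cases)
  obtain G g where G: "primitive_on a b G g" "sq_integrable a b G" "sq_integrable a b g" "v = restr a b G"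
    using ab assms(3) by (rule H1_cases)
  let ?A = "\<lambda>x. complex_of_real (p + q * x)"
  let ?h = "\<lambda>x. of_real q * (F x * cnj (G x)) + ?A x * (f x * cnj (G x) + F x * cnj (g x))"
  have P: "primitive_on a b (\<lambda>x. ?A x * (F x * cnj (G x))) ?h"
    by (intro primitive_on_mult primitive_on_affine F G primitive_on_cnj)
  have re: "Re (?h x) = (p + q * x) * Re (f x * cnj (G x)) + (p + q * x) * Re (F x * cnj (g x))
      + (q + 0 * x) * Re (F x * cnj (G x))" for x
    by (simp add: algebra_simps)
  have "wip p q a b (weak_deriv a b u) v + wip p q a b u (weak_deriv a b v) + wip q 0 a b u v
      = (LINT x:{a<..<b}|lborel. Re (?h x))"
    unfolding re using F G ab
    by (simp only: restr_H1 wip_restr set_integral_add sq_integrable_weighted)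
  also have "\<dots> = Re (LINT x:{a<..<b}|lborel. ?h x)"
  proof -
    have "set_integrable lborel {a<..<b} ?h" using P by (simp only: primitive_on_def)
    thus ?thesis
      unfolding set_lebesgue_integral_def set_integrable_def
      by (subst integral_Re[symmetric]) (auto intro!: Bochner_Integration.integral_cong)
  qed
  also have "\<dots> = Re (?A b * (F b * cnj (G b)) - ?A a * (F a * cnj (G a)))"
    using primitive_on_integral[OF P, of b] ab by simp
  finally show ?thesis using F G ab by (simp add: restr_H1)
qed

text \<open>The increment is an integral of the derivative, estimated by Cauchy-Schwarz.\<close>

lemma H1_point_value_diff:
  assumes ab: "a < b" and "u \<in> H1 a b" and x: "x \<in> {a..b}"
  shows "(cmod (point_value a b u x - point_value a b u a))\<^sup>2 \<le> (b - a) * L2_sqnorm a b (weak_deriv a b u)"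
proof -
  obtain F f where F: "primitive_on a b F f" "sq_integrable a b F" "sq_integrable a b f" "u = restr a b F"
    using ab assms(2) by (rule H1_cases)
  define J where "J = (LINT x:{a<..<b}|lborel. cmod (f x))"
  define I where "I = (LINT x:{a<..<b}|lborel. (cmod (f x))\<^sup>2)"
  have i: "set_integrable lborel {a<..<b} f" by (rule sq_integrable_imp_integrable[OF F(3)])
  have J0: "J \<ge> 0" unfolding J_def set_lebesgue_integral_def by (intro integral_nonneg_AE) auto
  have I0: "I \<ge> 0" unfolding I_def set_lebesgue_integral_def by (intro integral_nonneg_AE) auto
  have JI: "J\<^sup>2 \<le> (b - a) * I"
  proof (cases "J = 0")
    case False
    hence J: "J > 0" using J0 by simp
    \<comment> \<open>J / (b - a) makes the first Young term equal to J / 2, which is absorbed on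
      the left.\<close>
    have "J \<le> (J / (b - a) * (b - a) + I / (J / (b - a))) / 2"
      using sq_integrable_cmod_bound[OF _ F(3), of "J / (b - a)"] J ab by (simp add: J_def I_def)
    moreover have "J / (b - a) * (b - a) = J" "I / (J / (b - a)) = (b - a) * I / J"
      using ab by simp_all
    ultimately have "J \<le> (J + (b - a) * I / J) / 2" by (simp only:)
    hence "J \<le> (b - a) * I / J" by simp
    thus ?thesis using J by (simp add: field_simps power2_eq_square)
  qed (use I0 ab in simp)
  have "cmod (F x - F a) = cmod (LINT y:{a<..<x}|lborel. f y)" using primitive_on_integral[OF F(1) x] by simp
  also have "\<dots> \<le> (LINT y:{a<..<x}|lborel. cmod (f y))"
    using x by (intro set_integral_norm_bound set_integrable_subset[OF i]) auto
  also have "\<dots> \<le> J"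
  proof -
    have "set_integrable lborel {a<..<x} (\<lambda>y. cmod (f y))"
      using x by (intro set_integrable_norm set_integrable_subset[OF i]) auto
    thus ?thesis using x set_integrable_norm[OF i]
      unfolding J_def set_lebesgue_integral_def set_integrable_def
      by (intro integral_mono) (auto split: split_indicator)
  qed
  finally have "(cmod (F x - F a))\<^sup>2 \<le> J\<^sup>2" by (intro power_mono) auto
  with JI show ?thesis using F ab x by (simp add: restr_H1 L2_sqnorm_restr I_def)
qed

lemma L2_sqnorm_le_sup:
  assumes ab: "a < b" and "u \<in> H1 a b" and M: "\<And>x. x \<in> {a..b} \<Longrightarrow> (cmod (point_value a b u x))\<^sup>2 \<le> M"
  shows "L2_sqnorm a b u \<le> (b - a) * M"
proof -
  obtain F f where F: "primitive_on a b F f" "sq_integrable a b F" "sq_integrable a b f" "u = restr a b F"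
    using ab assms(2) by (rule H1_cases)
  have "(LINT x:{a<..<b}|lborel. (cmod (F x))\<^sup>2) \<le> (LINT x:{a<..<b}|lborel. M)"
  proof (intro set_integral_mono)
    show "(cmod (F x))\<^sup>2 \<le> M" if "x \<in> {a<..<b}" for x
      using M[of x] that F ab by (simp add: restr_H1)
    show "set_integrable lborel {a<..<b} (\<lambda>_. M)"
      by (rule set_integrable_bounded) auto
  qed (use F in \<open>auto simp: sq_integrable_def\<close>)
  also have "\<dots> = (b - a) * M" using ab by (simp add: set_lebesgue_integral_def)
  finally show ?thesis using F by (simp add: L2_sqnorm_restr)
qed

section \<open>Quadratic forms and semigroups\<close>

text \<open>Relative to a subspace because \<open>weak_deriv\<close> is known to be linear on H1
  only. Symmetry supplies linearity in the second argument.\<close>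

definition sym_bilinear_on :: "'a::real_vector set \<Rightarrow> ('a \<Rightarrow> 'a \<Rightarrow> real) \<Rightarrow> bool" where
  "sym_bilinear_on X B \<longleftrightarrow>
     (\<forall>u\<in>X. \<forall>v\<in>X. B u v = B v u) \<and>
     (\<forall>u\<in>X. \<forall>v\<in>X. \<forall>w\<in>X. B (u + v) w = B u w + B v w) \<and>
     (\<forall>r. \<forall>u\<in>X. \<forall>v\<in>X. B (r *\<^sub>R u) v = r * B u v)"

locale bilinear_form =
  fixes X :: "'a::real_vector set" and B :: "'a \<Rightarrow> 'a \<Rightarrow> real"
  assumes subspace: "subspace X" and bil: "sym_bilinear_on X B"
begin

lemma mem [intro, simp]:
  "u \<in> X \<Longrightarrow> v \<in> X \<Longrightarrow> u + v \<in> X" "u \<in> X \<Longrightarrow> v \<in> X \<Longrightarrow> u - v \<in> X"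
  "u \<in> X \<Longrightarrow> r *\<^sub>R u \<in> X" "0 \<in> X"
  using subspace by (auto simp: subspace_add subspace_diff subspace_scale subspace_0)

lemma sym: "u \<in> X \<Longrightarrow> v \<in> X \<Longrightarrow> B u v = B v u"
  using bil unfolding sym_bilinear_on_def by blast

lemma add_left: "u \<in> X \<Longrightarrow> v \<in> X \<Longrightarrow> w \<in> X \<Longrightarrow> B (u + v) w = B u w + B v w"
  using bil unfolding sym_bilinear_on_def by blast

lemma scale_left: "u \<in> X \<Longrightarrow> v \<in> X \<Longrightarrow> B (r *\<^sub>R u) v = r * B u v"
  using bil unfolding sym_bilinear_on_def by blast

lemma add_right: "u \<in> X \<Longrightarrow> v \<in> X \<Longrightarrow> w \<in> X \<Longrightarrow> B w (u + v) = B w u + B w v"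
  using add_left sym by (metis mem(1))

lemma scale_right: "u \<in> X \<Longrightarrow> v \<in> X \<Longrightarrow> B u (r *\<^sub>R v) = r * B u v"
  using scale_left sym by (metis mem(3))

lemma diff_left: "u \<in> X \<Longrightarrow> v \<in> X \<Longrightarrow> w \<in> X \<Longrightarrow> B (u - v) w = B u w - B v w"
  using add_left[of u "(-1) *\<^sub>R v" w] scale_left[of v w "-1"] mem(3)[of v "-1"] by simp

lemma diff_right: "u \<in> X \<Longrightarrow> v \<in> X \<Longrightarrow> w \<in> X \<Longrightarrow> B w (u - v) = B w u - B w v"
  using diff_left sym by (metis mem(2))

lemmas expand = add_left add_right diff_left diff_right scale_left scale_right

end

locale prehilbert_form = bilinear_form X Q for X :: "'a::real_vector set" and Q +
  assumes nonneg: "u \<in> X \<Longrightarrow> 0 \<le> Q u u"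
begin

definition N :: "'a \<Rightarrow> real" where "N u = sqrt (Q u u)"

lemma N_nonneg [simp]: "u \<in> X \<Longrightarrow> 0 \<le> N u"
  by (simp add: N_def nonneg)

lemma N_sq: "u \<in> X \<Longrightarrow> (N u)\<^sup>2 = Q u u"
  by (simp add: N_def nonneg)

lemma N_scale: "u \<in> X \<Longrightarrow> N (r *\<^sub>R u) = \<bar>r\<bar> * N u"
  by (simp add: N_def expand real_sqrt_mult flip: mult.assoc power2_eq_square)

text \<open>By polarization and scaling.\<close>

lemma bounded_form:
  assumes "sym_bilinear_on X B" and bd: "\<And>u. u \<in> X \<Longrightarrow> \<bar>B u u\<bar> \<le> K * Q u u" and "0 \<le> K"
    and u: "u \<in> X" and v: "v \<in> X"
  shows "\<bar>B u v\<bar> \<le> K * N u * N v"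
proof -
  interpret B: bilinear_form X B by unfold_locales (fact subspace assms)+
  have 1: "\<bar>B x y\<bar> \<le> K / 2 * (Q x x + Q y y)" if "x \<in> X" "y \<in> X" for x y
  proof -
    have "4 * B x y = B (x + y) (x + y) - B (x - y) (x - y)"
      using that by (simp add: B.expand B.sym[OF that])
    moreover have "Q (x + y) (x + y) + Q (x - y) (x - y) = 2 * (Q x x + Q y y)"
      using that by (simp add: expand sym[OF that])
    hence "K * Q (x + y) (x + y) + K * Q (x - y) (x - y) = 2 * K * (Q x x + Q y y)"
      by (metis distrib_left mult.assoc mult.commute)
    ultimately show ?thesis using bd[of "x + y"] bd[of "x - y"] that by (auto simp: abs_le_iff)
  qed
  \<comment> \<open>The seminorms may vanish; the margin \<open>e\<close> keeps the divisors
    positive and is sent to 0 at the end.\<close>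
  have 2: "\<bar>B u v\<bar> \<le> K * (N u + e) * (N v + e)" if "e > 0" for e
  proof -
    define a b where "a = N u + e" and "b = N v + e"
    have a: "a > 0" "b > 0" using that u v by (simp_all add: a_def b_def add_nonneg_pos)
    \<comment> \<open>The scaling that makes both terms of the polarized bound equal to a b.\<close>
    define l where "l = sqrt (b / a)"
    have l: "l > 0" "l\<^sup>2 = b / a" using a by (simp_all add: l_def)
    have qu: "Q u u \<le> a\<^sup>2" "Q v v \<le> b\<^sup>2"
      using u v that by (auto simp: a_def b_def simp flip: N_sq intro!: power_mono)
    have "B u v = B (l *\<^sub>R u) ((1 / l) *\<^sub>R v)" using u v l by (simp add: B.expand)
    also have "\<bar>\<dots>\<bar> \<le> K / 2 * (l\<^sup>2 * Q u u + Q v v / l\<^sup>2)"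
      using 1[of "l *\<^sub>R u" "(1 / l) *\<^sub>R v"] u v by (simp add: expand power2_eq_square mult.assoc)
    also have "\<dots> \<le> K / 2 * (l\<^sup>2 * a\<^sup>2 + b\<^sup>2 / l\<^sup>2)"
      using qu \<open>0 \<le> K\<close> by (intro mult_left_mono add_mono divide_right_mono) auto
    also have "\<dots> = K * a * b" unfolding l(2) using a by (simp add: field_simps power2_eq_square)
    finally show ?thesis by (simp add: a_def b_def)
  qed
  have "((\<lambda>e. K * (N u + e) * (N v + e)) \<longlongrightarrow> K * (N u + 0) * (N v + 0)) (at_right 0)"
    by (intro tendsto_intros)
  hence "\<bar>B u v\<bar> \<le> K * (N u + 0) * (N v + 0)"
    by (rule tendsto_lowerbound) (auto simp: eventually_at_right_field intro: 2 exI[of _ 1])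
  thus ?thesis by simp
qed

lemma Cauchy_Schwarz: "u \<in> X \<Longrightarrow> v \<in> X \<Longrightarrow> \<bar>Q u v\<bar> \<le> N u * N v"
  using bounded_form[of Q 1 u v] bil nonneg by simp

lemma N_triangle:
  assumes "u \<in> X" "v \<in> X"
  shows "N (u + v) \<le> N u + N v"
proof (rule power2_le_imp_le)
  show "(N (u + v))\<^sup>2 \<le> (N u + N v)\<^sup>2"
    using Cauchy_Schwarz[OF assms] assms
    by (simp add: N_sq power2_sum expand sym[OF assms])
qed (use assms in auto)

lemma N_minus: "u \<in> X \<Longrightarrow> v \<in> X \<Longrightarrow> N (u - v) = N (v - u)"
  using N_scale[of "v - u" "-1"] by simp

lemma N_diff_le: "u \<in> X \<Longrightarrow> v \<in> X \<Longrightarrow> N (u - v) \<le> N u + N v"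
  using N_triangle[of u "(-1) *\<^sub>R v"] N_scale[of v "-1"] mem(3)[of v "-1"] by simp

lemma N_triangle':
  assumes "u \<in> X" "v \<in> X"
  shows "N u \<le> N v + N (u - v)"
  using N_triangle[of v "u - v"] assms by simp

lemma N_triangle3:
  assumes "u \<in> X" "v \<in> X" "w \<in> X"
  shows "N (u - w) \<le> N (u - v) + N (v - w)"
  using N_triangle[of "u - v" "v - w"] assms by simp

end

text \<open>
  Completeness is only required for rapidly converging sequences, and the form may be degenerate.
\<close>

locale hilbert_form = prehilbert_form X Q for X :: "'a::real_vector set" and Q +
  assumes complete: "\<lbrakk>\<And>n. x n \<in> X; \<And>n. sqrt (Q (x (Suc n) - x n) (x (Suc n) - x n)) \<le> (1/3) ^ n\<rbrakk>
    \<Longrightarrow> \<exists>l\<in>X. (\<lambda>n. sqrt (Q (x n - l) (x n - l))) \<longlonglongrightarrow> 0"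
begin

text \<open>The gliding hump argument of Sokal.\<close>

lemma uniform_boundedness:
  fixes T :: "nat \<Rightarrow> 'a \<Rightarrow> 'a"
  assumes TX: "\<And>n u. u \<in> X \<Longrightarrow> T n u \<in> X"
    and T_add: "\<And>n u v. u \<in> X \<Longrightarrow> v \<in> X \<Longrightarrow> T n (u + v) = T n u + T n v"
    and T_scale: "\<And>n r u. u \<in> X \<Longrightarrow> T n (r *\<^sub>R u) = r *\<^sub>R T n u"
    and T_bd: "\<And>n. \<exists>C. \<forall>u\<in>X. N (T n u) \<le> C * N u"
    and ptw: "\<And>u. u \<in> X \<Longrightarrow> \<exists>C. \<forall>n. N (T n u) \<le> C"
  shows "\<exists>C. \<forall>n. \<forall>u\<in>X. N (T n u) \<le> C * N u"
proof (rule ccontr)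
  assume "\<not> ?thesis"
  hence un: "\<exists>n. \<exists>u\<in>X. N (T n u) > C * N u" for C by (meson not_le)
  \<comment> \<open>\<open>C\<close> is the operator seminorm of \<open>T m\<close>, taken as the
    infimum of all bounds. It is at least 4^n, and \<open>h\<close>, of size 3^(-n), attains it up
    to the factor 2/3.\<close>
  have big: "\<exists>m C h. h \<in> X \<and> N h = (1/3)^n \<and> C \<ge> 4^n \<and> N (T m h) \<ge> 2/3 * C * (1/3)^n
      \<and> (\<forall>u\<in>X. N (T m u) \<le> C * N u)" for n :: nat
  proof -
    obtain m u where u: "u \<in> X" "N (T m u) > 4^n * N u" using un by blast
    define Cs where "Cs = {C. \<forall>u\<in>X. N (T m u) \<le> C * N u}"
    have ne: "Cs \<noteq> {}" using T_bd[of m] by (auto simp: Cs_def)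
    have low: "4^n \<le> C" if "C \<in> Cs" for C
    proof (rule ccontr)
      assume "\<not> ?thesis"
      hence "C * N u \<le> 4^n * N u" using u by (intro mult_right_mono) auto
      thus False using that u by (force simp: Cs_def)
    qed
    hence bdd: "bdd_below Cs" by (auto simp: bdd_below_def)
    define C where "C = Inf Cs"
    have C4: "C \<ge> 4^n" unfolding C_def using low ne by (intro cInf_greatest)
    have C0: "C > 0" using C4 zero_less_power[of "4::real" n] by linarith
    have inC: "N (T m w) \<le> C * N w" if "w \<in> X" for w
    proof (cases "N w = 0")
      case True
      thus ?thesis using ne that by (auto simp: Cs_def)
    next
      case False
      hence Nw: "N w > 0" using N_nonneg[OF that] by linarith
      have "N (T m w) / N w \<le> C" unfolding C_def
        using ne that Nw by (intro cInf_greatest) (auto simp: Cs_def divide_le_eq)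
      thus ?thesis using Nw by (simp add: divide_le_eq)
    qed
    \<comment> \<open>Smaller than the infimum, hence not a bound: some \<open>w\<close> violates
      it, and rescaling \<open>w\<close> gives the hump.\<close>
    have "2/3 * C \<notin> Cs" using cInf_lower[OF _ bdd, of "2/3 * C"] C0 by (auto simp flip: C_def)
    then obtain w where w: "w \<in> X" "N (T m w) > 2/3 * C * N w" by (auto simp: Cs_def not_le)
    have Nw: "N w > 0"
      using w inC[OF w(1)] C0 N_nonneg[OF w(1)] by (cases "N w = 0") (auto simp: less_le)
    define h where "h = ((1/3)^n / N w) *\<^sub>R w"
    have "h \<in> X" "N h = (1/3)^n" using w Nw by (simp_all add: h_def N_scale)
    moreover have "N (T m h) = (1/3)^n / N w * N (T m w)"
      using w Nw TX by (simp add: h_def T_scale N_scale)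
    hence "N (T m h) \<ge> (1/3)^n / N w * (2/3 * C * N w)"
      using w Nw by (simp only:) (intro mult_left_mono, auto)
    hence "N (T m h) \<ge> 2/3 * C * (1/3)^n" using Nw by (simp add: field_simps)
    ultimately show ?thesis using inC C4 by blast
  qed
  then obtain m C h where h: "\<And>n. h n \<in> X" "\<And>n. N (h n) = (1/3)^n"
      "\<And>n. N (T (m n) (h n)) \<ge> 2/3 * C n * (1/3)^n"
    and C: "\<And>n. C n \<ge> 4^n" "\<And>n u. u \<in> X \<Longrightarrow> N (T (m n) u) \<le> C n * N u"
    by metis
  let ?P = "\<lambda>n x y. y \<in> X \<and> N (y - x) \<le> (1/3)^n \<and> N (T (m n) y) \<ge> 2/3 * C n * (1/3)^n"
  \<comment> \<open>The images of x + h and x - h differ by 2 T h, so at least one of them is as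
    large as T h.\<close>
  have step: "\<exists>y. ?P n x y" if x: "x \<in> X" for x n
  proof -
    have "T (m n) (x + h n) - T (m n) (x + (-1) *\<^sub>R h n) = 2 *\<^sub>R T (m n) (h n)"
      using x h TX by (simp only: T_add T_scale mem) (simp add: scaleR_2)
    hence "2 * N (T (m n) (h n)) = N (T (m n) (x + h n) - T (m n) (x + (-1) *\<^sub>R h n))"
      using h TX by (simp add: N_scale)
    also have "\<dots> \<le> N (T (m n) (x + h n)) + N (T (m n) (x + (-1) *\<^sub>R h n))"
      using x h TX by (intro N_diff_le) auto
    finally consider "N (T (m n) (x + h n)) \<ge> 2/3 * C n * (1/3)^n" | "N (T (m n) (x + (-1) *\<^sub>R h n)) \<ge> 2/3 * C n * (1/3)^n"
      using h(3)[of n] by linarith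
    thus ?thesis
    proof cases
      case 1 thus ?thesis using h x by (intro exI[of _ "x + h n"]) auto
    next
      case 2 thus ?thesis using h x N_scale[of "h n" "-1"]
        by (intro exI[of _ "x + (-1) *\<^sub>R h n"]) auto
    qed
  qed
  define x where "x = rec_nat 0 (\<lambda>n x. SOME y. ?P n x y)"
  have xS: "x (Suc n) = (SOME y. ?P n (x n) y)" for n
    by (simp add: x_def)
  have xX: "x n \<in> X" for n
  proof (induction n)
    case 0 show ?case by (simp add: x_def)
  next
    case (Suc n)
    show ?case unfolding xS using someI_ex[OF step[OF Suc]] by blast
  qed
  have xd: "N (x (Suc n) - x n) \<le> (1/3)^n" "N (T (m n) (x (Suc n))) \<ge> 2/3 * C n * (1/3)^n" for n
    unfolding xS using someI_ex[OF step[OF xX]] by blast+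
  obtain l where l: "l \<in> X" "(\<lambda>n. N (x n - l)) \<longlonglongrightarrow> 0"
    using complete[of x] xX xd(1) unfolding N_def by blast
  \<comment> \<open>3/2 is the sum of the geometric series with ratio 1/3.\<close>
  have near: "N (x n - l) \<le> 3/2 * (1/3)^n" for n
  proof -
    have tel: "N (x (n + k) - x n) \<le> 3/2 * ((1/3)^n - (1/3)^(n+k))" for k
    proof (induction k)
      case 0 show ?case using N_scale[of 0 0] by simp
    next
      case (Suc k)
      have "N (x (n + Suc k) - x n) \<le> N (x (Suc (n + k)) - x (n + k)) + N (x (n + k) - x n)"
        using N_triangle3 xX by simp
      also have "\<dots> \<le> (1/3)^(n+k) + 3/2 * ((1/3)^n - (1/3)^(n+k))"
        by (rule add_mono[OF xd(1)[of "n + k"] Suc])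
      finally show ?case by (simp add: field_simps)
    qed
    have "N (x n - l) \<le> 3/2 * (1/3)^n + N (x (k + n) - l)" for k
      using N_triangle3[OF xX xX l(1), of n "k + n"] tel[of k] N_minus[OF xX xX, of n "k + n"]
        zero_le_power[of "1/3::real" "n+k"] by (simp add: add.commute del: zero_le_power)
    moreover have "(\<lambda>k. 3/2 * (1/3)^n + N (x (k + n) - l)) \<longlonglongrightarrow> 3/2 * (1/3)^n + 0"
      using LIMSEQ_ignore_initial_segment[OF l(2), of n] by (intro tendsto_intros)
    ultimately show ?thesis by (intro tendsto_lowerbound[where f = "\<lambda>k. 3/2 * (1/3)^n + N (x (k + n) - l)" and F = sequentially]) auto
  qed
  obtain K where K: "\<And>n. N (T n l) \<le> K" using ptw[OF l(1)] by blast
  \<comment> \<open>The hump contributes 2/3, the remaining tail at most 3/2 * 1/3 = 1/2. The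
    difference 1/6 of C n (1/3)^n has to be bounded by \<open>K\<close>, although C n is at least
    4^n.\<close>
  have "(4/3)^n \<le> 6 * K" for n
  proof -
    have "2/3 * C n * (1/3)^n \<le> N (T (m n) (x (Suc n)))" by (rule xd(2))
    also have "\<dots> = N (T (m n) (x (Suc n) - l) + T (m n) l)"
      using T_add[of "x (Suc n) - l" l "m n"] xX l by simp
    also have "\<dots> \<le> N (T (m n) (x (Suc n) - l)) + N (T (m n) l)"
      using N_triangle TX xX l by simp
    also have "\<dots> \<le> C n * N (x (Suc n) - l) + K"
      using C(2)[of "x (Suc n) - l"] K xX l by (simp add: add_mono)
    also have "\<dots> \<le> C n * (3/2 * (1/3)^(Suc n)) + K"
      using near[of "Suc n"] by (intro add_mono mult_left_mono order_trans[OF _ C(1)]) auto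
    finally have "C n * (1/3)^n \<le> 6 * K" by simp
    moreover have "4^n * (1/3)^n \<le> C n * (1/3)^n" using C(1) by (intro mult_right_mono) auto
    ultimately show ?thesis by (simp add: power_divide)
  qed
  moreover obtain n where "6 * K < (4/3)^n" using real_arch_pow[of "4/3" "6*K"] by auto
  ultimately show False by (meson not_le)
qed

end

section \<open>Trajectories of a C0-semigroup\<close>

locale hilbert_semigroup = hilbert_form X Q for X :: "'a::complex_vector set" and Q +
  fixes S :: "real \<Rightarrow> 'a \<Rightarrow> 'a" and D :: "'a set" and A :: "'a \<Rightarrow> 'a"
  assumes gen: "generates_C0_semigroup X N D A S"
begin

lemma semigroup: "C0_semigroup X N S"
  using gen by (simp add: generates_C0_semigroup_def)

lemma S_mem [simp, intro]: "0 \<le> t \<Longrightarrow> u \<in> X \<Longrightarrow> S t u \<in> X"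
  and S_add: "0 \<le> t \<Longrightarrow> u \<in> X \<Longrightarrow> v \<in> X \<Longrightarrow> S t (u + v) = S t u + S t v"
  and S_bounded: "0 \<le> t \<Longrightarrow> \<exists>C. \<forall>u\<in>X. N (S t u) \<le> C * N u"
  and S_0 [simp]: "u \<in> X \<Longrightarrow> S 0 u = u"
  and S_plus: "0 \<le> s \<Longrightarrow> 0 \<le> t \<Longrightarrow> u \<in> X \<Longrightarrow> S (s + t) u = S s (S t u)"
  and S_cont0: "u \<in> X \<Longrightarrow> ((\<lambda>t. N (S t u - u)) \<longlongrightarrow> 0) (at_right 0)"
  using semigroup by (auto simp: C0_semigroup_def)

lemma S_scale: "0 \<le> t \<Longrightarrow> u \<in> X \<Longrightarrow> S t (r *\<^sub>R u) = r *\<^sub>R S t u"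
  using semigroup by (auto simp: C0_semigroup_def scaleR_scaleC)

lemma S_diff: "0 \<le> t \<Longrightarrow> u \<in> X \<Longrightarrow> v \<in> X \<Longrightarrow> S t (u - v) = S t u - S t v"
  using S_add[of t u "(-1) *\<^sub>R v"] S_scale[of t v "-1"] mem(3)[of v "-1"] by simp

text \<open>The generator is the graph of \<open>A\<close> over \<open>D\<close>, so one limit of
  difference quotients decides both membership in \<open>D\<close> and the value of
  \<open>A\<close>.\<close>

lemma generator_iff:
  "u \<in> D \<and> A u = v \<longleftrightarrow> u \<in> X \<and> v \<in> X \<and> ((\<lambda>h. N ((1 / h) *\<^sub>R (S h u - u) - v)) \<longlongrightarrow> 0) (at_right 0)"
proof -
  have "generator X N S = {(u, A u) | u. u \<in> D}"
    using gen by (simp add: generates_C0_semigroup_def)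
  hence "(u, v) \<in> generator X N S \<longleftrightarrow> u \<in> D \<and> A u = v" by auto
  thus ?thesis by (auto simp: generator_def)
qed

lemma D_mem [simp, intro]: "u \<in> D \<Longrightarrow> u \<in> X" "u \<in> D \<Longrightarrow> A u \<in> X"
  using generator_iff by blast+

text \<open>Failure gives times t n tending to 0 along which the operators S (t n) are unbounded in
  norm. They converge pointwise to the identity, which contradicts uniform boundedness.\<close>

lemma bounded_near_0: "\<exists>\<delta>>0. \<exists>C. \<forall>t\<in>{0..\<delta>}. \<forall>u\<in>X. N (S t u) \<le> C * N u"
proof (rule ccontr)
  assume neg: "\<not> ?thesis"
  have "\<exists>t\<in>{0..1 / real (Suc n)}. \<exists>u\<in>X. N (S t u) > real (Suc n) * N u" for n
    using neg by (meson not_le of_nat_0_less_iff zero_less_Suc zero_less_divide_1_iff)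
  then obtain t u where t: "\<And>n. t n \<in> {0..1 / real (Suc n)}" and u: "\<And>n. u n \<in> X"
      and big: "\<And>n. N (S (t n) (u n)) > real (Suc n) * N (u n)" by metis
  have t0: "t n \<ge> 0" for n using t[of n] by simp
  \<comment> \<open>Continuity at 0 is a limit from the right that excludes 0 itself; at time 0 the
    operator is the identity and cannot violate the bound.\<close>
  have tpos: "t n > 0" for n
  proof (rule ccontr)
    assume "\<not> ?thesis"
    hence "t n = 0" using t0[of n] by simp
    hence "N (u n) > real (Suc n) * N (u n)" using big[of n] u by simp
    moreover have "1 * N (u n) \<le> real (Suc n) * N (u n)" using u by (intro mult_right_mono) auto
    ultimately show False by simp
  qed
  have lim: "t \<longlonglongrightarrow> 0"
    by (rule tendsto_sandwich[where f = "\<lambda>_. 0" and h = "\<lambda>n. 1 / real (Suc n)"])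
      (use t LIMSEQ_inverse_real_of_nat in \<open>auto simp: inverse_eq_divide\<close>)
  have limr: "filterlim t (at_right 0) sequentially"
    unfolding at_within_def filterlim_inf filterlim_principal
    using lim tpos by (auto simp: less_le)
  have "\<exists>C. \<forall>n. \<forall>v\<in>X. N (S (t n) v) \<le> C * N v"
  proof (rule uniform_boundedness)
    fix v assume v: "v \<in> X"
    have "(\<lambda>n. N (S (t n) v - v)) \<longlonglongrightarrow> 0"
      using S_cont0[OF v] limr by (rule filterlim_compose)
    hence "Bseq (\<lambda>n. N (S (t n) v - v))" by (intro convergent_imp_Bseq) (auto simp: convergent_def)
    then obtain C where C: "\<And>n. norm (N (S (t n) v - v)) \<le> C" by (auto simp: Bseq_def)
    have "N (S (t n) v) \<le> N v + C" for n
      using C[of n] N_triangle'[of "S (t n) v" v] v t0 by (auto simp: abs_le_iff)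
    thus "\<exists>C. \<forall>n. N (S (t n) v) \<le> C" by blast
  qed (use t0 S_add S_scale S_bounded in auto)
  then obtain C where C: "\<And>n v. v \<in> X \<Longrightarrow> N (S (t n) v) \<le> C * N v" by blast
  obtain n where n: "C < real n" using reals_Archimedean2 by blast
  have "C * N (u n) \<le> real (Suc n) * N (u n)" using n u by (intro mult_right_mono) auto
  with C[OF u, of n n] big[of n] show False by linarith
qed

text \<open>The semigroup law carries the bound near 0 to [0, n \<delta>] at the cost of the power
  C^n.\<close>

lemma locally_bounded: "\<exists>C\<ge>0. \<forall>t\<in>{0..T}. \<forall>u\<in>X. N (S t u) \<le> C * N u"
proof -
  obtain \<delta> C0 where \<delta>: "\<delta> > 0" and C0: "\<And>t u. t \<in> {0..\<delta>} \<Longrightarrow> u \<in> X \<Longrightarrow> N (S t u) \<le> C0 * N u"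
    using bounded_near_0 by blast
  define C where "C = max C0 1"
  have C: "C \<ge> 1" "N (S t u) \<le> C * N u" if "t \<in> {0..\<delta>}" "u \<in> X" for t u
    using C0[OF that] mult_right_mono[of C0 C "N u"] that by (auto simp: C_def)
  have *: "\<forall>t\<in>{0..real n * \<delta>}. \<forall>u\<in>X. N (S t u) \<le> C ^ n * N u" for n
  proof (induction n)
    case 0 thus ?case by simp
  next
    case (Suc n)
    show ?case
    proof (intro ballI)
      fix t u assume t: "t \<in> {0..real (Suc n) * \<delta>}" and u: "u \<in> X"
      \<comment> \<open>Truncation at 0 keeps both \<open>s\<close> and t - s in range when t <
        \<delta>.\<close>
      define s where "s = max 0 (t - \<delta>)"
      have s: "s \<in> {0..real n * \<delta>}" "t - s \<in> {0..\<delta>}" using t \<delta> by (auto simp: s_def algebra_simps)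
      have "S t u = S (t - s) (S s u)" using S_plus[of "t - s" s u] s u by auto
      also have "N \<dots> \<le> C * N (S s u)" using C(2) s u by auto
      also have "\<dots> \<le> C * (C ^ n * N u)" using Suc s u C(1)[OF s(2) u] by (intro mult_left_mono) auto
      finally show "N (S t u) \<le> C ^ Suc n * N u" by simp
    qed
  qed
  obtain n where n: "T / \<delta> < real n" using reals_Archimedean2 by blast
  hence "T \<le> real n * \<delta>" using \<delta> by (simp add: field_simps)
  with *[of n] show ?thesis by (intro exI[of _ "C ^ n"]) (auto simp: C_def)
qed

text \<open>The bounded operator S t commutes with the difference quotients, so it maps their limit
  at \<open>u\<close> to their limit at S t u.\<close>

lemma D_invariant:
  assumes "0 \<le> t" "u \<in> D"
  shows "S t u \<in> D" "A (S t u) = S t (A u)"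
proof -
  have u: "u \<in> X" "A u \<in> X" using assms by auto
  obtain C where C: "\<And>v. v \<in> X \<Longrightarrow> N (S t v) \<le> C * N v" using S_bounded assms by blast
  have lim: "((\<lambda>h. C * N ((1 / h) *\<^sub>R (S h u - u) - A u)) \<longlongrightarrow> C * 0) (at_right 0)"
    using generator_iff[of u "A u"] assms by (intro tendsto_intros) auto
  have "((\<lambda>h. N ((1 / h) *\<^sub>R (S h (S t u) - S t u) - S t (A u))) \<longlongrightarrow> 0) (at_right 0)"
  proof (rule tendsto_sandwich[OF _ _ tendsto_const])
    show "((\<lambda>h. C * N ((1 / h) *\<^sub>R (S h u - u) - A u)) \<longlongrightarrow> 0) (at_right 0)" using lim by simp
    have "N ((1 / h) *\<^sub>R (S h (S t u) - S t u) - S t (A u)) \<le> C * N ((1 / h) *\<^sub>R (S h u - u) - A u)"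
      if "h > 0" for h
    proof -
      have "S h (S t u) = S t (S h u)"
        using S_plus[of h t u] S_plus[of t h u] that assms u by (simp add: add.commute)
      hence "(1 / h) *\<^sub>R (S h (S t u) - S t u) - S t (A u) = S t ((1 / h) *\<^sub>R (S h u - u) - A u)"
        using that assms u by (simp add: S_diff S_scale)
      thus ?thesis using C[of "(1 / h) *\<^sub>R (S h u - u) - A u"] u that by simp
    qed
    thus "\<forall>\<^sub>F h in at_right 0. N ((1 / h) *\<^sub>R (S h (S t u) - S t u) - S t (A u))
        \<le> C * N ((1 / h) *\<^sub>R (S h u - u) - A u)"
      by (auto simp: eventually_at_right_field intro: exI[of _ 1])
    show "\<forall>\<^sub>F h in at_right 0. 0 \<le> N ((1 / h) *\<^sub>R (S h (S t u) - S t u) - S t (A u))"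
      using assms u by (auto simp: eventually_at_right_field intro!: exI[of _ 1])
  qed
  hence "S t u \<in> D \<and> A (S t u) = S t (A u)"
    using generator_iff[of "S t u" "S t (A u)"] u assms by simp
  thus "S t u \<in> D" "A (S t u) = S t (A u)" by auto
qed

text \<open>Only a right derivative at time 0 is given. A quotient between \<open>s\<close> and
  \<open>t\<close> is the quotient at 0 moved by S of the earlier time, and the bound of
  \<open>S\<close> on [0, t + 1] makes the left limit work like the right one.\<close>

lemma form_deriv:
  assumes B: "sym_bilinear_on X B" and bd: "\<And>u. u \<in> X \<Longrightarrow> \<bar>B u u\<bar> \<le> K * Q u u" and "0 \<le> K"
    and t: "0 \<le> t" and u: "u \<in> D"
  shows "((\<lambda>s. B (S s u) (S s u)) has_real_derivative 2 * B (S t u) (A (S t u))) (at t within {0..})"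
proof -
  interpret B: bilinear_form X B by unfold_locales (fact subspace B)+
  have uX [simp]: "u \<in> X" "A u \<in> X" using u by auto
  obtain C where "0 \<le> C" and C: "\<And>s v. 0 \<le> s \<Longrightarrow> s \<le> t + 1 \<Longrightarrow> v \<in> X \<Longrightarrow> N (S s v) \<le> C * N v"
    using locally_bounded[of "t + 1"] by auto
  define w where "w = S t (A u)"
  have w [simp]: "w \<in> X" "A (S t u) = w" using D_invariant[OF t u] t by (auto simp: w_def)
  \<comment> \<open>The total error, expressed through |s - t| only, so that a right limit at 0
    controls both sides of \<open>t\<close>.\<close>
  define r where "r h = 2 * K * C * N u * (C * N ((1 / h) *\<^sub>R (S h u - u) - A u) + C * N (S h (A u) - A u))
     + K * N w * (C * N (S h u - u))" for h
  have "(r \<longlongrightarrow> 2 * K * C * N u * (C * 0 + C * 0) + K * N w * (C * 0)) (at_right 0)"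
    unfolding r_def using generator_iff[of u "A u"] u S_cont0 by (intro tendsto_intros) auto
  moreover have "filterlim (\<lambda>s. \<bar>s - t\<bar>) (at_right 0) (at t within {0..})"
    unfolding at_within_def[of 0] filterlim_inf filterlim_principal
    by (auto simp: eventually_at_filter intro!: tendsto_eq_intros)
  ultimately have lim: "((\<lambda>s. r \<bar>s - t\<bar>) \<longlongrightarrow> 0) (at t within {0..})"
    using filterlim_compose[of r "nhds 0"] by simp
  have main: "\<bar>(B (S s u) (S s u) - B (S t u) (S t u)) / (s - t) - 2 * B (S t u) w\<bar> \<le> r \<bar>s - t\<bar>"
    if s: "0 \<le> s" "s \<le> t + 1" "s \<noteq> t" for s
  proof -
    \<comment> \<open>The earlier of both times and the distance between them.\<close>
    define a h where "a = min s t" and "h = \<bar>s - t\<bar>"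
    have ah: "0 \<le> a" "a \<le> t + 1" "h > 0" using s t by (auto simp: a_def h_def)
    have Cv: "N (S a v) \<le> C * N v" if "v \<in> X" for v using C ah that by auto
    define q where "q = (1 / (s - t)) *\<^sub>R (S s u - S t u)"
    have [simp]: "S s u \<in> X" "S t u \<in> X" "q \<in> X" "S h u \<in> X" "S a u \<in> X" "S h (A u) \<in> X"
      using s t ah by (auto simp: q_def)
    have qS: "q = S a ((1 / h) *\<^sub>R (S h u - u))"
    proof (cases "t < s")
      case True
      hence "a = t" "h = s - t" by (auto simp: a_def h_def)
      thus ?thesis using True t S_plus[of t h u] by (simp add: q_def S_diff S_scale)
    next
      case False
      hence "a = s" "h = t - s" by (auto simp: a_def h_def)
      moreover have "q = (1 / (t - s)) *\<^sub>R (S t u - S s u)"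
        unfolding q_def by (metis (no_types, opaque_lifting) minus_diff_eq minus_divide_right
            scaleR_minus_left scaleR_minus_right add.inverse_inverse)
      ultimately show ?thesis using False s S_plus[of s h u] ah by (simp add: S_diff S_scale)
    qed
    have diff: "N (S s u - S t u) \<le> C * N (S h u - u)"
    proof -
      have "N (S s u - S t u) = h * N q" using s by (simp add: q_def N_scale h_def)
      also have "\<dots> = N (h *\<^sub>R q)" using ah by (simp add: N_scale)
      also have "h *\<^sub>R q = S a (S h u - u)" using ah by (simp add: qS flip: S_scale)
      finally show ?thesis using Cv[of "S h u - u"] by simp
    qed
    have tw: "N (S a (A u) - w) \<le> C * N (S h (A u) - A u)"
    proof (cases "t < s")
      case True
      hence "a = t" by (simp add: a_def)
      thus ?thesis using \<open>0 \<le> C\<close> N_scale[of 0 0] by (simp add: w_def)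
    next
      case False
      hence "a = s" "t = s + h" by (auto simp: a_def h_def)
      hence "w - S a (A u) = S a (S h (A u) - A u)" using ah s by (simp add: w_def S_plus S_diff)
      thus ?thesis using Cv[of "S h (A u) - A u"] ah N_minus[of "S a (A u)" w] by simp
    qed
    have qw: "N (q - w) \<le> C * N ((1 / h) *\<^sub>R (S h u - u) - A u) + C * N (S h (A u) - A u)"
    proof -
      have "N (q - w) \<le> N (q - S a (A u)) + N (S a (A u) - w)" using ah by (intro N_triangle3) auto
      also have "q - S a (A u) = S a ((1 / h) *\<^sub>R (S h u - u) - A u)" using ah by (simp add: qS S_diff)
      also have "N \<dots> \<le> C * N ((1 / h) *\<^sub>R (S h u - u) - A u)" using Cv by simp
      finally show ?thesis using tw by linarith
    qed
    \<comment> \<open>By symmetry B x x - B y y = B (x - y) (x + y).\<close>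
    have "(B (S s u) (S s u) - B (S t u) (S t u)) / (s - t) = B q (S s u + S t u)"
      using s by (simp add: q_def B.expand B.sym[of "S t u" "S s u"] flip: add_divide_distrib)
    hence "(B (S s u) (S s u) - B (S t u) (S t u)) / (s - t) - 2 * B (S t u) w
       = B (q - w) (S s u + S t u) + B w (S s u - S t u)"
      by (simp add: B.expand B.sym[of w "S t u"])
    also have "\<bar>\<dots>\<bar> \<le> \<bar>B (q - w) (S s u + S t u)\<bar> + \<bar>B w (S s u - S t u)\<bar>" by simp
    also have "\<dots> \<le> K * N (q - w) * N (S s u + S t u) + K * N w * N (S s u - S t u)"
      by (intro add_mono bounded_form[OF B bd \<open>0 \<le> K\<close>]) auto
    also have "N (S s u + S t u) \<le> 2 * C * N u"
      using N_triangle[of "S s u" "S t u"] C[of s u] C[of t u] s t by simp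
    hence "K * N (q - w) * N (S s u + S t u) \<le> K * N (q - w) * (2 * C * N u)"
      using \<open>0 \<le> K\<close> by (intro mult_left_mono) auto
    also have "K * N (q - w) * (2 * C * N u) = 2 * K * C * N u * N (q - w)" by simp
    also have "\<dots> \<le> 2 * K * C * N u * (C * N ((1 / h) *\<^sub>R (S h u - u) - A u) + C * N (S h (A u) - A u))"
      using \<open>0 \<le> K\<close> \<open>0 \<le> C\<close> qw by (intro mult_left_mono) auto
    also have "K * N w * N (S s u - S t u) \<le> K * N w * (C * N (S h u - u))"
      using \<open>0 \<le> K\<close> diff by (intro mult_left_mono) auto
    finally show ?thesis by (simp add: r_def h_def)
  qed
  have "((\<lambda>s. (B (S s u) (S s u) - B (S t u) (S t u)) / (s - t) - 2 * B (S t u) w) \<longlongrightarrow> 0) (at t within {0..})"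
  proof (rule Lim_null_comparison[OF _ lim])
    have "\<forall>\<^sub>F s in at t within {0..}. s < t + 1"
      using order_tendstoD(2)[OF tendsto_ident_at, of t "t + 1" "{0..}"] by simp
    thus "\<forall>\<^sub>F s in at t within {0..}. norm ((B (S s u) (S s u) - B (S t u) (S t u)) / (s - t)
        - 2 * B (S t u) w) \<le> r \<bar>s - t\<bar>"
      by (auto simp: eventually_at_filter elim!: eventually_mono intro!: main)
  qed
  thus ?thesis by (simp add: has_field_derivative_iff LIM_zero_iff)
qed

text \<open>On \<open>D\<close> this is Gronwall's argument for \<open>B\<close>, carried over to
  \<open>Q\<close> by the two-sided comparison. A single constant for all of \<open>D\<close> then
  extends to \<open>X\<close>, since each S t is bounded and \<open>D\<close> is dense.\<close>

theorem exponential_decay: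
  assumes B: "sym_bilinear_on X B" and lo: "\<And>u. u \<in> X \<Longrightarrow> k * Q u u \<le> B u u"
    and up: "\<And>u. u \<in> X \<Longrightarrow> B u u \<le> K * Q u u" and k: "0 < k" and c: "0 < c"
    and lyap: "\<And>u. u \<in> D \<Longrightarrow> 2 * B u (A u) \<le> - c * B u u"
    and dense: "\<And>u e. u \<in> X \<Longrightarrow> e > 0 \<Longrightarrow> \<exists>d\<in>D. N (u - d) < e"
  shows "\<exists>M \<epsilon>. M > 0 \<and> \<epsilon> > 0 \<and> (\<forall>t>0. \<forall>u\<in>X. N (S t u) \<le> M * exp (- \<epsilon> * t) * N u)"
proof -
  have K0: "\<bar>B u u\<bar> \<le> max K k * Q u u" if "u \<in> X" for u
  proof -
    have "0 \<le> k * Q u u" using nonneg[OF that] k by simp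
    moreover have "K * Q u u \<le> max K k * Q u u" using nonneg[OF that] by (intro mult_right_mono) auto
    ultimately show ?thesis using lo[OF that] up[OF that] by simp
  qed
  define K' where "K' = max K k"
  have K': "K' > 0" using k by (auto simp: K'_def)
  have onD: "N (S t u) \<le> sqrt (K' / k) * exp (- (c / 2) * t) * N u" if u: "u \<in> D" and t: "t > 0" for u t
  proof -
    \<comment> \<open>The integrating factor exp (c s) makes the Lyapunov functional
      nonincreasing.\<close>
    define g where "g s = exp (c * s) * B (S s u) (S s u)" for s
    have "g t \<le> g 0"
    proof (rule DERIV_nonpos_imp_decreasing_open[where f = g])
      fix s assume s: "0 < s" "s < t"
      have at: "at s within {0..} = at s" using s by (intro at_within_interior) auto
      have "(g has_real_derivative c * exp (c * s) * B (S s u) (S s u)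
          + exp (c * s) * (2 * B (S s u) (A (S s u)))) (at s)"
        unfolding g_def using form_deriv[OF B K0 _ _ u, of s] s k at
        by (auto intro!: derivative_eq_intros)
      moreover have "exp (c * s) * (c * B (S s u) (S s u) + 2 * B (S s u) (A (S s u))) \<le> 0"
        using lyap[OF D_invariant(1)[OF _ u, of s]] s by (intro mult_nonneg_nonpos) auto
      ultimately show "\<exists>y. (g has_real_derivative y) (at s) \<and> y \<le> 0"
        by (intro exI conjI) (auto simp: algebra_simps)
    next
      have "continuous_on {0..} (\<lambda>s. B (S s u) (S s u))"
        using k by (intro DERIV_continuous_on[where D = "\<lambda>s. 2 * B (S s u) (A (S s u))"]
            form_deriv[OF B K0 _ _ u]) auto
      thus "continuous_on {0..t} g"
        unfolding g_def by (intro continuous_intros) (auto intro: continuous_on_subset)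
    qed (use t in auto)
    hence "exp (c * t) * B (S t u) (S t u) \<le> B u u" using u by (simp add: g_def)
    also have "\<dots> \<le> K' * Q u u" using K0[of u] u by (simp add: K'_def)
    finally have "exp (c * t) * B (S t u) (S t u) \<le> K' * Q u u" .
    moreover have "exp (c * t) * (k * Q (S t u) (S t u)) \<le> exp (c * t) * B (S t u) (S t u)"
      using lo[of "S t u"] u t by simp
    ultimately have "exp (c * t) * (k * Q (S t u) (S t u)) \<le> K' * Q u u" by linarith
    hence "Q (S t u) (S t u) \<le> K' / k * exp (- c * t) * Q u u"
      using k by (simp add: field_simps exp_minus)
    hence "N (S t u) \<le> sqrt (K' / k * exp (- c * t) * Q u u)" by (simp add: N_def)
    also have "\<dots> = sqrt (K' / k) * exp (- (c / 2) * t) * N u"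
    proof -
      have "sqrt (exp (- c * t)) = exp (- (c / 2) * t)"
        by (intro real_sqrt_unique) (auto simp: power2_eq_square simp flip: exp_add)
      thus ?thesis by (simp only: real_sqrt_mult N_def)
    qed
    finally show ?thesis .
  qed
  have "N (S t u) \<le> sqrt (K' / k) * exp (- (c / 2) * t) * N u" if u: "u \<in> X" and t: "t > 0" for u t
  proof -
    define m where "m = sqrt (K' / k) * exp (- (c / 2) * t)"
    have m: "m \<ge> 0" using K' k by (simp add: m_def)
    obtain C where C: "C \<ge> 0" "\<And>v. v \<in> X \<Longrightarrow> N (S t v) \<le> C * N v"
      using locally_bounded[of t] t by auto
    have "N (S t u) \<le> m * N u + e" if e: "e > 0" for e
    proof -
      \<comment> \<open>Replacing \<open>u\<close> by \<open>d\<close> costs C + m times the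
        distance; the extra 1 makes the divisor positive.\<close>
      obtain d where d: "d \<in> D" "N (u - d) < e / (C + m + 1)"
        using dense[OF u, of "e / (C + m + 1)"] C m e by auto
      have "N (S t u) \<le> N (S t d) + N (S t (u - d))"
        using N_triangle'[of "S t u" "S t d"] u d t by (simp add: S_diff)
      also have "\<dots> \<le> m * N d + C * N (u - d)"
        using onD[OF d(1) t] C(2)[of "u - d"] d u by (simp add: m_def add_mono)
      also have "\<dots> \<le> m * (N u + N (u - d)) + C * N (u - d)"
        using N_triangle'[of d u] N_minus[of d u] d u m by (auto intro!: mult_left_mono)
      also have "\<dots> \<le> m * N u + (C + m + 1) * N (u - d)" using d u by (simp add: algebra_simps)
      also have "\<dots> \<le> m * N u + e" using d(2) C m by (simp add: field_simps)
      finally show ?thesis .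
    qed
    thus ?thesis unfolding m_def[symmetric] by (rule field_le_epsilon)
  qed
  thus ?thesis using K' k c by (intro exI[of _ "sqrt (K' / k)"] exI[of _ "c / 2"]) auto
qed

end

section \<open>The energy space\<close>

lemma H1_diff:
  assumes ab: "a < b" and u: "u \<in> H1 a b" and v: "v \<in> H1 a b"
  shows "weak_deriv a b (u - v) = weak_deriv a b u - weak_deriv a b v"
  using H1_add(2)[OF ab u H1_scaleR(1)[OF ab v], of "-1"] H1_scaleR(2)[OF ab v, of "-1"] by simp

lemma H1_0: "a < b \<Longrightarrow> 0 \<in> H1 a b" "a < b \<Longrightarrow> x \<in> {a..b} \<Longrightarrow> point_value a b 0 x = 0"
proof -
  assume ab: "a < b"
  obtain u where u: "u \<in> H1 a b"
    using H1_primitive[OF ab subspace_0[OF L2_subspace]] by blast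
  show "0 \<in> H1 a b" using H1_scaleR(1)[OF ab u, of 0] by simp
  show "x \<in> {a..b} \<Longrightarrow> point_value a b 0 x = 0" using H1_scaleR(3)[OF ab u, of x 0] by simp
qed

lemma wip_zero: "f \<in> L2 a b \<Longrightarrow> g \<in> L2 a b \<Longrightarrow> wip 0 0 a b f g = 0"
  using wip_combine[of f a b g 0 0] by simp

text \<open>The unweighted bound for \<surd>e f and g / \<surd>e, whose inner product is that of f
  and g.\<close>

lemma wip_young:
  assumes f: "f \<in> L2 a b" and g: "g \<in> L2 a b" and e: "e > 0"
  shows "\<bar>wip 1 0 a b f g\<bar> \<le> (e * L2_sqnorm a b f + L2_sqnorm a b g / e) / 2"
proof -
  define s where "s = sqrt e"
  have s: "s > 0" "s * s = e" using e by (simp_all add: s_def)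
  have m: "s *\<^sub>R f \<in> L2 a b" "(1 / s) *\<^sub>R g \<in> L2 a b"
    using f g L2_subspace by (auto intro: subspace_scale)
  have "wip 1 0 a b f g = wip 1 0 a b (s *\<^sub>R f) ((1 / s) *\<^sub>R g)"
    using f g m s by (simp add: wip_scaleR_left wip_scaleR_right)
  also have "\<bar>\<dots>\<bar> \<le> 1 / 2 * (L2_sqnorm a b (s *\<^sub>R f) + L2_sqnorm a b ((1 / s) *\<^sub>R g))"
    by (rule wip_bound[OF m]) simp
  also have "\<dots> = (e * L2_sqnorm a b f + L2_sqnorm a b g / e) / 2"
    using f g m s by (simp add: L2_sqnorm_eq_wip wip_scaleR_left wip_scaleR_right flip: mult.assoc)
  finally show ?thesis .
qed

text \<open>Components of a state and their derivatives are such maps, so every form built from them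
  by \<open>wip\<close> is bilinear by composition.\<close>

definition linear_into_L2 :: "'a::real_vector set \<Rightarrow> real \<Rightarrow> real \<Rightarrow> ('a \<Rightarrow> mfun) \<Rightarrow> bool" where
  "linear_into_L2 X a b P \<longleftrightarrow> (\<forall>u\<in>X. P u \<in> L2 a b) \<and>
     (\<forall>u\<in>X. \<forall>v\<in>X. P (u + v) = P u + P v) \<and> (\<forall>r. \<forall>u\<in>X. P (r *\<^sub>R u) = r *\<^sub>R P u)"

lemma sym_bilinear_on_add:
  "sym_bilinear_on X A \<Longrightarrow> sym_bilinear_on X B \<Longrightarrow> sym_bilinear_on X (\<lambda>u v. A u v + B u v)"
  unfolding sym_bilinear_on_def by (simp add: algebra_simps)

lemma sym_bilinear_on_cmult:
  "sym_bilinear_on X A \<Longrightarrow> sym_bilinear_on X (\<lambda>u v. c * A u v)"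
  unfolding sym_bilinear_on_def by (simp add: algebra_simps)

lemma sym_bilinear_on_wip:
  "linear_into_L2 X a b P \<Longrightarrow> sym_bilinear_on X (\<lambda>u v. wip p q a b (P u) (P v))"
  unfolding sym_bilinear_on_def linear_into_L2_def
  by (auto simp: wip_add_left wip_scaleR_left intro: wip_sym)

lemma sym_bilinear_on_wip_sym:
  "linear_into_L2 X a b P \<Longrightarrow> linear_into_L2 X a b R \<Longrightarrow>
    sym_bilinear_on X (\<lambda>u v. wip p q a b (P u) (R v) + wip p q a b (P v) (R u))"
  unfolding sym_bilinear_on_def linear_into_L2_def
  by (auto simp: wip_add_left wip_add_right wip_scaleR_left wip_scaleR_right algebra_simps)

section \<open>The concrete energy space and the density of the domain\<close>

locale kelvin_voigt =
  fixes \<beta> L \<tau> \<kappa>2 \<kappa>3 \<delta>1 \<delta>2 \<delta>3 :: real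
  assumes \<beta>: "0 < \<beta>" "\<beta> < L" and pos: "0 < \<tau>" "0 < \<kappa>2" "0 < \<kappa>3" "0 < \<delta>1"
    and \<delta>3: "\<delta>3 > 1 / (2 * \<kappa>3)" and \<delta>2: "\<bar>\<delta>2\<bar> < (1 / \<kappa>3) * sqrt (2 * \<kappa>3 * \<delta>3 - 1)"
begin

abbreviation "X \<equiv> energy_space \<beta> L"
abbreviation "cv (U :: state) \<equiv> fst U"
abbreviation "cw (U :: state) \<equiv> fst (snd U)"
abbreviation "cz (U :: state) \<equiv> fst (snd (snd U))"
abbreviation "c\<phi> (U :: state) \<equiv> fst (snd (snd (snd U)))"
abbreviation "c\<eta> (U :: state) \<equiv> snd (snd (snd (snd U)))"
abbreviation "cvx U \<equiv> weak_deriv 0 \<beta> (cv U)"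
abbreviation "cwx U \<equiv> weak_deriv \<beta> L (cw U)"

text \<open>The polarization of the squared energy norm, as a real inner product.\<close>

definition "Q U V = \<kappa>2 * wip 1 0 0 \<beta> (cvx U) (cvx V) + \<kappa>3 * wip 1 0 \<beta> L (cwx U) (cwx V)
  + wip 1 0 0 \<beta> (cz U) (cz V) + wip 1 0 \<beta> L (c\<phi> U) (c\<phi> V) + \<tau> * wip 1 0 0 1 (c\<eta> U) (c\<eta> V)"

lemma energy_norm_eq: "energy_norm \<beta> L \<tau> \<kappa>2 \<kappa>3 = (\<lambda>U. sqrt (Q U U))"
  by (auto simp: energy_norm_def Q_def L2_sqnorm_eq_wip fun_eq_iff)

lemma X_iff: "U \<in> X \<longleftrightarrow> cv U \<in> H1 0 \<beta> \<and> cw U \<in> H1 \<beta> L \<and> point_value 0 \<beta> (cv U) 0 = 0 \<and>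
    point_value 0 \<beta> (cv U) \<beta> = point_value \<beta> L (cw U) \<beta> \<and> cz U \<in> L2 0 \<beta> \<and> c\<phi> U \<in> L2 \<beta> L \<and> c\<eta> U \<in> L2 0 1"
  by (cases U) (auto simp: energy_space_def X1L_def X1_def X0_def)

lemma subspace_X: "subspace X"
  using \<beta> by (intro subspaceI)
    (auto simp: X_iff H1_0 H1_add H1_scaleR L2_subspace intro: subspace_add subspace_scale subspace_0)

lemma components_linear:
  "linear_into_L2 X 0 \<beta> cv" "linear_into_L2 X \<beta> L cw" "linear_into_L2 X 0 \<beta> cvx" "linear_into_L2 X \<beta> L cwx"
  "linear_into_L2 X 0 \<beta> cz" "linear_into_L2 X \<beta> L c\<phi>" "linear_into_L2 X 0 1 c\<eta>"
  using \<beta> by (auto simp: linear_into_L2_def X_iff H1_add H1_scaleR)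

lemma Q_bilinear: "sym_bilinear_on X Q"
  unfolding Q_def[abs_def]
  by (intro sym_bilinear_on_add sym_bilinear_on_cmult sym_bilinear_on_wip components_linear)

lemma Q_diag: "Q U U = \<kappa>2 * L2_sqnorm 0 \<beta> (cvx U) + \<kappa>3 * L2_sqnorm \<beta> L (cwx U)
  + L2_sqnorm 0 \<beta> (cz U) + L2_sqnorm \<beta> L (c\<phi> U) + \<tau> * L2_sqnorm 0 1 (c\<eta> U)"
  by (simp add: Q_def L2_sqnorm_eq_wip)

lemma Q_nonneg: "0 \<le> Q U U"
  using pos by (auto simp: Q_diag L2_sqnorm_nonneg intro!: add_nonneg_nonneg mult_nonneg_nonneg)

lemma Q_bounds_components:
  "L2_sqnorm 0 \<beta> (cvx U) \<le> Q U U / \<kappa>2" "L2_sqnorm \<beta> L (cwx U) \<le> Q U U / \<kappa>3"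
  "L2_sqnorm 0 \<beta> (cz U) \<le> Q U U" "L2_sqnorm \<beta> L (c\<phi> U) \<le> Q U U" "L2_sqnorm 0 1 (c\<eta> U) \<le> Q U U / \<tau>"
proof -
  have n: "0 \<le> \<kappa>2 * L2_sqnorm 0 \<beta> (cvx U)" "0 \<le> \<kappa>3 * L2_sqnorm \<beta> L (cwx U)"
    "0 \<le> L2_sqnorm 0 \<beta> (cz U)" "0 \<le> L2_sqnorm \<beta> L (c\<phi> U)" "0 \<le> \<tau> * L2_sqnorm 0 1 (c\<eta> U)"
    using pos by (simp_all add: L2_sqnorm_nonneg)
  have "\<kappa>2 * L2_sqnorm 0 \<beta> (cvx U) \<le> Q U U" "\<kappa>3 * L2_sqnorm \<beta> L (cwx U) \<le> Q U U"
    "L2_sqnorm 0 \<beta> (cz U) \<le> Q U U" "L2_sqnorm \<beta> L (c\<phi> U) \<le> Q U U" "\<tau> * L2_sqnorm 0 1 (c\<eta> U) \<le> Q U U"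
    using n unfolding Q_diag by linarith+
  thus "L2_sqnorm 0 \<beta> (cvx U) \<le> Q U U / \<kappa>2" "L2_sqnorm \<beta> L (cwx U) \<le> Q U U / \<kappa>3"
    "L2_sqnorm 0 \<beta> (cz U) \<le> Q U U" "L2_sqnorm \<beta> L (c\<phi> U) \<le> Q U U" "L2_sqnorm 0 1 (c\<eta> U) \<le> Q U U / \<tau>"
    using pos by (simp_all add: field_simps)
qed

lemma Q_diff:
  assumes "U \<in> X" "V \<in> X"
  shows "Q (U - V) (U - V) = \<kappa>2 * L2_sqnorm 0 \<beta> (cvx U - cvx V) + \<kappa>3 * L2_sqnorm \<beta> L (cwx U - cwx V)
    + L2_sqnorm 0 \<beta> (cz U - cz V) + L2_sqnorm \<beta> L (c\<phi> U - c\<phi> V) + \<tau> * L2_sqnorm 0 1 (c\<eta> U - c\<eta> V)"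
  using assms \<beta> by (simp add: Q_diag X_iff H1_diff)

text \<open>v_x and w_x can be prescribed freely: v is integrated from 0 and w from the value of v
  at \<beta>. Completeness and density thus reduce to L2 components.\<close>

lemma X_exists:
  assumes "p \<in> L2 0 \<beta>" "q \<in> L2 \<beta> L" "z \<in> L2 0 \<beta>" "\<phi> \<in> L2 \<beta> L" "\<eta> \<in> L2 0 1"
  obtains v w where "(v, w, z, \<phi>, \<eta>) \<in> X" "weak_deriv 0 \<beta> v = p" "weak_deriv \<beta> L w = q"
proof -
  obtain v where v: "v \<in> H1 0 \<beta>" "weak_deriv 0 \<beta> v = p" "point_value 0 \<beta> v 0 = 0"
    using H1_primitive[OF \<beta>(1) assms(1)] by blast
  obtain w where w: "w \<in> H1 \<beta> L" "weak_deriv \<beta> L w = q" "point_value \<beta> L w \<beta> = point_value 0 \<beta> v \<beta>"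
    using H1_primitive[OF \<beta>(2) assms(2)] by blast
  show ?thesis using v w assms by (intro that[of v w]) (auto simp: X_iff)
qed

text \<open>The energy sees v and w through their derivatives only, so limits are taken of v_x and
  w_x and integrated back within the energy space.\<close>

lemma Q_complete:
  fixes x :: "nat \<Rightarrow> state"
  assumes x: "\<And>n. x n \<in> X" and d: "\<And>n. sqrt (Q (x (Suc n) - x n) (x (Suc n) - x n)) \<le> (1/3) ^ n"
  shows "\<exists>l\<in>X. (\<lambda>n. sqrt (Q (x n - l) (x n - l))) \<longlonglongrightarrow> 0"
proof -
  have Q9: "Q (x (Suc n) - x n) (x (Suc n) - x n) \<le> (1/9) ^ n" for n
  proof -
    have "(sqrt (Q (x (Suc n) - x n) (x (Suc n) - x n)))\<^sup>2 \<le> ((1/3) ^ n)\<^sup>2"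
      using d[of n] Q_nonneg by (intro power_mono) auto
    thus ?thesis using Q_nonneg by (simp add: power2_eq_square flip: power_mult_distrib)
  qed
  have m: "cvx (x n) \<in> L2 0 \<beta>" "cwx (x n) \<in> L2 \<beta> L" "cz (x n) \<in> L2 0 \<beta>" "c\<phi> (x n) \<in> L2 \<beta> L" "c\<eta> (x n) \<in> L2 0 1" for n
    using x[of n] \<beta> by (auto simp: X_iff)
  note B = Q_bounds_components[of "x (Suc n) - x n" for n]
  have D: "cvx (x (Suc n) - x n) = cvx (x (Suc n)) - cvx (x n)" "cwx (x (Suc n) - x n) = cwx (x (Suc n)) - cwx (x n)" for n
    using x[of n] x[of "Suc n"] \<beta> by (auto simp: X_iff H1_diff)
  have div: "Q (x (Suc n) - x n) (x (Suc n) - x n) / k \<le> 1 / k * (1/9)^n" if "k > 0" for n k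
    using Q9[of n] that by (simp add: divide_right_mono)
  obtain p where p: "p \<in> L2 0 \<beta>" "(\<lambda>n. L2_sqnorm 0 \<beta> (cvx (x n) - p)) \<longlonglongrightarrow> 0"
    by (rule L2_rapidly_Cauchy[of 0 \<beta> "\<lambda>n. cvx (x n)" "1 / \<kappa>2"])
      (use \<beta> m order_trans[OF B(1)[unfolded D] div[OF pos(2)]] in auto)
  obtain q where q: "q \<in> L2 \<beta> L" "(\<lambda>n. L2_sqnorm \<beta> L (cwx (x n) - q)) \<longlonglongrightarrow> 0"
    by (rule L2_rapidly_Cauchy[of \<beta> L "\<lambda>n. cwx (x n)" "1 / \<kappa>3"])
      (use \<beta> m order_trans[OF B(2)[unfolded D] div[OF pos(3)]] in auto)
  obtain z where z: "z \<in> L2 0 \<beta>" "(\<lambda>n. L2_sqnorm 0 \<beta> (cz (x n) - z)) \<longlonglongrightarrow> 0"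
    by (rule L2_rapidly_Cauchy[of 0 \<beta> "\<lambda>n. cz (x n)" 1])
      (use \<beta> m order_trans[OF B(3) Q9] in auto)
  obtain \<phi> where \<phi>: "\<phi> \<in> L2 \<beta> L" "(\<lambda>n. L2_sqnorm \<beta> L (c\<phi> (x n) - \<phi>)) \<longlonglongrightarrow> 0"
    by (rule L2_rapidly_Cauchy[of \<beta> L "\<lambda>n. c\<phi> (x n)" 1])
      (use \<beta> m order_trans[OF B(4) Q9] in auto)
  obtain \<eta> where \<eta>: "\<eta> \<in> L2 0 1" "(\<lambda>n. L2_sqnorm 0 1 (c\<eta> (x n) - \<eta>)) \<longlonglongrightarrow> 0"
    by (rule L2_rapidly_Cauchy[of 0 1 "\<lambda>n. c\<eta> (x n)" "1 / \<tau>"])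
      (use m order_trans[OF B(5) div[OF pos(1)]] in auto)
  obtain v w where l: "(v, w, z, \<phi>, \<eta>) \<in> X" "weak_deriv 0 \<beta> v = p" "weak_deriv \<beta> L w = q"
    using X_exists[OF p(1) q(1) z(1) \<phi>(1) \<eta>(1)] by blast
  have "(\<lambda>n. \<kappa>2 * L2_sqnorm 0 \<beta> (cvx (x n) - p) + \<kappa>3 * L2_sqnorm \<beta> L (cwx (x n) - q)
    + L2_sqnorm 0 \<beta> (cz (x n) - z) + L2_sqnorm \<beta> L (c\<phi> (x n) - \<phi>) + \<tau> * L2_sqnorm 0 1 (c\<eta> (x n) - \<eta>))
    \<longlonglongrightarrow> \<kappa>2 * 0 + \<kappa>3 * 0 + 0 + 0 + \<tau> * 0"
    by (intro tendsto_intros p q z \<phi> \<eta>)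
  hence "(\<lambda>n. Q (x n - (v, w, z, \<phi>, \<eta>)) (x n - (v, w, z, \<phi>, \<eta>))) \<longlonglongrightarrow> 0"
    using l by (simp add: Q_diff[OF x l(1)])
  hence "(\<lambda>n. sqrt (Q (x n - (v, w, z, \<phi>, \<eta>)) (x n - (v, w, z, \<phi>, \<eta>)))) \<longlonglongrightarrow> sqrt 0"
    by (rule tendsto_real_sqrt)
  thus ?thesis using l(1) by auto
qed

sublocale hilbert_form X Q
  by unfold_locales (auto intro: subspace_X Q_bilinear Q_nonneg Q_complete)

abbreviation "D \<equiv> dom_A \<beta> L \<kappa>2 \<kappa>3 \<delta>1 \<delta>2 \<delta>3"
abbreviation "A \<equiv> op_A \<beta> L \<tau> \<kappa>2 \<kappa>3 \<delta>1"

text \<open>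
  Only \<open>\<kappa>\<^sub>2 v + \<delta>\<^sub>1 z\<close> has to be in \<open>H\<^sup>2\<close>, so first \<open>z\<close> is approximated, then the stress
  \<open>\<kappa>\<^sub>2 v\<^sub>x + \<delta>\<^sub>1 z\<^sub>x\<close>, and \<open>v\<close> is recovered from these two.
\<close>

lemma D_dense:
  assumes U: "U \<in> X" and e: "e > 0"
  shows "\<exists>V\<in>D. sqrt (Q (U - V) (U - V)) < e"
proof -
  \<comment> \<open>Five component errors below \<open>d\<close>, weighted by \<kappa>2, \<kappa>3,
    1, 1 and \<tau>, add up to less than e^2.\<close>
  define d where "d = e\<^sup>2 / (\<kappa>2 + \<kappa>3 + 2 + \<tau>)"
  have d: "d > 0" using e pos by (auto simp: d_def intro!: divide_pos_pos add_pos_pos)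
  have m: "cvx U \<in> L2 0 \<beta>" "cwx U \<in> L2 \<beta> L" "cz U \<in> L2 0 \<beta>" "c\<phi> U \<in> L2 \<beta> L" "c\<eta> U \<in> L2 0 1"
    using U \<beta> by (auto simp: X_iff)
  note sub = subspace_add[OF L2_subspace] subspace_scale[OF L2_subspace] subspace_diff[OF L2_subspace]
  obtain z where z: "z \<in> H1 0 \<beta>" "point_value 0 \<beta> z 0 = 0" "point_value 0 \<beta> z \<beta> = 0" "L2_sqnorm 0 \<beta> (cz U - z) < d"
    using H1_0_dense[OF \<beta>(1) m(3) d] by blast
  obtain \<phi> where \<phi>: "\<phi> \<in> H1 \<beta> L" "point_value \<beta> L \<phi> \<beta> = 0" "point_value \<beta> L \<phi> L = 0" "L2_sqnorm \<beta> L (c\<phi> U - \<phi>) < d"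
    using H1_0_dense[OF \<beta>(2) m(4) d] by blast
  obtain \<eta> where \<eta>: "\<eta> \<in> H1 0 1" "point_value 0 1 \<eta> 0 = 0" "point_value 0 1 \<eta> 1 = 0" "L2_sqnorm 0 1 (c\<eta> U - \<eta>) < d"
    using H1_0_dense[OF _ m(5) d] by auto
  obtain q where q: "q \<in> H1 \<beta> L" "point_value \<beta> L q \<beta> = 0" "point_value \<beta> L q L = 0" "L2_sqnorm \<beta> L (cwx U - q) < d"
    using H1_0_dense[OF \<beta>(2) m(2) d] by blast
  define zx where "zx = weak_deriv 0 \<beta> z"
  have zx: "zx \<in> L2 0 \<beta>" using z \<beta> by (auto simp: zx_def)
  have mm: "\<kappa>2 *\<^sub>R cvx U + \<delta>1 *\<^sub>R zx \<in> L2 0 \<beta>" using m zx by (intro sub)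
  have "\<kappa>2\<^sup>2 * d > 0" using d pos by simp
  then obtain s where s: "s \<in> H1 0 \<beta>" "point_value 0 \<beta> s \<beta> = 0"
      "L2_sqnorm 0 \<beta> (\<kappa>2 *\<^sub>R cvx U + \<delta>1 *\<^sub>R zx - s) < \<kappa>2\<^sup>2 * d"
    using H1_0_dense[OF \<beta>(1) mm] by blast
  \<comment> \<open>The solution of \<kappa>2 p + \<delta>1 z_x = s. Division by \<kappa>2 explains
    why \<open>s\<close> was chosen with error \<kappa>2^2 d.\<close>
  define p where "p = (1 / \<kappa>2) *\<^sub>R (s - \<delta>1 *\<^sub>R zx)"
  have sL: "s \<in> L2 0 \<beta>" "z \<in> L2 0 \<beta>" "\<phi> \<in> L2 \<beta> L" "\<eta> \<in> L2 0 1" "q \<in> L2 \<beta> L" using s z \<phi> \<eta> q by auto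
  have p: "p \<in> L2 0 \<beta>" unfolding p_def using sL zx by (intro sub)
  obtain v w where V: "(v, w, z, \<phi>, \<eta>) \<in> X" "weak_deriv 0 \<beta> v = p" "weak_deriv \<beta> L w = q"
    using X_exists[OF p sL(5,2,3,4)] by blast
  have vw: "v \<in> H1 0 \<beta>" "w \<in> H1 \<beta> L" "point_value 0 \<beta> v 0 = 0" "point_value 0 \<beta> v \<beta> = point_value \<beta> L w \<beta>"
    using V(1) by (auto simp: X_iff)
  have kz: "\<kappa>2 *\<^sub>R v + \<delta>1 *\<^sub>R z \<in> H1 0 \<beta>" "weak_deriv 0 \<beta> (\<kappa>2 *\<^sub>R v + \<delta>1 *\<^sub>R z) = s"
    using vw z \<beta> pos V by (simp_all add: H1_add H1_scaleR p_def flip: zx_def)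
  \<comment> \<open>All traces at \<beta>, at L and of \<open>\<eta>\<close> in the interface and
    feedback conditions are zero, so these conditions read 0 = 0. The trace of v at \<beta> is
    matched by \<open>X_exists\<close>.\<close>
  have inD: "(v, w, z, \<phi>, \<eta>) \<in> D"
    using vw z \<phi> \<eta> q s kz V by (simp add: dom_A_def X1L_def X1_def X2_def H2_def)
  have "L2_sqnorm 0 \<beta> (cvx U - p) < d"
  proof -
    have "cvx U - p = (1 / \<kappa>2) *\<^sub>R (\<kappa>2 *\<^sub>R cvx U + \<delta>1 *\<^sub>R zx - s)"
      using pos by (simp add: p_def scaleR_diff_right scaleR_add_right)
    moreover have "\<kappa>2 *\<^sub>R cvx U + \<delta>1 *\<^sub>R zx - s \<in> L2 0 \<beta>" by (rule sub(3)[OF mm sL(1)])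
    ultimately have "L2_sqnorm 0 \<beta> (cvx U - p) = (1 / \<kappa>2) * ((1 / \<kappa>2) * L2_sqnorm 0 \<beta> (\<kappa>2 *\<^sub>R cvx U + \<delta>1 *\<^sub>R zx - s))"
      by (simp add: L2_sqnorm_eq_wip wip_scaleR_left wip_scaleR_right sub(2))
    also have "\<dots> < (1 / \<kappa>2) * ((1 / \<kappa>2) * (\<kappa>2\<^sup>2 * d))"
      using s(3) pos by (intro mult_strict_left_mono) auto
    also have "\<dots> = d" using pos by (simp add: power2_eq_square)
    finally show ?thesis .
  qed
  have "Q (U - (v, w, z, \<phi>, \<eta>)) (U - (v, w, z, \<phi>, \<eta>)) < \<kappa>2 * d + \<kappa>3 * d + d + d + \<tau> * d"
    using \<open>L2_sqnorm 0 \<beta> (cvx U - p) < d\<close> z(4) \<phi>(4) \<eta>(4) q(4) pos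
    unfolding Q_diff[OF U V(1)] fst_conv snd_conv V(2,3)
    by (intro add_strict_mono mult_strict_left_mono)
  also have "\<dots> = (\<kappa>2 + \<kappa>3 + 2 + \<tau>) * d" by (simp add: algebra_simps)
  also have "\<dots> = e\<^sup>2" using pos by (simp add: d_def)
  finally have "sqrt (Q (U - (v, w, z, \<phi>, \<eta>)) (U - (v, w, z, \<phi>, \<eta>))) < e"
    using e by (metis real_sqrt_less_mono real_sqrt_abs abs_of_pos)
  with inD show ?thesis by blast
qed

end

section \<open>The Lyapunov functional\<close>

lemma cmod_sq_eq: "(cmod z)\<^sup>2 = Re z * Re z + Im z * Im z"
  by (simp add: cmod_power2 flip: power2_eq_square)

text \<open>In the moduli the form is at least P x^2 - R x y + y^2 / 2 with P = \<kappa> \<delta>3 -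
  1/2 and R = \<kappa> |\<delta>2|. The conditions say P > 0 and R^2 < 2 P, which is a negative
  discriminant.\<close>

lemma negative_definite_boundary_form:
  fixes \<kappa> \<delta>2 \<delta>3 :: real
  assumes k: "0 < \<kappa>" and \<delta>3: "\<delta>3 > 1 / (2 * \<kappa>)" and \<delta>2: "\<bar>\<delta>2\<bar> < (1 / \<kappa>) * sqrt (2 * \<kappa> * \<delta>3 - 1)"
  obtains c where "c > 0" "\<And>x y. \<kappa> * \<delta>3 * (cmod x)\<^sup>2 + \<kappa> * \<delta>2 * Re (x * cnj y) - ((cmod x)\<^sup>2 - (cmod y)\<^sup>2) / 2
      \<ge> c * ((cmod x)\<^sup>2 + (cmod y)\<^sup>2)"
proof -
  define P where "P = \<kappa> * \<delta>3 - 1 / 2"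
  define R where "R = \<kappa> * \<bar>\<delta>2\<bar>"
  have P: "P > 0" using \<delta>3 k by (simp add: P_def field_simps)
  have "R < sqrt (2 * P)" using mult_strict_left_mono[OF \<delta>2 k] k by (simp add: R_def P_def algebra_simps)
  moreover have R0: "R \<ge> 0" using k by (simp add: R_def)
  ultimately have "R\<^sup>2 < (sqrt (2 * P))\<^sup>2" by (intro power_strict_mono) auto
  hence R: "R\<^sup>2 < 2 * P" using P by simp
  \<comment> \<open>Chosen so that, after subtracting \<open>c\<close> from both diagonal entries,
    all terms of 4 (P - c) (1/2 - c) - R^2 cancel except 4 c^2.\<close>
  define c where "c = (2 * P - R\<^sup>2) / (4 * P + 2)"
  have c: "c > 0" using R P by (simp add: c_def)
  have cc: "c * (4 * P + 2) = 2 * P - R\<^sup>2" using P by (simp add: c_def)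
  \<comment> \<open>Completing the square multiplies the form by 4 (P - c); this factor has to be
    positive to be cancelled.\<close>
  have cP: "c < P"
  proof -
    have "c * (4 * P + 2) \<le> 2 * P" using cc by simp
    also have "\<dots> < P * (4 * P + 2)" using P by (simp add: algebra_simps)
    finally show ?thesis using P by (simp add: mult_less_cancel_right)
  qed
  have key: "(P - c) * s\<^sup>2 - R * s * t + (1 / 2 - c) * t\<^sup>2 \<ge> 0" for s t
  proof -
    have *: "4 * (P - c) * (1 / 2 - c) - R\<^sup>2 = 4 * c\<^sup>2"
      using cc by (simp add: algebra_simps power2_eq_square)
    have "4 * r * (r * s\<^sup>2 - R * s * t + q * t\<^sup>2) = (2 * r * s - R * t)\<^sup>2 + (4 * r * q - R\<^sup>2) * t\<^sup>2" for r q
      by (simp add: algebra_simps power2_eq_square)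
    from this[of "P - c" "1 / 2 - c"] have "4 * (P - c) * ((P - c) * s\<^sup>2 - R * s * t + (1 / 2 - c) * t\<^sup>2)
        = (2 * (P - c) * s - R * t)\<^sup>2 + 4 * c\<^sup>2 * t\<^sup>2"
      by (simp only: *)
    also have "\<dots> \<ge> 0" by simp
    finally show ?thesis using cP by (simp add: zero_le_mult_iff)
  qed
  show ?thesis
  proof (rule that[OF c])
    fix x y :: complex
    have "\<bar>Re (x * cnj y)\<bar> \<le> cmod x * cmod y" using abs_Re_le_cmod[of "x * cnj y"] by (simp only: norm_mult complex_mod_cnj)
    hence "\<kappa> * \<bar>\<delta>2\<bar> * \<bar>Re (x * cnj y)\<bar> \<le> R * (cmod x * cmod y)"
      unfolding R_def using k by (intro mult_left_mono) auto
    hence "\<bar>\<kappa> * \<delta>2 * Re (x * cnj y)\<bar> \<le> R * (cmod x * cmod y)" using k by (simp only: abs_mult)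
    from abs_le_D2[OF this] have "\<kappa> * \<delta>2 * Re (x * cnj y) \<ge> - (R * cmod x * cmod y)"
      unfolding mult.assoc by linarith
    moreover have "\<kappa> * \<delta>3 * (cmod x)\<^sup>2 = P * (cmod x)\<^sup>2 + (cmod x)\<^sup>2 / 2" by (simp add: P_def algebra_simps)
    moreover have "(P - c) * (cmod x)\<^sup>2 = P * (cmod x)\<^sup>2 - c * (cmod x)\<^sup>2"
      "(1 / 2 - c) * (cmod y)\<^sup>2 = (cmod y)\<^sup>2 / 2 - c * (cmod y)\<^sup>2"
      "c * ((cmod x)\<^sup>2 + (cmod y)\<^sup>2) = c * (cmod x)\<^sup>2 + c * (cmod y)\<^sup>2"
      by (simp_all add: algebra_simps)
    ultimately show "\<kappa> * \<delta>3 * (cmod x)\<^sup>2 + \<kappa> * \<delta>2 * Re (x * cnj y) - ((cmod x)\<^sup>2 - (cmod y)\<^sup>2) / 2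
      \<ge> c * ((cmod x)\<^sup>2 + (cmod y)\<^sup>2)"
      using key[of "cmod x" "cmod y"] by argo
  qed
qed

section \<open>Multiplier identities and the choice of the Lyapunov functional\<close>

context kelvin_voigt
begin

text \<open>The three multiplier functionals in polarized form, so that 2 F U (A U) is the
  derivative of F U U along a trajectory. \<open>F1\<close> and \<open>F3\<close> are symmetrized
  and hence, on the diagonal, twice the usual integrals.\<close>

definition "F1 U V = wip (- \<beta>) 1 \<beta> L (c\<phi> U) (cwx V) + wip (- \<beta>) 1 \<beta> L (c\<phi> V) (cwx U)"
definition "F2 U V = \<tau> * wip 2 (- 1) 0 1 (c\<eta> U) (c\<eta> V)"
definition "F3 U V = (wip 1 0 0 \<beta> (cz U) (cv V) + wip 1 0 0 \<beta> (cz V) (cv U))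
  + (wip 1 0 \<beta> L (c\<phi> U) (cw V) + wip 1 0 \<beta> L (c\<phi> V) (cw U))"

lemma F_bilinear: "sym_bilinear_on X F1" "sym_bilinear_on X F2" "sym_bilinear_on X F3"
  unfolding F1_def[abs_def] F2_def[abs_def] F3_def[abs_def]
  by (intro sym_bilinear_on_add sym_bilinear_on_cmult sym_bilinear_on_wip_sym sym_bilinear_on_wip components_linear)+

text \<open>v(0) = 0 bounds v by v_x, continuity at \<beta> hands the bound over to w, and w_x
  carries it on to L. The velocities of a state in the domain satisfy the same conditions, so this
  applies to them too.\<close>

lemma Poincare:
  assumes "v \<in> H1 0 \<beta>" "w \<in> H1 \<beta> L" "point_value 0 \<beta> v 0 = 0" "point_value 0 \<beta> v \<beta> = point_value \<beta> L w \<beta>"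
  defines "M \<equiv> 2 * \<beta> * L2_sqnorm 0 \<beta> (weak_deriv 0 \<beta> v) + 2 * (L - \<beta>) * L2_sqnorm \<beta> L (weak_deriv \<beta> L w)"
  shows "L2_sqnorm 0 \<beta> v \<le> \<beta> * (\<beta> * L2_sqnorm 0 \<beta> (weak_deriv 0 \<beta> v))"
    and "x \<in> {\<beta>..L} \<Longrightarrow> (cmod (point_value \<beta> L w x))\<^sup>2 \<le> M"
    and "L2_sqnorm \<beta> L w \<le> (L - \<beta>) * M"
proof -
  have v: "(cmod (point_value 0 \<beta> v x))\<^sup>2 \<le> \<beta> * L2_sqnorm 0 \<beta> (weak_deriv 0 \<beta> v)" if "x \<in> {0..\<beta>}" for x
    using H1_point_value_diff[OF \<beta>(1) assms(1) that] assms(3) by simp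
  show "L2_sqnorm 0 \<beta> v \<le> \<beta> * (\<beta> * L2_sqnorm 0 \<beta> (weak_deriv 0 \<beta> v))"
    using L2_sqnorm_le_sup[OF \<beta>(1) assms(1) v] by simp
  have w: "(cmod (point_value \<beta> L w x))\<^sup>2 \<le> M" if "x \<in> {\<beta>..L}" for x
  proof -
    have "(cmod (point_value \<beta> L w x))\<^sup>2 \<le> 2 * (cmod (point_value \<beta> L w x - point_value \<beta> L w \<beta>))\<^sup>2
        + 2 * (cmod (point_value \<beta> L w \<beta>))\<^sup>2"
      using sum_sq_le[of "point_value \<beta> L w x - point_value \<beta> L w \<beta>" "point_value \<beta> L w \<beta>"] by simp
    moreover have "(cmod (point_value \<beta> L w \<beta>))\<^sup>2 \<le> \<beta> * L2_sqnorm 0 \<beta> (weak_deriv 0 \<beta> v)"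
      using v[of \<beta>] \<beta> assms(4) by simp
    ultimately show ?thesis
      using H1_point_value_diff[OF \<beta>(2) assms(2) that] unfolding M_def mult.assoc by linarith
  qed
  show "x \<in> {\<beta>..L} \<Longrightarrow> (cmod (point_value \<beta> L w x))\<^sup>2 \<le> M" by (rule w)
  show "L2_sqnorm \<beta> L w \<le> (L - \<beta>) * M" by (rule L2_sqnorm_le_sup[OF \<beta>(2) assms(2) w])
qed

text \<open>With this bound a large multiple of \<open>Q\<close> dominates the multiplier terms, so
  that the perturbed functional is equivalent to the energy.\<close>

lemma multipliers_bounded:
  "\<exists>K\<ge>0. \<forall>U\<in>X. \<bar>2 * F1 U U + F3 U U / 2 + F2 U U\<bar> \<le> K * Q U U"
proof -
  define C where "C = 2 * \<beta> / \<kappa>2 + 2 * (L - \<beta>) / \<kappa>3"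
  \<comment> \<open>The summands bound in turn 2 F1, the two parts of F3 / 2 (generously, by twice
    their Young bounds), and F2.\<close>
  define K where "K = 2 * (L - \<beta>) * (1 + 1 / \<kappa>3) + (1 + \<beta>\<^sup>2 / \<kappa>2) + (1 + (L - \<beta>) * C) + 2"
  have C: "C \<ge> 0" using \<beta> pos by (simp add: C_def)
  have K: "K \<ge> 0" using \<beta> pos C by (simp add: K_def)
  have "\<bar>2 * F1 U U + F3 U U / 2 + F2 U U\<bar> \<le> K * Q U U" if U: "U \<in> X" for U
  proof -
    define E where "E = Q U U"
    have E: "E \<ge> 0" using Q_nonneg by (simp add: E_def)
    have m: "cv U \<in> H1 0 \<beta>" "cw U \<in> H1 \<beta> L" "point_value 0 \<beta> (cv U) 0 = 0"
      "point_value 0 \<beta> (cv U) \<beta> = point_value \<beta> L (cw U) \<beta>"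
      "cz U \<in> L2 0 \<beta>" "c\<phi> U \<in> L2 \<beta> L" "c\<eta> U \<in> L2 0 1" using U by (auto simp: X_iff)
    have m': "cv U \<in> L2 0 \<beta>" "cw U \<in> L2 \<beta> L" "cwx U \<in> L2 \<beta> L" using m \<beta> by auto
    note b = Q_bounds_components[of U, folded E_def]
    have "2 * \<beta> * L2_sqnorm 0 \<beta> (cvx U) + 2 * (L - \<beta>) * L2_sqnorm \<beta> L (cwx U)
        \<le> 2 * \<beta> * (E / \<kappa>2) + 2 * (L - \<beta>) * (E / \<kappa>3)"
      using b \<beta> by (intro add_mono mult_left_mono) auto
    also have "\<dots> = C * E" by (simp add: C_def distrib_right)
    finally have "(L - \<beta>) * (2 * \<beta> * L2_sqnorm 0 \<beta> (cvx U) + 2 * (L - \<beta>) * L2_sqnorm \<beta> L (cwx U)) \<le> (L - \<beta>) * (C * E)"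
      using \<beta> by (intro mult_left_mono) auto
    hence w: "L2_sqnorm \<beta> L (cw U) \<le> (L - \<beta>) * C * E" using Poincare(3)[OF m(1-4)] by simp
    have "\<beta> * (\<beta> * L2_sqnorm 0 \<beta> (cvx U)) \<le> \<beta> * (\<beta> * (E / \<kappa>2))" using b \<beta> by (intro mult_left_mono) auto
    hence v: "L2_sqnorm 0 \<beta> (cv U) \<le> \<beta>\<^sup>2 / \<kappa>2 * E"
      using Poincare(1)[OF m(1-4)] by (simp add: power2_eq_square)
    have "\<bar>wip (- \<beta>) 1 \<beta> L (c\<phi> U) (cwx U)\<bar> \<le> (L - \<beta>) / 2 * (L2_sqnorm \<beta> L (c\<phi> U) + L2_sqnorm \<beta> L (cwx U))"
      by (intro wip_bound m m') auto
    also have "\<dots> \<le> (L - \<beta>) / 2 * (E + E / \<kappa>3)" using b \<beta> by (intro mult_left_mono add_mono) auto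
    finally have "\<bar>2 * F1 U U\<bar> \<le> 4 * ((L - \<beta>) / 2 * (E + E / \<kappa>3))" by (simp add: F1_def)
    also have "\<dots> = 2 * (L - \<beta>) * (1 + 1 / \<kappa>3) * E" using pos by (simp add: field_simps)
    finally have f1: "\<bar>2 * F1 U U\<bar> \<le> 2 * (L - \<beta>) * (1 + 1 / \<kappa>3) * E" .
    have "\<bar>wip 1 0 0 \<beta> (cz U) (cv U)\<bar> \<le> 1 / 2 * (L2_sqnorm 0 \<beta> (cz U) + L2_sqnorm 0 \<beta> (cv U))"
      by (intro wip_bound m m') auto
    also have "\<dots> \<le> 1 / 2 * (E + \<beta>\<^sup>2 / \<kappa>2 * E)" using b v by (intro mult_left_mono add_mono) auto
    finally have f3: "\<bar>wip 1 0 0 \<beta> (cz U) (cv U)\<bar> \<le> 1 / 2 * (E + \<beta>\<^sup>2 / \<kappa>2 * E)" .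
    have "\<bar>wip 1 0 \<beta> L (c\<phi> U) (cw U)\<bar> \<le> 1 / 2 * (L2_sqnorm \<beta> L (c\<phi> U) + L2_sqnorm \<beta> L (cw U))"
      by (intro wip_bound m m') auto
    also have "\<dots> \<le> 1 / 2 * (E + (L - \<beta>) * C * E)" using b w by (intro mult_left_mono add_mono) auto
    finally have f3': "\<bar>wip 1 0 \<beta> L (c\<phi> U) (cw U)\<bar> \<le> 1 / 2 * (E + (L - \<beta>) * C * E)" .
    have "\<bar>wip 2 (- 1) 0 1 (c\<eta> U) (c\<eta> U)\<bar> \<le> 2 / 2 * (L2_sqnorm 0 1 (c\<eta> U) + L2_sqnorm 0 1 (c\<eta> U))"
      by (intro wip_bound m m') auto
    also have "\<dots> \<le> 2 / 2 * (E / \<tau> + E / \<tau>)" using b by (intro mult_left_mono add_mono) auto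
    finally have "\<tau> * \<bar>wip 2 (- 1) 0 1 (c\<eta> U) (c\<eta> U)\<bar> \<le> \<tau> * (2 / 2 * (E / \<tau> + E / \<tau>))"
      using pos by (intro mult_left_mono) auto
    hence f2: "\<bar>F2 U U\<bar> \<le> 2 * E" using pos by (simp add: F2_def abs_mult)
    have f3'': "\<bar>F3 U U / 2\<bar> \<le> 1 / 2 * (E + \<beta>\<^sup>2 / \<kappa>2 * E) + 1 / 2 * (E + (L - \<beta>) * C * E)"
    proof -
      have "F3 U U / 2 = wip 1 0 0 \<beta> (cz U) (cv U) + wip 1 0 \<beta> L (c\<phi> U) (cw U)" by (simp add: F3_def)
      thus ?thesis using f3 f3' by linarith
    qed
    moreover have "0 \<le> \<beta>\<^sup>2 / \<kappa>2 * E" "0 \<le> (L - \<beta>) * C * E" using \<beta> pos C E by auto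
    ultimately have "\<bar>F3 U U / 2\<bar> \<le> E + \<beta>\<^sup>2 / \<kappa>2 * E + (E + (L - \<beta>) * C * E)" using E by argo
    hence "\<bar>2 * F1 U U + F3 U U / 2 + F2 U U\<bar> \<le> 2 * (L - \<beta>) * (1 + 1 / \<kappa>3) * E
        + (E + \<beta>\<^sup>2 / \<kappa>2 * E + (E + (L - \<beta>) * C * E)) + 2 * E" using f1 f2 by linarith
    also have "\<dots> = K * E" by (simp add: K_def algebra_simps)
    finally show ?thesis by (simp add: E_def)
  qed
  with K show ?thesis by blast
qed

text \<open>v and z lie in H1 separately, so the derivative of \<kappa>2 v + \<delta>1 z splits into
  the stress that also occurs in \<open>op_A\<close>.\<close>

lemma D_iff: "U \<in> D \<longleftrightarrow> cv U \<in> H1 0 \<beta> \<and> cw U \<in> H1 \<beta> L \<and> cz U \<in> H1 0 \<beta> \<and> c\<phi> U \<in> H1 \<beta> L \<and> c\<eta> U \<in> H1 0 1 \<and>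
   point_value 0 \<beta> (cv U) 0 = 0 \<and> point_value 0 \<beta> (cv U) \<beta> = point_value \<beta> L (cw U) \<beta> \<and>
   point_value 0 \<beta> (cz U) 0 = 0 \<and> point_value 0 \<beta> (cz U) \<beta> = point_value \<beta> L (c\<phi> U) \<beta> \<and>
   \<kappa>2 *\<^sub>R cvx U + \<delta>1 *\<^sub>R weak_deriv 0 \<beta> (cz U) \<in> H1 0 \<beta> \<and> cwx U \<in> H1 \<beta> L \<and>
   point_value 0 \<beta> (\<kappa>2 *\<^sub>R cvx U + \<delta>1 *\<^sub>R weak_deriv 0 \<beta> (cz U)) \<beta> = of_real \<kappa>3 * point_value \<beta> L (cwx U) \<beta> \<and>
   point_value \<beta> L (cwx U) L = - of_real \<delta>3 * point_value 0 1 (c\<eta> U) 0 - of_real \<delta>2 * point_value 0 1 (c\<eta> U) 1 \<and>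
   point_value \<beta> L (c\<phi> U) L = point_value 0 1 (c\<eta> U) 0"
  using \<beta> by (cases U) (auto simp: dom_A_def X1L_def X1_def X2_def H2_def H1_add H1_scaleR)

text \<open>On (0, \<beta>) integration by parts is applied only to pairs containing the stress
  \<open>s\<close>, the quantity known to be in H1. Interface terms either cancel between both sides
  or carry a vanishing weight.\<close>

lemma multiplier_identities:
  assumes U: "U \<in> D"
  defines "a \<equiv> point_value 0 1 (c\<eta> U) 0" and "b \<equiv> point_value 0 1 (c\<eta> U) 1"
    and "wL \<equiv> point_value \<beta> L (cw U) L" and "w' \<equiv> point_value \<beta> L (cwx U) L"
    and "zx \<equiv> weak_deriv 0 \<beta> (cz U)"
  shows "Q U (A U) = - \<delta>1 * L2_sqnorm 0 \<beta> zx - (\<kappa>3 * \<delta>3 * (cmod a)\<^sup>2 + \<kappa>3 * \<delta>2 * Re (a * cnj b)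
      - ((cmod a)\<^sup>2 - (cmod b)\<^sup>2) / 2)" (is ?energy)
    and "2 * F1 U (A U) = (L - \<beta>) * ((cmod a)\<^sup>2 + \<kappa>3 * (cmod w')\<^sup>2)
      - L2_sqnorm \<beta> L (c\<phi> U) - \<kappa>3 * L2_sqnorm \<beta> L (cwx U)" (is ?F1)
    and "2 * F2 U (A U) = 2 * (cmod a)\<^sup>2 - (cmod b)\<^sup>2 - L2_sqnorm 0 1 (c\<eta> U)" (is ?F2)
    and "F3 U (A U) = L2_sqnorm 0 \<beta> (cz U) + L2_sqnorm \<beta> L (c\<phi> U) - \<kappa>2 * L2_sqnorm 0 \<beta> (cvx U)
      - \<delta>1 * wip 1 0 0 \<beta> zx (cvx U) - \<kappa>3 * L2_sqnorm \<beta> L (cwx U) + \<kappa>3 * Re (w' * cnj wL)" (is ?F3)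
proof -
  define v w z \<phi> \<eta> where "v = cv U" "w = cw U" "z = cz U" "\<phi> = c\<phi> U" "\<eta> = c\<eta> U"
  note UU = this
  define vx wx where "vx = weak_deriv 0 \<beta> v" and "wx = weak_deriv \<beta> L w"
  define s where "s = \<kappa>2 *\<^sub>R vx + \<delta>1 *\<^sub>R zx"
  have H: "v \<in> H1 0 \<beta>" "w \<in> H1 \<beta> L" "z \<in> H1 0 \<beta>" "\<phi> \<in> H1 \<beta> L" "\<eta> \<in> H1 0 1" "s \<in> H1 0 \<beta>" "wx \<in> H1 \<beta> L"
    and bc: "point_value 0 \<beta> v 0 = 0" "point_value 0 \<beta> v \<beta> = point_value \<beta> L w \<beta>"
      "point_value 0 \<beta> z 0 = 0" "point_value 0 \<beta> z \<beta> = point_value \<beta> L \<phi> \<beta>"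
      "point_value 0 \<beta> s \<beta> = of_real \<kappa>3 * point_value \<beta> L wx \<beta>"
      "w' = - of_real \<delta>3 * a - of_real \<delta>2 * b" "point_value \<beta> L \<phi> L = a"
    using U unfolding D_iff UU[symmetric] s_def vx_def wx_def zx_def a_def b_def w'_def by auto
  have pv: "point_value 0 1 \<eta> 0 = a" "point_value 0 1 \<eta> 1 = b" "point_value \<beta> L w L = wL" "point_value \<beta> L wx L = w'"
    by (simp_all add: a_def b_def wL_def w'_def wx_def UU)
  have M: "v \<in> L2 0 \<beta>" "w \<in> L2 \<beta> L" "z \<in> L2 0 \<beta>" "\<phi> \<in> L2 \<beta> L" "\<eta> \<in> L2 0 1" "s \<in> L2 0 \<beta>" "wx \<in> L2 \<beta> L"
    "vx \<in> L2 0 \<beta>" "zx \<in> L2 0 \<beta>" "weak_deriv \<beta> L \<phi> \<in> L2 \<beta> L" "weak_deriv \<beta> L wx \<in> L2 \<beta> L"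
    "weak_deriv 0 \<beta> s \<in> L2 0 \<beta>" "weak_deriv 0 1 \<eta> \<in> L2 0 1"
    using H \<beta> by (auto simp: vx_def zx_def UU)
  have zx: "weak_deriv 0 \<beta> z = zx" by (simp add: zx_def UU)
  have AU: "A U = (z, \<phi>, weak_deriv 0 \<beta> s, \<kappa>3 *\<^sub>R weak_deriv \<beta> L wx, - (1 / \<tau>) *\<^sub>R weak_deriv 0 1 \<eta>)"
    by (cases U) (simp add: op_A_def UU s_def vx_def wx_def zx_def)
  have s_left: "wip 1 0 0 \<beta> s f = \<kappa>2 * wip 1 0 0 \<beta> vx f + \<delta>1 * wip 1 0 0 \<beta> zx f" if "f \<in> L2 0 \<beta>" for f
    unfolding s_def using M that
    by (simp add: wip_add_left wip_scaleR_left subspace_scale[OF L2_subspace])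
  \<comment> \<open>The interface term here is opposite to the one in \<open>P2\<close> times
    \<kappa>3, by continuity of the velocity and of the stress.\<close>
  have P1: "wip 1 0 0 \<beta> zx s + wip 1 0 0 \<beta> z (weak_deriv 0 \<beta> s) = \<kappa>3 * Re (point_value \<beta> L \<phi> \<beta> * cnj (point_value \<beta> L wx \<beta>))"
    using wip_by_parts[OF \<beta>(1) H(3) H(6), of 1 0] M bc by (simp add: wip_zero zx algebra_simps)
  have P2: "wip 1 0 \<beta> L (weak_deriv \<beta> L \<phi>) wx + wip 1 0 \<beta> L \<phi> (weak_deriv \<beta> L wx)
      = Re (a * cnj w') - Re (point_value \<beta> L \<phi> \<beta> * cnj (point_value \<beta> L wx \<beta>))"
    using wip_by_parts[OF \<beta>(2) H(4) H(7), of 1 0] M bc by (simp add: wip_zero pv)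
  have P3: "2 * wip 1 0 0 1 \<eta> (weak_deriv 0 1 \<eta>) = (cmod b)\<^sup>2 - (cmod a)\<^sup>2"
    using wip_by_parts[of 0 1, OF _ H(5) H(5), of 1 0] M wip_sym[of 1 0 0 1 \<eta>]
    by (simp add: wip_zero pv cmod_sq_eq)
  \<comment> \<open>The feedback law turns the power at L into the quadratic form in the present and
    the delayed velocity.\<close>
  have "\<kappa>3 * Re (a * cnj w') = - (\<kappa>3 * \<delta>3 * (cmod a)\<^sup>2) - \<kappa>3 * \<delta>2 * Re (a * cnj b)"
    unfolding bc(6) by (simp add: algebra_simps cmod_sq_eq)
  moreover have "Q U (A U) = \<kappa>2 * wip 1 0 0 \<beta> vx zx + \<kappa>3 * wip 1 0 \<beta> L wx (weak_deriv \<beta> L \<phi>)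
      + wip 1 0 0 \<beta> z (weak_deriv 0 \<beta> s) + \<kappa>3 * wip 1 0 \<beta> L \<phi> (weak_deriv \<beta> L wx)
      - wip 1 0 0 1 \<eta> (weak_deriv 0 1 \<eta>)"
    using M pos wip_scaleR_right[OF M(13) M(5), of 1 0 "- (1 / \<tau>)"]
    unfolding Q_def AU fst_conv snd_conv UU[symmetric] vx_def[symmetric] wx_def[symmetric] zx
    by (simp add: wip_scaleR_right)
  moreover have "wip 1 0 0 \<beta> z (weak_deriv 0 \<beta> s) = \<kappa>3 * Re (point_value \<beta> L \<phi> \<beta> * cnj (point_value \<beta> L wx \<beta>))
      - \<kappa>2 * wip 1 0 0 \<beta> vx zx - \<delta>1 * L2_sqnorm 0 \<beta> zx"
    using P1 s_left[OF M(9)] wip_sym[of 1 0 0 \<beta> zx s] by (simp add: L2_sqnorm_eq_wip)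
  moreover have "\<kappa>3 * wip 1 0 \<beta> L wx (weak_deriv \<beta> L \<phi>) + \<kappa>3 * wip 1 0 \<beta> L \<phi> (weak_deriv \<beta> L wx)
      = \<kappa>3 * Re (a * cnj w') - \<kappa>3 * Re (point_value \<beta> L \<phi> \<beta> * cnj (point_value \<beta> L wx \<beta>))"
    using arg_cong[OF P2, of "\<lambda>x. \<kappa>3 * x"] wip_sym[of 1 0 \<beta> L wx "weak_deriv \<beta> L \<phi>"]
    by (simp only: distrib_left right_diff_distrib)
  ultimately show ?energy using P3 by argo
  \<comment> \<open>The weight x - \<beta> is zero at \<beta> and L - \<beta> at L, and its slope 1
    releases the norm.\<close>
  have P4: "2 * wip (- \<beta>) 1 \<beta> L \<phi> (weak_deriv \<beta> L \<phi>) = (L - \<beta>) * (cmod a)\<^sup>2 - L2_sqnorm \<beta> L \<phi>"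
    using wip_by_parts[OF \<beta>(2) H(4) H(4), of "- \<beta>" 1] wip_sym[of "- \<beta>" 1 \<beta> L \<phi>]
    by (simp add: bc cmod_sq_eq L2_sqnorm_eq_wip)
  have P5: "2 * wip (- \<beta>) 1 \<beta> L (weak_deriv \<beta> L wx) wx = (L - \<beta>) * (cmod w')\<^sup>2 - L2_sqnorm \<beta> L wx"
    using wip_by_parts[OF \<beta>(2) H(7) H(7), of "- \<beta>" 1] wip_sym[of "- \<beta>" 1 \<beta> L wx]
    by (simp add: pv cmod_sq_eq L2_sqnorm_eq_wip)
  have "2 * F1 U (A U) = 2 * wip (- \<beta>) 1 \<beta> L \<phi> (weak_deriv \<beta> L \<phi>)
      + \<kappa>3 * (2 * wip (- \<beta>) 1 \<beta> L (weak_deriv \<beta> L wx) wx)"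
    unfolding F1_def AU fst_conv snd_conv UU[symmetric] wx_def[symmetric]
    using M by (simp add: wip_scaleR_left)
  hence "2 * F1 U (A U) = (L - \<beta>) * (cmod a)\<^sup>2 - L2_sqnorm \<beta> L \<phi>
      + \<kappa>3 * ((L - \<beta>) * (cmod w')\<^sup>2 - L2_sqnorm \<beta> L wx)" by (simp only: P4 P5)
  thus ?F1 unfolding UU(4) wx_def UU(2) by (simp add: algebra_simps)
  \<comment> \<open>The weight 2 - \<rho> is 2 at the entrance and 1 at the exit of the delay
    line.\<close>
  have "2 * wip 2 (- 1) 0 1 \<eta> (weak_deriv 0 1 \<eta>) + wip (- 1) 0 0 1 \<eta> \<eta> = (cmod b)\<^sup>2 - 2 * (cmod a)\<^sup>2"
    using wip_by_parts[of 0 1, OF _ H(5) H(5), of 2 "- 1"] wip_sym[of 2 "- 1" 0 1 \<eta>]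
    by (simp add: pv cmod_sq_eq)
  moreover have "wip (- 1) 0 0 1 \<eta> \<eta> = - L2_sqnorm 0 1 \<eta>"
    using wip_combine[OF M(5) M(5), of "- 1" 0] by (simp add: L2_sqnorm_eq_wip)
  moreover have "F2 U (A U) = - wip 2 (- 1) 0 1 \<eta> (weak_deriv 0 1 \<eta>)"
    using M pos wip_scaleR_right[OF M(13) M(5), of 2 "- 1" "- (1 / \<tau>)"]
    unfolding F2_def AU snd_conv UU[symmetric] by simp
  ultimately show ?F2 unfolding UU(5)[symmetric] by argo
  \<comment> \<open>Again the interface terms of both sides cancel, now through v(\<beta>) =
    w(\<beta>) and the continuity of the stress.\<close>
  have P6: "wip 1 0 0 \<beta> (weak_deriv 0 \<beta> s) v + wip 1 0 0 \<beta> s vx = \<kappa>3 * Re (point_value \<beta> L wx \<beta> * cnj (point_value \<beta> L w \<beta>))"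
    using wip_by_parts[OF \<beta>(1) H(6) H(1), of 1 0] M bc by (simp add: wip_zero vx_def algebra_simps)
  have P7: "wip 1 0 \<beta> L (weak_deriv \<beta> L wx) w + L2_sqnorm \<beta> L wx
      = Re (w' * cnj wL) - Re (point_value \<beta> L wx \<beta> * cnj (point_value \<beta> L w \<beta>))"
    using wip_by_parts[OF \<beta>(2) H(7) H(2), of 1 0] M bc
    by (simp add: wip_zero pv L2_sqnorm_eq_wip flip: wx_def)
  have "F3 U (A U) = L2_sqnorm 0 \<beta> z + wip 1 0 0 \<beta> (weak_deriv 0 \<beta> s) v + L2_sqnorm \<beta> L \<phi>
      + \<kappa>3 * wip 1 0 \<beta> L (weak_deriv \<beta> L wx) w"
    unfolding F3_def AU fst_conv snd_conv UU[symmetric] using M by (simp add: wip_scaleR_left L2_sqnorm_eq_wip)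
  moreover have "wip 1 0 0 \<beta> s vx = \<kappa>2 * L2_sqnorm 0 \<beta> vx + \<delta>1 * wip 1 0 0 \<beta> zx vx"
    using s_left[OF M(8)] by (simp add: L2_sqnorm_eq_wip)
  moreover have "\<kappa>3 * wip 1 0 \<beta> L (weak_deriv \<beta> L wx) w + \<kappa>3 * L2_sqnorm \<beta> L wx
      = \<kappa>3 * Re (w' * cnj wL) - \<kappa>3 * Re (point_value \<beta> L wx \<beta> * cnj (point_value \<beta> L w \<beta>))"
    using arg_cong[OF P7, of "\<lambda>x. \<kappa>3 * x"] by (simp only: distrib_left right_diff_distrib)
  ultimately show ?F3 using P6 unfolding UU[symmetric] vx_def[symmetric] wx_def[symmetric] by argo
qed

text \<open>Each undesired term is either a small fraction of the potential energy or a multiple of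
  |z_x|^2, |a|^2 or |b|^2, and those are the terms multiplied by \<open>n\<close> in the
  dissipation.\<close>

lemma lyapunov_derivative:
  "\<exists>c>0. \<exists>N0. \<forall>n\<ge>N0. \<forall>U\<in>D.
    2 * (n * Q U (A U) + (2 * F1 U (A U) + F3 U (A U) / 2 + F2 U (A U))) \<le> - c * Q U U"
proof -
  obtain c0 where c0: "c0 > 0" and bdry: "\<And>x y. \<kappa>3 * \<delta>3 * (cmod x)\<^sup>2 + \<kappa>3 * \<delta>2 * Re (x * cnj y)
      - ((cmod x)\<^sup>2 - (cmod y)\<^sup>2) / 2 \<ge> c0 * ((cmod x)\<^sup>2 + (cmod y)\<^sup>2)"
    using negative_definite_boundary_form[OF pos(3) \<delta>3 \<delta>2] by blast
  \<comment> \<open>\<open>K\<close> bounds |w_x(L)|^2 through the feedback law, \<open>C\<close>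
    bounds |w(L)|^2 through the potential energy.\<close>
  define K where "K = 2 * (\<delta>3\<^sup>2 + \<delta>2\<^sup>2)"
  define C where "C = 2 * \<beta> / \<kappa>2 + 2 * (L - \<beta>) / \<kappa>3"
  \<comment> \<open>The total coefficient of |a|^2 + |b|^2 that the three multipliers
    generate.\<close>
  define T where "T = 2 * (L - \<beta>) * (1 + \<kappa>3 * K) + \<kappa>3\<^sup>2 * C * K + 2"
  \<comment> \<open>The coefficient of |z_x|^2: the first summand pays for the mixed term with v_x.
    The second pays twice for the norm of z, once to cancel it and once to gain it.\<close>
  define R where "R = \<delta>1\<^sup>2 / \<kappa>2 + 2 * \<beta>\<^sup>2"
  \<comment> \<open>From here on 2 n \<delta>1 is at least \<open>R\<close> and 2 n c0 is at least
    \<open>T\<close>.\<close>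
  define N0 where "N0 = R / (2 * \<delta>1) + T / (2 * c0)"
  \<comment> \<open>1/2 is the share left for the mechanical components; 1/\<tau> accounts for the
    factor \<tau> of the delay term in \<open>Q\<close>.\<close>
  define c where "c = min (1 / 2) (1 / \<tau>)"
  have C: "C > 0" using \<beta> pos by (simp add: C_def add_pos_pos)
  have K: "K \<ge> 0" by (simp add: K_def)
  have T: "T \<ge> 0" using \<beta> pos C K by (simp add: T_def)
  have R: "R \<ge> 0" using pos by (simp add: R_def)
  have c: "c > 0" using pos by (simp add: c_def)
  have "2 * (n * Q U (A U) + (2 * F1 U (A U) + F3 U (A U) / 2 + F2 U (A U))) \<le> - c * Q U U"
    if n: "n \<ge> N0" and U: "U \<in> D" for n U
  proof -
    define a b where "a = point_value 0 1 (c\<eta> U) 0" and "b = point_value 0 1 (c\<eta> U) 1"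
    define wL w' where "wL = point_value \<beta> L (cw U) L" and "w' = point_value \<beta> L (cwx U) L"
    define zx where "zx = weak_deriv 0 \<beta> (cz U)"
    note id = multiplier_identities[OF U, folded a_def b_def wL_def w'_def zx_def]
    define s where "s = (cmod a)\<^sup>2 + (cmod b)\<^sup>2"
    define Zx Vx Wx Z Ph Et where "Zx = L2_sqnorm 0 \<beta> zx" "Vx = L2_sqnorm 0 \<beta> (cvx U)" "Wx = L2_sqnorm \<beta> L (cwx U)"
      "Z = L2_sqnorm 0 \<beta> (cz U)" "Ph = L2_sqnorm \<beta> L (c\<phi> U)" "Et = L2_sqnorm 0 1 (c\<eta> U)"
    note norms = this
    have nn: "s \<ge> 0" "Zx \<ge> 0" "Vx \<ge> 0" "Wx \<ge> 0" "Z \<ge> 0" "Ph \<ge> 0" "Et \<ge> 0"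
      by (simp_all add: norms L2_sqnorm_nonneg s_def)
    have m: "cv U \<in> H1 0 \<beta>" "cw U \<in> H1 \<beta> L" "cz U \<in> H1 0 \<beta>" "c\<phi> U \<in> H1 \<beta> L"
      "point_value 0 \<beta> (cv U) 0 = 0" "point_value 0 \<beta> (cv U) \<beta> = point_value \<beta> L (cw U) \<beta>"
      "point_value 0 \<beta> (cz U) 0 = 0" "point_value 0 \<beta> (cz U) \<beta> = point_value \<beta> L (c\<phi> U) \<beta>"
      "w' = - of_real \<delta>3 * a - of_real \<delta>2 * b"
      using U unfolding D_iff a_def b_def w'_def by auto
    have zv: "zx \<in> L2 0 \<beta>" "cvx U \<in> L2 0 \<beta>" using m \<beta> by (auto simp: zx_def)
    \<comment> \<open>Poincare for the velocities (z, \<phi>): the damping controls the kinetic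
      energy on its side of the string.\<close>
    have Z: "Z \<le> \<beta>\<^sup>2 * Zx"
      using Poincare(1)[OF m(3,4,7,8)] by (simp add: norms zx_def power2_eq_square)
    have "(cmod wL)\<^sup>2 \<le> 2 * \<beta> * Vx + 2 * (L - \<beta>) * Wx"
      using Poincare(2)[OF m(1,2,5,6), of L] \<beta> by (simp add: wL_def norms)
    also have "\<dots> \<le> C * (\<kappa>2 * Vx + \<kappa>3 * Wx)"
    proof -
      have "C * (\<kappa>2 * Vx + \<kappa>3 * Wx) = (2 * \<beta> * Vx + 2 * (L - \<beta>) * Wx)
          + (2 * (L - \<beta>) / \<kappa>3 * (\<kappa>2 * Vx) + 2 * \<beta> / \<kappa>2 * (\<kappa>3 * Wx))"
        using pos by (simp add: C_def field_simps)
      moreover have "0 \<le> 2 * (L - \<beta>) / \<kappa>3 * (\<kappa>2 * Vx) + 2 * \<beta> / \<kappa>2 * (\<kappa>3 * Wx)"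
        using \<beta> pos nn by (intro add_nonneg_nonneg mult_nonneg_nonneg) auto
      ultimately show ?thesis by linarith
    qed
    finally have wL: "(cmod wL)\<^sup>2 / (4 * C) \<le> (\<kappa>2 * Vx + \<kappa>3 * Wx) / 4" using C by (simp add: field_simps)
    have "(cmod w')\<^sup>2 \<le> 2 * (cmod (of_real \<delta>3 * a))\<^sup>2 + 2 * (cmod (of_real \<delta>2 * b))\<^sup>2"
      using sum_sq_le[of "- of_real \<delta>3 * a" "- of_real \<delta>2 * b"] m(9) by simp
    also have "\<dots> = 2 * \<delta>3\<^sup>2 * (cmod a)\<^sup>2 + 2 * \<delta>2\<^sup>2 * (cmod b)\<^sup>2"
      by (simp add: norm_mult power_mult_distrib)
    also have "\<dots> \<le> K * s" by (simp add: K_def s_def algebra_simps)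
    finally have w': "(cmod w')\<^sup>2 \<le> K * s" .
    \<comment> \<open>Young's inequality with weight 4 C, so that w(L) uses up only a quarter of the
      potential energy.\<close>
    have "\<kappa>3 * Re (w' * cnj wL) \<le> \<kappa>3 * (cmod w' * cmod wL)"
      using pos complex_Re_le_cmod[of "w' * cnj wL"] by (intro mult_left_mono) (simp_all only: norm_mult complex_mod_cnj less_imp_le)
    also have "\<dots> \<le> \<kappa>3\<^sup>2 * C * (cmod w')\<^sup>2 + (cmod wL)\<^sup>2 / (4 * C)"
    proof -
      have "0 \<le> (2 * \<kappa>3 * C * cmod w' - cmod wL)\<^sup>2 / (4 * C)" using C by simp
      also have "\<dots> = \<kappa>3\<^sup>2 * C * (cmod w')\<^sup>2 + (cmod wL)\<^sup>2 / (4 * C) - \<kappa>3 * (cmod w' * cmod wL)"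
        using C by (simp add: field_simps power2_eq_square)
      finally show ?thesis by simp
    qed
    also have "\<dots> \<le> \<kappa>3\<^sup>2 * C * (K * s) + (\<kappa>2 * Vx + \<kappa>3 * Wx) / 4"
      using w' wL C by (intro add_mono mult_left_mono) auto
    finally have re: "\<kappa>3 * Re (w' * cnj wL) \<le> \<kappa>3\<^sup>2 * C * (K * s) + (\<kappa>2 * Vx + \<kappa>3 * Wx) / 4" .
    \<comment> \<open>The Young weight 2 \<delta>1 / \<kappa>2 leaves exactly \<kappa>2 / 4 in front
      of the norm of v_x.\<close>
    have "- \<delta>1 * wip 1 0 0 \<beta> zx (cvx U) \<le> \<delta>1 * \<bar>wip 1 0 0 \<beta> zx (cvx U)\<bar>"
      using pos abs_ge_minus_self[of "\<delta>1 * wip 1 0 0 \<beta> zx (cvx U)"] by (simp add: abs_mult)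
    also have "\<dots> \<le> \<delta>1 * ((2 * \<delta>1 / \<kappa>2 * Zx + Vx / (2 * \<delta>1 / \<kappa>2)) / 2)"
      unfolding norms using pos by (intro mult_left_mono wip_young zv) auto
    also have "\<dots> = \<delta>1\<^sup>2 / \<kappa>2 * Zx + \<kappa>2 * Vx / 4" using pos by (simp add: field_simps power2_eq_square)
    finally have cross: "- \<delta>1 * wip 1 0 0 \<beta> zx (cvx U) \<le> \<delta>1\<^sup>2 / \<kappa>2 * Zx + \<kappa>2 * Vx / 4" .
    have "N0 \<ge> 0" using R T pos c0 by (simp add: N0_def)
    hence n0: "n \<ge> 0" using n by simp
    have nR: "R \<le> 2 * n * \<delta>1"
    proof -
      have "0 \<le> T / (2 * c0)" using T c0 by simp
      hence "R / (2 * \<delta>1) \<le> n" using n unfolding N0_def by linarith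
      thus ?thesis using pos by (simp add: field_simps)
    qed
    have nT: "T \<le> 2 * n * c0"
    proof -
      have "0 \<le> R / (2 * \<delta>1)" using R pos by simp
      hence "T / (2 * c0) \<le> n" using n unfolding N0_def by linarith
      thus ?thesis using c0 by (simp add: field_simps)
    qed
    have "Q U (A U) \<le> - \<delta>1 * Zx - c0 * s" unfolding id(1) norms s_def using bdry[of a b] by linarith
    hence "2 * n * Q U (A U) \<le> 2 * n * (- \<delta>1 * Zx - c0 * s)" using n0 by (intro mult_left_mono) auto
    also have "\<dots> = - (2 * n * \<delta>1 * Zx) - 2 * n * c0 * s" by (simp add: algebra_simps)
    also have "\<dots> \<le> - (R * Zx) - T * s"
      using mult_right_mono[OF nR nn(2)] mult_right_mono[OF nT nn(1)] by linarith
    finally have e1: "2 * n * Q U (A U) \<le> - (R * Zx) - T * s" .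
    have "(cmod a)\<^sup>2 + \<kappa>3 * (cmod w')\<^sup>2 \<le> s + \<kappa>3 * (K * s)"
      using w' pos by (intro add_mono mult_left_mono) (auto simp: s_def)
    hence "(L - \<beta>) * ((cmod a)\<^sup>2 + \<kappa>3 * (cmod w')\<^sup>2) \<le> (L - \<beta>) * (s + \<kappa>3 * (K * s))"
      using \<beta> by (intro mult_left_mono) auto
    hence e2: "2 * (2 * F1 U (A U)) \<le> 2 * ((L - \<beta>) * (s + \<kappa>3 * (K * s))) - 2 * Ph - 2 * (\<kappa>3 * Wx)"
      unfolding id(2) norms by argo
    have e3: "F3 U (A U) \<le> Z + Ph - \<kappa>2 * Vx + \<delta>1\<^sup>2 / \<kappa>2 * Zx + \<kappa>2 * Vx / 4 - \<kappa>3 * Wx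
        + \<kappa>3\<^sup>2 * C * (K * s) + (\<kappa>2 * Vx + \<kappa>3 * Wx) / 4"
      using re cross unfolding id(4) norms by linarith
    have e4: "2 * F2 U (A U) \<le> 2 * s - Et"
      unfolding id(3) norms s_def by simp
    have Ts: "T * s = 2 * ((L - \<beta>) * (s + \<kappa>3 * (K * s))) + \<kappa>3\<^sup>2 * C * (K * s) + 2 * s"
      by (simp add: T_def algebra_simps)
    have Rz: "R * Zx = \<delta>1\<^sup>2 / \<kappa>2 * Zx + 2 * (\<beta>\<^sup>2 * Zx)" by (simp add: R_def algebra_simps)
    have kk: "\<kappa>2 * Vx \<ge> 0" "\<kappa>3 * Wx \<ge> 0" using pos nn by auto
    have "2 * (n * Q U (A U) + (2 * F1 U (A U) + F3 U (A U) / 2 + F2 U (A U)))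
        = 2 * n * Q U (A U) + 2 * (2 * F1 U (A U)) + F3 U (A U) + 2 * F2 U (A U)"
      by (simp add: algebra_simps)
    \<comment> \<open>Balance of coefficients: v_x has -1 + 1/4 + 1/4, w_x has -2 - 1 + 1/4, \<phi>
      has -2 + 1, z has 1 - 2; each is at most -1/2.\<close>
    also have "\<dots> \<le> - (1 / 2 * (\<kappa>2 * Vx + \<kappa>3 * Wx + Z + Ph)) - Et"
      using e1 e2 e3 e4 Ts Rz Z kk nn by argo
    also have "\<dots> \<le> - (c * (\<kappa>2 * Vx + \<kappa>3 * Wx + Z + Ph)) - c * (\<tau> * Et)"
    proof -
      have "c * (\<kappa>2 * Vx + \<kappa>3 * Wx + Z + Ph) \<le> 1 / 2 * (\<kappa>2 * Vx + \<kappa>3 * Wx + Z + Ph)"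
        using kk nn by (intro mult_right_mono) (auto simp: c_def)
      moreover have "c * (\<tau> * Et) \<le> 1 / \<tau> * (\<tau> * Et)"
        using pos nn by (intro mult_right_mono) (auto simp: c_def)
      hence "c * (\<tau> * Et) \<le> Et" using pos by simp
      ultimately show ?thesis by linarith
    qed
    also have "\<dots> = - c * Q U U" by (simp add: Q_diag norms algebra_simps)
    finally show ?thesis .
  qed
  with c show ?thesis by blast
qed

theorem exponentially_stable:
  assumes "generates_C0_semigroup X (energy_norm \<beta> L \<tau> \<kappa>2 \<kappa>3) D A S"
  shows "\<exists>M \<epsilon>. M > 0 \<and> \<epsilon> > 0 \<and> (\<forall>t>0. \<forall>U\<in>X. energy_norm \<beta> L \<tau> \<kappa>2 \<kappa>3 (S t U)
    \<le> M * exp (- \<epsilon> * t) * energy_norm \<beta> L \<tau> \<kappa>2 \<kappa>3 U)"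
proof -
  have N: "energy_norm \<beta> L \<tau> \<kappa>2 \<kappa>3 = N"
    by (simp add: energy_norm_eq N_def fun_eq_iff)
  interpret hilbert_semigroup X Q S D A
    by unfold_locales (use assms N in simp)
  obtain c N0 where c: "c > 0" and deriv: "\<And>n U. n \<ge> N0 \<Longrightarrow> U \<in> D \<Longrightarrow>
      2 * (n * Q U (A U) + (2 * F1 U (A U) + F3 U (A U) / 2 + F2 U (A U))) \<le> - c * Q U U"
    using lyapunov_derivative by meson
  obtain K where K: "K \<ge> 0" "\<And>U. U \<in> X \<Longrightarrow> \<bar>2 * F1 U U + F3 U U / 2 + F2 U U\<bar> \<le> K * Q U U"
    using multipliers_bounded by meson
  \<comment> \<open>N0 ensures the decay, and K + 1 makes the functional at least
    \<open>Q\<close>.\<close>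
  define n where "n = max N0 (K + 1)"
  define V where "V U W = n * Q U W + (2 * F1 U W + 1 / 2 * F3 U W + F2 U W)" for U W
  have bil: "sym_bilinear_on X V"
    unfolding V_def[abs_def]
    by (intro sym_bilinear_on_add sym_bilinear_on_cmult F_bilinear Q_bilinear)
  have nK: "n \<ge> K + 1" "n \<ge> N0" by (simp_all add: n_def)
  have lo: "1 * Q U U \<le> V U U" and up: "V U U \<le> (n + K) * Q U U" if "U \<in> X" for U
  proof -
    have "(K + 1) * Q U U \<le> n * Q U U" using nK Q_nonneg by (intro mult_right_mono) auto
    thus "1 * Q U U \<le> V U U" using K(2)[OF that] by (simp add: V_def distrib_right abs_le_iff)
    show "V U U \<le> (n + K) * Q U U" using K(2)[OF that] by (simp add: V_def distrib_right abs_le_iff)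
  qed
  have nKp: "n + K > 0" using nK K by simp
  \<comment> \<open>The derivative is bounded in terms of \<open>Q\<close>; the upper comparison V
    \<le> (n + K) Q turns it into a bound in terms of \<open>V\<close> with rate c / (n +
    K).\<close>
  have ly: "2 * V U (A U) \<le> - (c / (n + K)) * V U U" if U: "U \<in> D" for U
  proof -
    have "c / (n + K) * V U U \<le> c / (n + K) * ((n + K) * Q U U)"
      using up[of U] U c nKp by (intro mult_left_mono) auto
    hence "c / (n + K) * V U U \<le> c * Q U U" using nKp by simp
    moreover have "2 * V U (A U) \<le> - c * Q U U" using deriv[OF nK(2) U] by (simp add: V_def)
    ultimately show ?thesis by simp
  qed
  show ?thesis unfolding N
    by (rule exponential_decay[OF bil lo up _ _ ly]) (use c nKp D_dense in \<open>simp_all add: N_def\<close>)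
qed

end

theorem theorem2p14:
  fixes \<beta> L \<tau> \<kappa>2 \<kappa>3 \<delta>1 \<delta>2 \<delta>3 :: real
    and S :: "real \<Rightarrow> state \<Rightarrow> state"
  assumes "0 < \<beta>" and "\<beta> < L" and "\<tau> > 0" and "\<kappa>2 > 0" and "\<kappa>3 > 0"
    and "\<delta>1 > 0" and "\<delta>3 > 0" and "\<delta>2 \<noteq> 0"
    and "\<delta>3 > 1 / (2 * \<kappa>3)"
    and "\<bar>\<delta>2\<bar> < (1 / \<kappa>3) * sqrt (2 * \<kappa>3 * \<delta>3 - 1)"
    and "generates_C0_semigroup (energy_space \<beta> L) (energy_norm \<beta> L \<tau> \<kappa>2 \<kappa>3)
           (dom_A \<beta> L \<kappa>2 \<kappa>3 \<delta>1 \<delta>2 \<delta>3) (op_A \<beta> L \<tau> \<kappa>2 \<kappa>3 \<delta>1) S"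
  shows "\<exists>M \<epsilon>. M > 0 \<and> \<epsilon> > 0 \<and>
    (\<forall>t>0. \<forall>U0\<in>energy_space \<beta> L.
       energy_norm \<beta> L \<tau> \<kappa>2 \<kappa>3 (S t U0)
         \<le> M * exp (- \<epsilon> * t) * energy_norm \<beta> L \<tau> \<kappa>2 \<kappa>3 U0)"
proof -
  interpret kelvin_voigt \<beta> L \<tau> \<kappa>2 \<kappa>3 \<delta>1 \<delta>2 \<delta>3
    using assms by unfold_locales auto
  show ?thesis using assms by (intro exponentially_stable) auto
qed

end
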